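(* Let $W_1=x_0^2+f_1(x_1,\dots,x_n)$ and $W_2=y_0^2+f_2(y_1,\dots,y_m)$ be invertible polynomials in disjoint sets of variables, each satisfying the Calabi--Yau condition, let $W=W_1+W_2$, and let $G$ be a group with $J_{W_1}\times J_{W_2}\subseteq G\subseteq \mathrm{SL}_{W_1}\times \mathrm{SL}_{W_2}$. Let $\Sigma G$ be the group generated by $G$ and $\sigma$, and let $\Sigma G^T$ be the group generated by $G^T$ and $\sigma$, where $\sigma$ is the involution $(x_0,y_0)\mapsto(-x_0,-y_0)$ fixing all other variables. Then there is an isomorphism of vector spaces $$\mathscr{A}_{W,\Sigma G}\cong \mathscr{B}_{W^T,\Sigma G^T}$$ which preserves the bi-degree (A-model bi-degree on the left, B-model bi-degree on the right).
   Context: Polynomials and groups. A polynomial $W\in\mathbb{C}[z_1,\dots,z_N]$ is quasihomogeneous if there are positive rational weights $q_j=w_j/d$ (with $\gcd(w_1,\dots,w_N)=1$) such that every monomial of $W$ has weighted degree $1$; the tuple $(w_1,\dots,w_N;d)$ is its weight system. It is nondegenerate (admissible) if it has an isolated singularity at the origin and the weights $q_j$ are uniquely determined; it is invertible if moreover the number of monomials equals the number of variables. By rescaling variables all coefficients may be taken to be $1$. $G_W^{max}$ is the group of $g=(g_1,\dots,g_N)\in(\mathbb{Q}/\mathbb{Z})^N$ with $W(e^{2\pi i g_1}z_1,\dots,e^{2\pi i g_N}z_N)=W(z_1,\dots,z_N)$; it acts on $\mathbb{C}^N$ diagonally. The exponential grading operator is $\mathfrak{j}_W=(q_1,\dots,q_N)\in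 G_W^{max}$ and $J_W=\langle\mathfrak{j}_W\rangle$. With representatives $0\le g_j<1$, $\mathrm{age}\,g=\sum_j g_j$, and $\mathrm{SL}_W=\{g\in G_W^{max}:\mathrm{age}\,g\in\mathbb{Z}\}$. The Calabi--Yau condition for $W$ is $\sum_j q_j=1$, i.e. $\mathrm{age}\,\mathfrak{j}_W=1$. Transposes. For invertible $W=\sum_{i=1}^N\prod_j z_j^{a_{ij}}$ with exponent matrix $A_W=(a_{ij})$, the polynomial $W^T=\sum_{i=1}^N\prod_j z_j^{a_{ji}}$ has exponent matrix $A_W^T$. For a subgroup $G\subseteq G_W^{max}$, $G^T=\{g\in G_{W^T}^{max}: gA_Wh^T\in\mathbb{Z}\text{ for all }h\in G\}$ (elements regarded as row vectors). The element $\sigma=(1/2,0,\dots,0,1/2,0,\dots,0)$ (entries $1/2$ in the positions of $x_0$ and $y_0$) lies in both $G_W^{max}$ and $G_{W^T}^{max}$. The notation $\Sigma G^T$ means $\Sigma(G^T)$. State spaces. For $g\in G_W^{max}$ let $\mathrm{Fix}(g)\subseteq\mathbb{C}^N$ be its fixed locus, $N_g=\dim\mathrm{Fix}(g)$, $I_g$ the set of indices of fixed variables, $W_g=W|_{\mathrm{Fix}(g)}$, $\mathscr{Q}_g=\mathbb{C}[z_i:i\in I_g]/(\partial W_g/\partial z_i)$ the Milnor ring of $W_g$ (equal to $\mathbb{C}$ if $I_g=\emptyset$), and $\omega_g=\bigwedge_{i\in I_g}dz_i$. $G_W^{max}$ acts on $\mathscr{Q}_g\omega_g$ by acting on both monomials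 and the volume form: $h$ multiplies $\prod_{i\in I_g} z_i^{a_i}\,\omega_g$ by $\exp(2\pi i\sum_{i\in I_g}(a_i+1)h_i)$. For a group $H$ with $J_W\subseteq H\subseteq G_W^{max}$ (A-admissible), $\mathscr{A}_{W,H}=\bigoplus_{g\in H}(\mathscr{Q}_g\omega_g)^H$. For a group $H\subseteq \mathrm{SL}_W$ (B-admissible), $\mathscr{B}_{W,H}$ is the same expression $\bigoplus_{g\in H}(\mathscr{Q}_g\omega_g)^H$. A basis consists of elements $\lceil m;g\rfloor$ with $m=\prod_{i\in I_g}z_i^{a_i}\,\omega_g$; put $\deg m=\sum_{i\in I_g}(a_i+1)q_i$. The A-model bi-degree of $\lceil m;g\rfloor$ is $(\deg m+\mathrm{age}\,g-\mathrm{age}\,\mathfrak{j}_W,\ N_g-\deg m+\mathrm{age}\,g-\mathrm{age}\,\mathfrak{j}_W)$; the B-model bi-degree is $(\deg m+\mathrm{age}\,g-\mathrm{age}\,\mathfrak{j}_W,\ \deg m+\mathrm{age}\,g^{-1}-\mathrm{age}\,\mathfrak{j}_W)$. *)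

theory Defs
  imports
    "HOL-Analysis.Analysis"
    "HOL-Library.Poly_Mapping"
    "HOL-Algebra.Generated_Groups"
    "HOL-Algebra.QuotRing"
    "Jordan_Normal_Form.VS_Connect"
begin

section \<open>Multivariate polynomials over a set of variables\<close>

text \<open>The monomial with exponent vector \<open>m\<close> is the key \<open>m\<close>. The number of variables is not part
  of the type: the ring of polynomials in the variables \<open>V\<close> consists of the polynomials in which
  only variables from \<open>V\<close> occur.\<close>

type_synonym 'v exponent = "'v \<Rightarrow>\<^sub>0 nat"
type_synonym 'v mpoly = "'v exponent \<Rightarrow>\<^sub>0 complex"

definition mpoly_vars :: "'v mpoly \<Rightarrow> 'v set" where
  "mpoly_vars p = (\<Union>m\<in>Poly_Mapping.keys p. Poly_Mapping.keys m)"

definition mpoly_eval :: "('v \<Rightarrow> complex) \<Rightarrow> 'v mpoly \<Rightarrow> complex" where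
  "mpoly_eval z p = (\<Sum>m\<in>Poly_Mapping.keys p.
     Poly_Mapping.lookup p m * (\<Prod>j\<in>Poly_Mapping.keys m. z j ^ Poly_Mapping.lookup m j))"

text \<open>In the summands with \<open>lookup m j = 0\<close> the truncated exponent is harmless, since the
  coefficient vanishes.\<close>

definition mpoly_deriv :: "'v \<Rightarrow> 'v mpoly \<Rightarrow> 'v mpoly" where
  "mpoly_deriv j p = (\<Sum>m\<in>Poly_Mapping.keys p.
     Poly_Mapping.single (m - Poly_Mapping.single j 1)
       (of_nat (Poly_Mapping.lookup m j) * Poly_Mapping.lookup p m))"

definition mpoly_square :: "'v \<Rightarrow> 'v mpoly" where
  "mpoly_square x = Poly_Mapping.single (Poly_Mapping.single x 2) 1"

definition mpoly_ring :: "'v set \<Rightarrow> 'v mpoly ring" where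
  "mpoly_ring V = \<lparr>carrier = {p. mpoly_vars p \<subseteq> V}, mult = (*), one = 1, zero = 0, add = (+)\<rparr>"


section \<open>Invertible polynomials\<close>

text \<open>Weight functions vanish outside \<open>V\<close>, so that uniqueness is meaningful.\<close>

definition is_weights :: "'v set \<Rightarrow> 'v mpoly \<Rightarrow> ('v \<Rightarrow> rat) \<Rightarrow> bool" where
  "is_weights V W q \<longleftrightarrow> (\<forall>j\<in>V. q j > 0) \<and> (\<forall>j. j \<notin> V \<longrightarrow> q j = 0) \<and>
     (\<forall>m\<in>Poly_Mapping.keys W. (\<Sum>j\<in>V. q j * of_nat (Poly_Mapping.lookup m j)) = 1)"

definition weights :: "'v set \<Rightarrow> 'v mpoly \<Rightarrow> 'v \<Rightarrow> rat" where
  "weights V W = (THE q. is_weights V W q)"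

definition quasihomogeneous :: "'v set \<Rightarrow> 'v mpoly \<Rightarrow> bool" where
  "quasihomogeneous V W \<longleftrightarrow> (\<exists>q. is_weights V W q)"

definition critical_point :: "'v set \<Rightarrow> 'v mpoly \<Rightarrow> ('v \<Rightarrow> complex) \<Rightarrow> bool" where
  "critical_point V W z \<longleftrightarrow> (\<forall>j\<in>V. mpoly_eval z (mpoly_deriv j W) = 0)"

definition isolated_singularity_at_origin :: "'v set \<Rightarrow> 'v mpoly \<Rightarrow> bool" where
  "isolated_singularity_at_origin V W \<longleftrightarrow> critical_point V W (\<lambda>_. 0) \<and>
     (\<exists>\<epsilon>>0. \<forall>z. (\<forall>j\<in>V. cmod (z j) < \<epsilon>) \<and> critical_point V W z \<longrightarrow> (\<forall>j\<in>V. z j = 0))"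

definition nondegenerate :: "'v set \<Rightarrow> 'v mpoly \<Rightarrow> bool" where
  "nondegenerate V W \<longleftrightarrow> finite V \<and> W \<in> carrier (mpoly_ring V) \<and> quasihomogeneous V W \<and>
     isolated_singularity_at_origin V W \<and> (\<exists>!q. is_weights V W q)"

definition invertible_poly :: "'v set \<Rightarrow> 'v mpoly \<Rightarrow> bool" where
  "invertible_poly V W \<longleftrightarrow> nondegenerate V W \<and> card (Poly_Mapping.keys W) = card V"

definition calabi_yau :: "'v set \<Rightarrow> 'v mpoly \<Rightarrow> bool" where
  "calabi_yau V W \<longleftrightarrow> (\<Sum>j\<in>V. weights V W j) = 1"

text \<open>An exponent matrix enumerates the monomials of \<open>W\<close> by the variables: row \<open>i \<in> V\<close> is the
  exponent vector \<open>A i\<close>, with entries \<open>a\<^sub>i\<^sub>j = lookup (A i) j\<close>.\<close>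

definition exponent_matrix :: "'v set \<Rightarrow> 'v mpoly \<Rightarrow> ('v \<Rightarrow> 'v exponent) \<Rightarrow> bool" where
  "exponent_matrix V W A \<longleftrightarrow> bij_betw A V (Poly_Mapping.keys W)"

definition transpose_poly :: "'v set \<Rightarrow> ('v \<Rightarrow> 'v exponent) \<Rightarrow> 'v mpoly" where
  "transpose_poly V A =
     (\<Sum>i\<in>V. Poly_Mapping.single (\<Sum>j\<in>V. Poly_Mapping.single j (Poly_Mapping.lookup (A j) i)) 1)"


section \<open>Diagonal symmetry groups\<close>

text \<open>The group \<open>(\<rat>/\<int>)\<^sup>V\<close>. Classes are given by their representatives in \<open>[0, 1)\<close>, and a tuple is
  extended by \<open>0\<close> outside \<open>V\<close>; thus \<open>(\<rat>/\<int>)\<^sup>V \<subseteq> (\<rat>/\<int>)\<^sup>V\<^sup>'\<close> for \<open>V \<subseteq> V'\<close>.\<close>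

definition QZ_group :: "'v set \<Rightarrow> ('v \<Rightarrow> rat) monoid" where
  "QZ_group V = \<lparr>carrier = {g. (\<forall>j\<in>V. 0 \<le> g j \<and> g j < 1) \<and> (\<forall>j. j \<notin> V \<longrightarrow> g j = 0)},
     mult = (\<lambda>g h j. frac (g j + h j)), one = (\<lambda>_. 0)\<rparr>"

definition G_max :: "'v set \<Rightarrow> 'v mpoly \<Rightarrow> ('v \<Rightarrow> rat) set" where
  "G_max V W = {g \<in> carrier (QZ_group V).
     \<forall>z. mpoly_eval (\<lambda>j. cis (2 * pi * of_rat (g j)) * z j) W = mpoly_eval z W}"

definition age :: "'v set \<Rightarrow> ('v \<Rightarrow> rat) \<Rightarrow> rat" where
  "age V g = (\<Sum>j\<in>V. g j)"

definition grading_op :: "'v set \<Rightarrow> 'v mpoly \<Rightarrow> 'v \<Rightarrow> rat" where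
  "grading_op V W = (\<lambda>j. frac (weights V W j))"

definition J_group :: "'v set \<Rightarrow> 'v mpoly \<Rightarrow> ('v \<Rightarrow> rat) set" where
  "J_group V W = generate (QZ_group V) {grading_op V W}"

definition SL_group :: "'v set \<Rightarrow> 'v mpoly \<Rightarrow> ('v \<Rightarrow> rat) set" where
  "SL_group V W = {g \<in> G_max V W. age V g \<in> \<int>}"

text \<open>Product of groups acting on disjoint sets of variables: a pair \<open>(g, h)\<close> becomes the tuple
  \<open>g + h\<close>, since each component vanishes on the variables of the other.\<close>

definition group_prod :: "('v \<Rightarrow> rat) set \<Rightarrow> ('v \<Rightarrow> rat) set \<Rightarrow> ('v \<Rightarrow> rat) set" where
  "group_prod H1 H2 = {\<lambda>j. g j + h j | g h. g \<in> H1 \<and> h \<in> H2}"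

definition transpose_group ::
  "'v set \<Rightarrow> ('v \<Rightarrow> 'v exponent) \<Rightarrow> ('v \<Rightarrow> rat) set \<Rightarrow> ('v \<Rightarrow> rat) set" where
  "transpose_group V A G = {g \<in> G_max V (transpose_poly V A).
     \<forall>h\<in>G. (\<Sum>i\<in>V. \<Sum>j\<in>V. g i * of_nat (Poly_Mapping.lookup (A i) j) * h j) \<in> \<int>}"

definition sigma :: "'v \<Rightarrow> 'v \<Rightarrow> 'v \<Rightarrow> rat" where
  "sigma x0 y0 = (\<lambda>j. if j = x0 \<or> j = y0 then 1/2 else 0)"

definition Sigma_group :: "'v set \<Rightarrow> 'v \<Rightarrow> 'v \<Rightarrow> ('v \<Rightarrow> rat) set \<Rightarrow> ('v \<Rightarrow> rat) set" where
  "Sigma_group V x0 y0 G = generate (QZ_group V) (insert (sigma x0 y0) G)"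


section \<open>State spaces\<close>

text \<open>\<open>fixed_vars V g\<close> is the index set \<open>I\<^sub>g\<close>; the fixed locus of \<open>g\<close> is the coordinate subspace
  of \<open>\<complex>\<^sup>V\<close> on these variables, so its dimension is \<open>N\<^sub>g = card (fixed_vars V g)\<close>, and restricting
  \<open>W\<close> to it keeps exactly the monomials in these variables.\<close>

definition fixed_vars :: "'v set \<Rightarrow> ('v \<Rightarrow> rat) \<Rightarrow> 'v set" where
  "fixed_vars V g = {j \<in> V. g j = 0}"

definition restrict_poly :: "'v set \<Rightarrow> 'v mpoly \<Rightarrow> 'v mpoly" where
  "restrict_poly I W = (\<Sum>m\<in>{m \<in> Poly_Mapping.keys W. Poly_Mapping.keys m \<subseteq> I}.
     Poly_Mapping.single m (Poly_Mapping.lookup W m))"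

definition jacobian_ideal :: "'v set \<Rightarrow> 'v mpoly \<Rightarrow> 'v mpoly set" where
  "jacobian_ideal I W = genideal (mpoly_ring I) ((\<lambda>i. mpoly_deriv i (restrict_poly I W)) ` I)"

definition milnor_ring :: "'v set \<Rightarrow> 'v mpoly \<Rightarrow> 'v mpoly set ring" where
  "milnor_ring I W = mpoly_ring I Quot jacobian_ideal I W"

definition milnor_class :: "'v set \<Rightarrow> 'v mpoly \<Rightarrow> 'v mpoly \<Rightarrow> 'v mpoly set" where
  "milnor_class I W f = jacobian_ideal I W +>\<^bsub>mpoly_ring I\<^esub> f"

text \<open>Elements of \<open>\<Q>\<^sub>g \<omega>\<^sub>g\<close> are represented by their coefficient in \<open>\<Q>\<^sub>g\<close>. The volume form \<open>\<omega>\<^sub>g\<close>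
  only enters through the summand \<open>1\<close> in the following action of \<open>h\<close> on \<open>\<complex>[z\<^sub>i : i \<in> I] \<omega>\<close>; it
  acts on a class of the Milnor ring by taking the image of the coset.\<close>

definition form_action :: "'v set \<Rightarrow> ('v \<Rightarrow> rat) \<Rightarrow> 'v mpoly \<Rightarrow> 'v mpoly" where
  "form_action I h f = (\<Sum>m\<in>Poly_Mapping.keys f. Poly_Mapping.single m
     (cis (2 * pi * of_rat (\<Sum>i\<in>I. (of_nat (Poly_Mapping.lookup m i) + 1) * h i))
       * Poly_Mapping.lookup f m))"

definition sector :: "'v set \<Rightarrow> 'v mpoly \<Rightarrow> ('v \<Rightarrow> rat) set \<Rightarrow> ('v \<Rightarrow> rat) \<Rightarrow> 'v mpoly set set" where
  "sector V W H g = {C \<in> carrier (milnor_ring (fixed_vars V g) W).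
     \<forall>h\<in>H. form_action (fixed_vars V g) h ` C = C}"

text \<open>The direct sum of all sectors, as a complex vector space: an element is a family of classes
  indexed by \<open>H\<close>. Multiplication by a scalar \<open>c\<close> is multiplication by the class of the constant
  \<open>c\<close> in the Milnor ring. The fields \<open>mult\<close> and \<open>one\<close> of the record play no role.\<close>

definition state_space ::
  "'v set \<Rightarrow> 'v mpoly \<Rightarrow> ('v \<Rightarrow> rat) set \<Rightarrow> (complex, ('v \<Rightarrow> rat) \<Rightarrow> 'v mpoly set) module" where
  "state_space V W H = (let Q = (\<lambda>g. milnor_ring (fixed_vars V g) W) in
     \<lparr>carrier = {s \<in> (\<Pi>\<^sub>E g\<in>H. sector V W H g). finite {g \<in> H. s g \<noteq> \<zero>\<^bsub>Q g\<^esub>}},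
      mult = undefined, one = undefined,
      zero = (\<lambda>g\<in>H. \<zero>\<^bsub>Q g\<^esub>),
      add = (\<lambda>s t. \<lambda>g\<in>H. s g \<oplus>\<^bsub>Q g\<^esub> t g),
      smult = (\<lambda>c s. \<lambda>g\<in>H.
        milnor_class (fixed_vars V g) W (Poly_Mapping.single 0 c) \<otimes>\<^bsub>Q g\<^esub> s g)\<rparr>)"

definition form_degree :: "'v set \<Rightarrow> 'v mpoly \<Rightarrow> 'v exponent \<Rightarrow> ('v \<Rightarrow> rat) \<Rightarrow> rat" where
  "form_degree V W m g =
     (\<Sum>i\<in>fixed_vars V g. (of_nat (Poly_Mapping.lookup m i) + 1) * weights V W i)"

definition A_bidegree :: "'v set \<Rightarrow> 'v mpoly \<Rightarrow> 'v exponent \<Rightarrow> ('v \<Rightarrow> rat) \<Rightarrow> rat \<times> rat" where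
  "A_bidegree V W m g =
     (form_degree V W m g + age V g - age V (grading_op V W),
      of_nat (card (fixed_vars V g)) - form_degree V W m g + age V g - age V (grading_op V W))"

definition B_bidegree :: "'v set \<Rightarrow> 'v mpoly \<Rightarrow> 'v exponent \<Rightarrow> ('v \<Rightarrow> rat) \<Rightarrow> rat \<times> rat" where
  "B_bidegree V W m g =
     (form_degree V W m g + age V g - age V (grading_op V W),
      form_degree V W m g + age V (inv\<^bsub>QZ_group V\<^esub> g) - age V (grading_op V W))"

text \<open>The subspace of elements of bi-degree \<open>d\<close>: in each sector, classes of linear combinations of
  monomials \<open>m\<close> for which \<open>m\<omega>\<^sub>g\<close> has bi-degree \<open>d\<close>.\<close>

definition homogeneous_part ::
  "'v set \<Rightarrow> 'v mpoly \<Rightarrow> ('v \<Rightarrow> rat) set \<Rightarrow> ('v exponent \<Rightarrow> ('v \<Rightarrow> rat) \<Rightarrow> rat \<times> rat) \<Rightarrow> rat \<times> rat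
    \<Rightarrow> (('v \<Rightarrow> rat) \<Rightarrow> 'v mpoly set) set" where
  "homogeneous_part V W H bideg d = {s \<in> carrier (state_space V W H).
     \<forall>g\<in>H. \<exists>f\<in>carrier (mpoly_ring (fixed_vars V g)).
       s g = milnor_class (fixed_vars V g) W f \<and> (\<forall>m\<in>Poly_Mapping.keys f. bideg m g = d)}"

end

(* Under the Calabi-Yau condition an invertible polynomial is, up to coefficients, a sum of
   terms z_i^(a_i) z_(nx i) with a_i >= 2 and a partial injection nx, that is, of chains and
   loops. Their Jacobian ideals are generated by binomials and monomials, so that on monomials the
   relations are moves in a graph: if m + 1 = A^T e, a relation moves one unit of e between
   neighbouring variables. Monomials with 0 <= e <= 1 and suitable conditions at the entries 0 and 1
   form a basis of the Milnor ring; linear independence is shown by explicit dual functionals.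
   Krawitz duality exchanges the sector g with the fractional part of e. It is an involution up to
   transposition, matches the bidegrees, and identifies invariance under a group H with
   membership of the dual sector in H^T.
   The groups Sigma G and Sigma (G^T) are not transposes of each other. Since x_0 and y_0 only
   occur as squares, the pairs with sector in the coset sigma G can be corrected by exchanging, in
   x_0 and y_0, the fixed and the moved variable before dualising. The identity G^TT = G
   follows from character sums. *)
theory Submission
  imports Defs
begin

text \<open>The Calabi-Yau condition acts through the weights: the square of \<open>x_0\<close> or
  \<open>y_0\<close> takes 1/2 of the total 1, so any two other variables share at most 1/2. This
  rules out linear terms and products \<open>z_i z_j\<close>, and leaves all exponents at least 2.
  That bound makes the exponent matrix and its transpose strictly diagonally dominant, and nearly
  every estimate below is a form of this dominance. The obstacle on the algebraic side is that a
  state space consists of cosets, whose representatives are hard to compare. The dual functionals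
  turn a class into coordinates; they are eigenvectors of the group and each sees monomials of one
  bidegree only, so the isomorphism reduces to a bijection of two finite index sets. Invariance
  under \<sigma> says that \<open>x_0\<close> and \<open>y_0\<close> are both fixed or both moved,
  which the duality and the exchange at these variables both respect. The bounds on \<open>G\<close>
  by the products of the groups J and SL keep \<sigma> out of \<open>G^T\<close> and out of
  \<open>G\<close>, so on either side it can be recognised which pairs were exchanged.\<close>

abbreviation lkp :: "('a \<Rightarrow>\<^sub>0 'b::zero) \<Rightarrow> 'a \<Rightarrow> 'b" where "lkp \<equiv> Poly_Mapping.lookup"
abbreviation mon :: "'a \<Rightarrow> 'b \<Rightarrow> 'a \<Rightarrow>\<^sub>0 'b::zero" where "mon \<equiv> Poly_Mapping.single"
abbreviation kys :: "('a \<Rightarrow>\<^sub>0 'b::zero) \<Rightarrow> 'a set" where "kys \<equiv> Poly_Mapping.keys"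

section \<open>Termwise linear maps on polynomials\<close>

lemma poly_mapping_sum_terms:
  fixes f :: "'k \<Rightarrow>\<^sub>0 'b::comm_monoid_add"
  shows "f = (\<Sum>m\<in>kys f. mon m (lkp f m))"
proof (rule poly_mapping_eqI)
  fix k
  show "lkp f k = lkp (\<Sum>m\<in>kys f. mon m (lkp f m)) k"
    by (cases "k \<in> kys f")
       (auto simp: lookup_sum lookup_single when_def not_in_keys_iff_lookup_eq_zero)
qed

lemma poly_mapping_term_induct [case_names zero single add]:
  fixes f :: "'k \<Rightarrow>\<^sub>0 'b::comm_monoid_add"
  assumes "P 0" and "\<And>m c. m \<in> kys f \<Longrightarrow> P (mon m c)" and "\<And>g h. P g \<Longrightarrow> P h \<Longrightarrow> P (g + h)"
  shows "P f"
proof -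
  have "P (\<Sum>m\<in>S. mon m (lkp f m))" if "S \<subseteq> kys f" for S
    using finite_subset[OF that finite_keys] that
    by (induction S rule: finite_induct) (auto intro: assms)
  from this[of "kys f"] show ?thesis
    using poly_mapping_sum_terms[of f] by simp
qed

definition mlin :: "('k \<Rightarrow> complex) \<Rightarrow> ('k \<Rightarrow>\<^sub>0 complex) \<Rightarrow> complex" where
  "mlin w f = (\<Sum>m\<in>kys f. lkp f m * w m)"

lemma mlin_superset:
  assumes "finite S" "kys f \<subseteq> S"
  shows "mlin w f = (\<Sum>m\<in>S. lkp f m * w m)"
  unfolding mlin_def using assms
  by (intro sum.mono_neutral_left) (auto simp: in_keys_iff)

lemma mlin_add: "mlin w (f + g) = mlin w f + mlin w g"
proof -
  let ?S = "kys f \<union> kys g"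
  have "kys (f + g) \<subseteq> ?S" by (rule Poly_Mapping.keys_add)
  then show ?thesis
    by (subst (1 2 3) mlin_superset[where S = ?S])
       (auto simp: lookup_add sum.distrib algebra_simps)
qed

lemma mlin_zero [simp]: "mlin w 0 = 0"
  by (simp add: mlin_def)

lemma mlin_single [simp]: "mlin w (mon m c) = c * w m"
  by (simp add: mlin_def)

lemma mlin_uminus: "mlin w (- f) = - mlin w f"
  using mlin_add[of w f "- f"] by (simp add: eq_neg_iff_add_eq_0 add.commute)

lemma mlin_diff: "mlin w (f - g) = mlin w f - mlin w g"
  using mlin_add[of w f "- g"] by (simp add: mlin_uminus)

lemma mlin_sum: "mlin w (\<Sum>i\<in>A. f i) = (\<Sum>i\<in>A. mlin w (f i))"
  by (induction A rule: infinite_finite_induct) (auto simp: mlin_add)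

lemma mlin_single_mult:
  fixes f :: "'k::comm_monoid_add \<Rightarrow>\<^sub>0 complex"
  shows "mlin w (mon m c * f) = c * mlin (\<lambda>x. w (m + x)) f"
  by (induction f rule: poly_mapping_term_induct)
     (simp_all add: mlin_add mult_single algebra_simps)

text \<open>Common form of partial derivatives, where \<open>s\<close> lowers an exponent, and of
  the diagonal group action, where \<open>s\<close> is the identity and \<open>w\<close> a
  character.\<close>

definition mterm :: "('k \<Rightarrow> 'l) \<Rightarrow> ('k \<Rightarrow> complex) \<Rightarrow> ('k \<Rightarrow>\<^sub>0 complex) \<Rightarrow> ('l \<Rightarrow>\<^sub>0 complex)" where
  "mterm s w f = (\<Sum>m\<in>kys f. mon (s m) (w m * lkp f m))"

lemma mterm_superset:
  assumes "finite S" "kys f \<subseteq> S"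
  shows "mterm s w f = (\<Sum>m\<in>S. mon (s m) (w m * lkp f m))"
  unfolding mterm_def using assms
  by (intro sum.mono_neutral_left) (auto simp: in_keys_iff)

lemma mterm_add: "mterm s w (f + g) = mterm s w f + mterm s w g"
proof -
  let ?S = "kys f \<union> kys g"
  have "kys (f + g) \<subseteq> ?S" by (rule Poly_Mapping.keys_add)
  then show ?thesis
    by (subst (1 2 3) mterm_superset[where S = ?S])
       (auto simp: lookup_add sum.distrib[symmetric] single_add[symmetric] algebra_simps)
qed

lemma mterm_zero [simp]: "mterm s w 0 = 0"
  by (simp add: mterm_def)

lemma mterm_single [simp]: "mterm s w (mon m c) = mon (s m) (w m * c)"
  by (cases "c = 0") (auto simp: mterm_def)

lemma mterm_sum: "mterm s w (\<Sum>i\<in>A. f i) = (\<Sum>i\<in>A. mterm s w (f i))"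
  by (induction A rule: infinite_finite_induct) (auto simp: mterm_add)

lemma mlin_mterm: "mlin w' (mterm s w f) = mlin (\<lambda>m. w m * w' (s m)) f"
  by (simp add: mterm_def mlin_sum) (simp add: mlin_def algebra_simps)

lemma lookup_mterm_id: "lkp (mterm id w f) m = w m * lkp f m"
  by (cases "m \<in> kys f")
     (auto simp: mterm_def lookup_sum lookup_single when_def not_in_keys_iff_lookup_eq_zero)

lemma mterm_comp: "mterm id w (mterm id w' f) = mterm id (\<lambda>m. w m * w' m) f"
  by (simp add: mterm_def[of id w' f] mterm_sum) (simp add: mterm_def algebra_simps)

lemma mterm_id: "(\<And>m. m \<in> kys f \<Longrightarrow> w m = 1) \<Longrightarrow> mterm id w f = f"
  using poly_mapping_sum_terms[of f] by (simp add: mterm_def)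

lemma keys_mterm_id: "kys (mterm id w f) \<subseteq> kys f"
  by (auto simp: in_keys_iff lookup_mterm_id)

lemma mpoly_eval_eq_mlin:
  "mpoly_eval z = mlin (\<lambda>m. \<Prod>j\<in>kys m. z j ^ lkp m j)"
  by (simp add: mpoly_eval_def mlin_def fun_eq_iff)

lemma mpoly_deriv_eq_mterm:
  "mpoly_deriv j = mterm (\<lambda>m. m - mon j 1) (\<lambda>m. of_nat (lkp m j))"
  by (simp add: mpoly_deriv_def mterm_def fun_eq_iff)

definition form_char :: "'v set \<Rightarrow> ('v \<Rightarrow> rat) \<Rightarrow> 'v exponent \<Rightarrow> complex" where
  "form_char I h m = cis (2 * pi * of_rat (\<Sum>i\<in>I. (of_nat (lkp m i) + 1) * h i))"

lemma form_action_eq_mterm: "form_action I h = mterm id (form_char I h)"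
  by (simp add: form_action_def mterm_def form_char_def fun_eq_iff)

lemma monomial_eval_superset:
  fixes z :: "'v \<Rightarrow> complex"
  assumes "finite V" "kys m \<subseteq> V"
  shows "(\<Prod>j\<in>kys m. z j ^ lkp m j) = (\<Prod>j\<in>V. z j ^ lkp m j)"
  using assms by (intro prod.mono_neutral_left) (auto simp: in_keys_iff)

section \<open>The ring of polynomials in a set of variables\<close>

lemma mpoly_vars_subset_iff: "mpoly_vars f \<subseteq> I \<longleftrightarrow> (\<forall>m\<in>kys f. kys m \<subseteq> I)"
  by (auto simp: mpoly_vars_def)

lemma carrier_mpoly_ring: "carrier (mpoly_ring I) = {f. \<forall>m\<in>kys f. kys m \<subseteq> I}"
  by (simp add: mpoly_ring_def mpoly_vars_subset_iff)

lemma mpoly_ring_simps [simp]: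
  "mult (mpoly_ring I) = (*)" "one (mpoly_ring I) = 1"
  "zero (mpoly_ring I) = 0" "add (mpoly_ring I) = (+)"
  by (simp_all add: mpoly_ring_def)

lemma keys_exponent_add: "kys (m + n) = kys m \<union> kys n" for m n :: "'v exponent"
  by (auto simp: in_keys_iff lookup_add)

lemma mpoly_ring_add_closed:
  "f \<in> carrier (mpoly_ring I) \<Longrightarrow> g \<in> carrier (mpoly_ring I) \<Longrightarrow> f + g \<in> carrier (mpoly_ring I)"
  unfolding carrier_mpoly_ring using Poly_Mapping.keys_add[of f g] by blast

lemma mpoly_ring_uminus_closed:
  "f \<in> carrier (mpoly_ring I) \<Longrightarrow> - f \<in> carrier (mpoly_ring I)"
  by (simp add: carrier_mpoly_ring in_keys_iff)

lemma mpoly_ring_diff_closed: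
  "f \<in> carrier (mpoly_ring I) \<Longrightarrow> g \<in> carrier (mpoly_ring I) \<Longrightarrow> f - g \<in> carrier (mpoly_ring I)"
  using mpoly_ring_add_closed[of f I "- g"] mpoly_ring_uminus_closed[of g I] by simp

lemma mpoly_ring_mult_closed:
  assumes "f \<in> carrier (mpoly_ring I)" "g \<in> carrier (mpoly_ring I)"
  shows "f * g \<in> carrier (mpoly_ring I)"
proof -
  have "kys m \<subseteq> I" if "m \<in> kys (f * g)" for m
  proof -
    obtain a b where "m = a + b" "a \<in> kys f" "b \<in> kys g"
      using Poly_Mapping.keys_mult[of f g] \<open>m \<in> kys (f * g)\<close> by blast
    then show ?thesis using assms by (auto simp: carrier_mpoly_ring keys_exponent_add)
  qed
  then show ?thesis by (auto simp: carrier_mpoly_ring)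
qed

lemma mpoly_ring_single_closed: "kys m \<subseteq> I \<Longrightarrow> mon m c \<in> carrier (mpoly_ring I)"
  by (simp add: carrier_mpoly_ring)

lemma mpoly_ring_zero_closed: "0 \<in> carrier (mpoly_ring I)"
  by (simp add: carrier_mpoly_ring)

lemma mpoly_ring_sum_closed:
  "(\<And>i. i \<in> A \<Longrightarrow> f i \<in> carrier (mpoly_ring I)) \<Longrightarrow> (\<Sum>i\<in>A. f i) \<in> carrier (mpoly_ring I)"
  by (induction A rule: infinite_finite_induct)
     (auto simp: mpoly_ring_zero_closed mpoly_ring_add_closed)

lemma mpoly_ring_one_closed: "1 \<in> carrier (mpoly_ring I)"
  using mpoly_ring_single_closed[of 0 I 1] by simp

lemma cring_mpoly_ring: "cring (mpoly_ring I)"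
proof (rule cringI)
  show "abelian_group (mpoly_ring I)"
  proof (rule abelian_groupI)
    fix x assume "x \<in> carrier (mpoly_ring I)"
    then show "\<exists>y\<in>carrier (mpoly_ring I). y \<oplus>\<^bsub>mpoly_ring I\<^esub> x = \<zero>\<^bsub>mpoly_ring I\<^esub>"
      by (intro bexI[of _ "- x"]) (auto simp: mpoly_ring_uminus_closed)
  qed (auto simp: mpoly_ring_add_closed mpoly_ring_zero_closed algebra_simps)
  show "Group.comm_monoid (mpoly_ring I)"
    by (rule comm_monoidI)
       (auto simp: mpoly_ring_mult_closed mpoly_ring_one_closed algebra_simps)
qed (auto simp: algebra_simps)

lemma a_inv_mpoly_ring:
  assumes "f \<in> carrier (mpoly_ring I)" shows "\<ominus>\<^bsub>mpoly_ring I\<^esub> f = - f"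
proof -
  interpret cring "mpoly_ring I" by (rule cring_mpoly_ring)
  show ?thesis
    by (rule minus_equality) (use assms in \<open>auto simp: mpoly_ring_uminus_closed\<close>)
qed

lemma mterm_id_closed:
  "f \<in> carrier (mpoly_ring I) \<Longrightarrow> mterm id w f \<in> carrier (mpoly_ring I)"
  unfolding carrier_mpoly_ring using keys_mterm_id[of w f] by blast

definition mexp :: "'v set \<Rightarrow> ('v \<Rightarrow> nat) \<Rightarrow> 'v exponent" where
  "mexp I n = (\<Sum>i\<in>I. mon i (n i))"

lemma lookup_mexp: "finite I \<Longrightarrow> lkp (mexp I n) i = (if i \<in> I then n i else 0)"
  by (simp add: mexp_def lookup_sum lookup_single when_def)

lemma keys_mexp: "finite I \<Longrightarrow> kys (mexp I n) \<subseteq> I"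
  by (auto simp: in_keys_iff lookup_mexp split: if_splits)

lemma mexp_eqI:
  assumes "finite I" "kys m \<subseteq> I" "\<And>i. i \<in> I \<Longrightarrow> lkp m i = n i"
  shows "mexp I n = m"
  using assms by (intro poly_mapping_eqI) (auto simp: lookup_mexp in_keys_iff)

section \<open>Linear algebra\<close>

lemma lookup_scale: "lkp (Poly_Mapping.map ((*) (c::'b::mult_zero)) p) k = c * lkp p k"
  by (simp add: Poly_Mapping.map.rep_eq when_def)

lemma vector_space_poly_mapping:
  "vector_space (\<lambda>(c::'b::field) (p :: 'k \<Rightarrow>\<^sub>0 'b). Poly_Mapping.map ((*) c) p)"
  by unfold_locales
     (auto intro!: poly_mapping_eqI simp: lookup_scale lookup_add algebra_simps)

text \<open>The basis \<open>B\<close> goes to an independent set of the same size inside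
  \<open>span B\<close>. A vector missed by \<open>T\<close> could be added to it, giving an
  independent set larger than \<open>B\<close>.\<close>

lemma (in vector_space) injective_imp_surjective_on_span:
  assumes T: "Vector_Spaces.linear scale scale T" and B: "finite B" "independent B"
    and into: "T ` B \<subseteq> span B" and inj: "inj_on T (span B)"
  shows "span B \<subseteq> T ` span B"
proof
  interpret vector_space_pair scale scale by unfold_locales
  fix y assume y: "y \<in> span B"
  have ind: "independent (T ` B)"
    by (rule linear_independent_injective_image[OF T B(2) inj])
  have card: "card (T ` B) = card B"
    using inj span_superset by (intro card_image) (rule inj_on_subset)
  have sp: "T ` span B = span (T ` B)"
    by (rule linear_span_image[OF T, symmetric])
  show "y \<in> T ` span B"
  proof (rule ccontr)
    assume "y \<notin> T ` span B"
    then have ny: "y \<notin> span (T ` B)" by (simp add: sp)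
    then have "independent (insert y (T ` B))"
      using ind by (simp add: independent_insert)
    moreover have "insert y (T ` B) \<subseteq> span B" using y into by simp
    ultimately have "card (insert y (T ` B)) \<le> card B"
      using independent_span_bound[OF B(1)] by blast
    moreover have "y \<notin> T ` B" using ny span_superset by blast
    ultimately show False using card B(1) by simp
  qed
qed

text \<open>A basis of \<open>S\<close> stays independent when \<open>f\<close> is added, so a
  functional may be prescribed as 0 on \<open>S\<close> and 1 at \<open>f\<close>. Spanning can then
  be proved by showing that functionals vanish.\<close>

lemma separating_functional:
  fixes S :: "('k \<Rightarrow>\<^sub>0 complex) set"
  assumes zero: "0 \<in> S" and add: "\<And>f g. f \<in> S \<Longrightarrow> g \<in> S \<Longrightarrow> f + g \<in> S"
    and scale: "\<And>c f. f \<in> S \<Longrightarrow> Poly_Mapping.map ((*) c) f \<in> S" and f: "f \<notin> S"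
  obtains w where "\<And>g. g \<in> S \<Longrightarrow> mlin w g = 0" "mlin w f \<noteq> 0"
proof -
  let ?s = "\<lambda>(c::complex) (p :: 'k \<Rightarrow>\<^sub>0 complex). Poly_Mapping.map ((*) c) p"
  interpret vs: vector_space ?s by (rule vector_space_poly_mapping)
  interpret vp: vector_space_pair ?s "(*) :: complex \<Rightarrow> complex \<Rightarrow> complex"
    by unfold_locales (auto simp: algebra_simps)
  have sub: "vs.subspace S" by (rule vs.subspaceI) (use zero add scale in auto)
  obtain B where B: "B \<subseteq> S" "vs.independent B" "vs.span B = S"
    using vs.basis_exists[of S] vs.span_subspace[OF _ _ sub] by metis
  have "vs.independent (insert f B)"
    using B f by (simp add: vs.independent_insert)
  then obtain \<psi> where \<psi>: "Vector_Spaces.linear ?s (*) \<psi>"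
    "\<forall>x\<in>insert f B. \<psi> x = (if x = f then 1 else 0)"
    using vp.linear_independent_extend[of "insert f B" "\<lambda>x. if x = f then 1 else 0"] by blast
  interpret L: Vector_Spaces.linear ?s "(*)" \<psi> by (fact \<psi>(1))
  have lin: "\<psi> g = mlin (\<lambda>m. \<psi> (mon m 1)) g" for g
  proof (induction g rule: poly_mapping_term_induct)
    case zero show ?case by (simp add: L.zero)
  next
    case (single m c)
    have "mon m c = ?s c (mon m 1)"
      by (rule poly_mapping_eqI) (simp add: lookup_scale lookup_single when_def)
    then have "\<psi> (mon m c) = \<psi> (?s c (mon m 1))" by (simp only:)
    also have "\<dots> = c * \<psi> (mon m 1)" by (rule L.scale)
    finally show ?case by simp
  next
    case (add g h) then show ?case by (simp add: L.add mlin_add)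
  qed
  have "\<psi> g = 0" if "g \<in> S" for g
  proof -
    have "g \<in> vs.span B" using that B by simp
    then show ?thesis
    proof (induction rule: vs.span_induct_alt)
      case base show ?case by (rule L.zero)
    next
      case (step c x y)
      have "x \<noteq> f" using step B f by blast
      then show ?case using step \<psi>(2) by (simp add: L.add L.scale)
    qed
  qed
  moreover have "\<psi> f \<noteq> 0" using \<psi>(2) by simp
  ultimately show ?thesis using that[of "\<lambda>m. \<psi> (mon m 1)"] by (simp add: lin[symmetric])
qed

section \<open>Sums of chains and loops\<close>

text \<open>A missing neighbour contributes zero, so the ends of a chain need no separate
  formulas.\<close>

definition ov :: "('v \<Rightarrow> 'b::zero) \<Rightarrow> 'v option \<Rightarrow> 'b" where
  "ov e x = (case x of None \<Rightarrow> 0 | Some j \<Rightarrow> e j)"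

lemma ov_simps [simp]: "ov e None = 0" "ov e (Some j) = e j"
  by (simp_all add: ov_def)

definition dl :: "'v \<Rightarrow> 'v \<Rightarrow> 'b::zero_neq_one" where "dl j i = (if i = j then 1 else 0)"
definition ind :: "'v set \<Rightarrow> 'v \<Rightarrow> 'b::zero_neq_one" where "ind U i = (if i \<in> U then 1 else 0)"
definition supp_in :: "'v set \<Rightarrow> ('v \<Rightarrow> 'b::zero) \<Rightarrow> bool" where
  "supp_in I e \<longleftrightarrow> (\<forall>i. i \<notin> I \<longrightarrow> e i = 0)"

text \<open>Term \<open>i\<close> of the polynomial is \<open>c i * z_i^(a i) * z_j\<close> if
  \<open>nx i = Some j\<close>, and \<open>c i * z_i^(a i)\<close> if \<open>nx i = None\<close>. As
  \<open>pv\<close> inverts \<open>nx\<close>, following \<open>nx\<close> traces out chains and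
  loops. The coefficients are arbitrary because the given polynomial is not normalised; outside
  \<open>V\<close> nothing is known about \<open>nx\<close> and \<open>pv\<close>.\<close>

locale inv_struct =
  fixes V :: "'v set" and a :: "'v \<Rightarrow> nat" and nx pv :: "'v \<Rightarrow> 'v option" and c :: "'v \<Rightarrow> complex"
  assumes finite_V: "finite V"
    and a_ge2: "i \<in> V \<Longrightarrow> 2 \<le> a i"
    and c_nz: "i \<in> V \<Longrightarrow> c i \<noteq> 0"
    and nx_pv: "i \<in> V \<Longrightarrow> nx i = Some j \<Longrightarrow> j \<in> V \<and> j \<noteq> i \<and> pv j = Some i"
    and pv_nx: "j \<in> V \<Longrightarrow> pv j = Some i \<Longrightarrow> i \<in> V \<and> nx i = Some j"
begin

text \<open>Polymorphic because it is applied to rational exponent coordinates and also to complex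
  vectors of coefficients.\<close>

definition R :: "('v \<Rightarrow> 'b::comm_ring_1) \<Rightarrow> 'v \<Rightarrow> 'b" where
  "R e i = of_nat (a i) * e i + ov e (pv i)"

definition row :: "'v \<Rightarrow> 'v exponent" where
  "row i = mon i (a i) + (case nx i of None \<Rightarrow> 0 | Some j \<Rightarrow> mon j 1)"

definition wpoly :: "'v set \<Rightarrow> 'v mpoly" where
  "wpoly I = (\<Sum>i\<in>I. mon (row i) (c i))"

lemma lookup_row: "lkp (row i) j = (if j = i then a i else 0) + (if nx i = Some j then 1 else 0)"
  by (auto simp: row_def lookup_add lookup_single when_def split: option.splits)

lemma nx_iff_pv: "i \<in> V \<Longrightarrow> j \<in> V \<Longrightarrow> nx i = Some j \<longleftrightarrow> pv j = Some i"
  using nx_pv pv_nx by blast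

lemma a_rat_ge2: "i \<in> V \<Longrightarrow> (2::rat) \<le> of_nat (a i)"
  using a_ge2[of i] by (metis of_nat_le_iff of_nat_numeral)

lemma R_add: "R (\<lambda>i. e i + f i) i = R e i + R f i"
  by (cases "pv i") (auto simp: R_def algebra_simps)

lemma R_diff: "R (\<lambda>i. e i - f i) i = R e i - R f i"
  by (cases "pv i") (auto simp: R_def algebra_simps)

lemma R_dl: "i \<in> V \<Longrightarrow> p \<in> V \<Longrightarrow> R (dl p) i = of_nat (lkp (row p) i)"
  using nx_iff_pv[of p i] by (cases "pv i") (auto simp: R_def lookup_row dl_def)

text \<open>Stepping back along \<open>pv\<close> is adjoint to stepping forward along
  \<open>nx\<close>. The support condition discards predecessors outside \<open>I\<close>, and
  closure under \<open>nx\<close> keeps successors inside.\<close>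

lemma sum_ov_adjoint:
  fixes e f :: "'v \<Rightarrow> 'b::comm_ring_1"
  assumes I: "I \<subseteq> V" and closed: "\<And>i j. i \<in> I \<Longrightarrow> nx i = Some j \<Longrightarrow> j \<in> I"
    and e: "supp_in I e"
  shows "(\<Sum>i\<in>I. ov e (pv i) * f i) = (\<Sum>i\<in>I. e i * ov f (nx i))"
proof -
  have fin: "finite I" using I finite_V finite_subset by blast
  have "ov e (pv i) * f i = (\<Sum>j\<in>I. if nx j = Some i then e j * f i else 0)" if "i \<in> I" for i
  proof (cases "\<exists>j\<in>I. nx j = Some i")
    case True
    then obtain j where j: "j \<in> I" "nx j = Some i" by blast
    have "nx k = Some i \<longleftrightarrow> k = j" if "k \<in> I" for k
      using j that nx_pv[of k i] nx_pv[of j i] subsetD[OF I] by auto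
    then have "(\<Sum>k\<in>I. if nx k = Some i then e k * f i else 0) = (\<Sum>k\<in>I. if k = j then e k * f i else 0)"
      by (intro sum.cong) auto
    also have "\<dots> = e j * f i" using j fin by simp
    finally show ?thesis using nx_pv[of j i] j I by auto
  next
    case False
    have "ov e (pv i) = 0"
    proof (cases "pv i")
      case (Some j)
      then have "j \<notin> I" using False pv_nx[of i j] \<open>i \<in> I\<close> I by blast
      then show ?thesis using Some e by (simp add: supp_in_def)
    qed simp
    then show ?thesis using False by (simp add: sum.neutral)
  qed
  then have "(\<Sum>i\<in>I. ov e (pv i) * f i) = (\<Sum>i\<in>I. \<Sum>j\<in>I. if nx j = Some i then e j * f i else 0)"
    by simp
  also have "\<dots> = (\<Sum>j\<in>I. \<Sum>i\<in>I. if nx j = Some i then e j * f i else 0)"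
    by (rule sum.swap)
  also have "\<dots> = (\<Sum>j\<in>I. e j * ov f (nx j))"
  proof (rule sum.cong[OF refl])
    fix j assume "j \<in> I"
    show "(\<Sum>i\<in>I. if nx j = Some i then e j * f i else 0) = e j * ov f (nx j)"
    proof (cases "nx j")
      case (Some l)
      then have "l \<in> I" using closed \<open>j \<in> I\<close> by blast
      have "(\<Sum>i\<in>I. if nx j = Some i then e j * f i else 0) = (\<Sum>i\<in>I. if i = l then e j * f i else 0)"
        by (rule sum.cong) (auto simp: Some)
      then show ?thesis using fin \<open>l \<in> I\<close> Some by simp
    qed simp
  qed
  finally show ?thesis .
qed

lemma sum_R_adjoint:
  fixes e f :: "'v \<Rightarrow> 'b::comm_ring_1"
  assumes "I \<subseteq> V" and "\<And>i j. i \<in> I \<Longrightarrow> nx i = Some j \<Longrightarrow> j \<in> I" and "supp_in I e"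
  shows "(\<Sum>i\<in>I. R e i * f i) = (\<Sum>i\<in>I. e i * (of_nat (a i) * f i + ov f (nx i)))"
  using sum_ov_adjoint[OF assms, where f = f] by (simp add: R_def algebra_simps sum.distrib)

text \<open>Diagonal dominance: at an index of maximal modulus \<open>M\<close> the equation gives
  \<open>a i * M \<le> M\<close>, and \<open>a i \<ge> 2\<close> forces
  \<open>M = 0\<close>.\<close>

lemma R_zero_complex:
  fixes e :: "'v \<Rightarrow> complex"
  assumes I: "I \<subseteq> V" and e: "supp_in I e" and R0: "\<And>i. i \<in> I \<Longrightarrow> R e i = 0"
  shows "e i = 0"
proof (cases "I = {}")
  case True then show ?thesis using e by (simp add: supp_in_def)
next
  case False
  have fin: "finite I" using I finite_V finite_subset by blast
  define M where "M = Max ((\<lambda>i. cmod (e i)) ` I)"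
  have le: "cmod (e i) \<le> M" if "i \<in> I" for i
    unfolding M_def using fin that by (intro Max_ge) auto
  have "M \<in> (\<lambda>i. cmod (e i)) ` I"
    unfolding M_def using fin False by (intro Max_in) auto
  then obtain i0 where i0: "i0 \<in> I" "M = cmod (e i0)" by blast
  have M0: "0 \<le> M" using i0 by simp
  have ovle: "cmod (ov e (pv i0)) \<le> M"
  proof (cases "pv i0")
    case (Some p)
    then show ?thesis using le[of p] e M0 by (cases "p \<in> I") (auto simp: supp_in_def)
  qed (use M0 in simp)
  have "of_nat (a i0) * e i0 = - ov e (pv i0)"
    using R0[OF i0(1)] by (simp add: R_def eq_neg_iff_add_eq_0)
  then have "real (a i0) * M = cmod (ov e (pv i0))"
    by (metis i0(2) norm_minus_cancel norm_mult norm_of_nat)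
  then have "real (a i0) * M \<le> M" using ovle by simp
  moreover have "2 * M \<le> real (a i0) * M"
    using a_ge2[of i0] i0 I M0 by (intro mult_right_mono) auto
  ultimately have "M \<le> 0" by simp
  then have "cmod (e i) \<le> 0" if "i \<in> I" using le[OF that] by linarith
  then show ?thesis using e by (cases "i \<in> I") (auto simp: supp_in_def)
qed

lemma of_rat_R: "of_rat (R e i) = (R (\<lambda>i. of_rat (e i)) i :: complex)"
  by (cases "pv i") (auto simp: R_def of_rat_add of_rat_mult)

lemma R_zero:
  fixes e :: "'v \<Rightarrow> rat"
  assumes I: "I \<subseteq> V" and e: "supp_in I e" and R0: "\<And>i. i \<in> I \<Longrightarrow> R e i = 0"
  shows "e i = 0"
proof -
  have "(of_rat (e i) :: complex) = 0"
    by (rule R_zero_complex[OF I, of "\<lambda>i. of_rat (e i)"])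
       (use e in \<open>auto simp: supp_in_def of_rat_R[symmetric] R0\<close>)
  then show ?thesis by simp
qed

lemma R_inj:
  fixes e f :: "'v \<Rightarrow> rat"
  assumes I: "I \<subseteq> V" and "supp_in I e" "supp_in I f" and eq: "\<And>i. i \<in> I \<Longrightarrow> R e i = R f i"
  shows "e = f"
proof
  fix i
  have "e i - f i = 0"
    by (rule R_zero[OF I, of "\<lambda>i. e i - f i"]) (use assms in \<open>auto simp: supp_in_def R_diff\<close>)
  then show "e i = f i" by simp
qed

text \<open>\<open>R\<close> is an injective endomorphism of the finite-dimensional space of vectors
  supported in \<open>I\<close>, hence onto. Finitely supported maps serve as that vector
  space.\<close>

lemma R_solvable:
  fixes x :: "'v \<Rightarrow> rat"
  assumes I: "I \<subseteq> V"
  obtains e where "supp_in I e" "\<And>i. i \<in> I \<Longrightarrow> R e i = x i"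
proof -
  have fin: "finite I" using I finite_V finite_subset by blast
  let ?s = "\<lambda>(c::rat) (p :: 'v \<Rightarrow>\<^sub>0 rat). Poly_Mapping.map ((*) c) p"
  interpret vs: vector_space ?s by (rule vector_space_poly_mapping)
  define B :: "('v \<Rightarrow>\<^sub>0 rat) set" where "B = (\<lambda>i. mon i 1) ` I"
  define T :: "('v \<Rightarrow>\<^sub>0 rat) \<Rightarrow> _" where "T p = (\<Sum>i\<in>I. mon i (R (lkp p) i))" for p
  have lT: "lkp (T p) i = (if i \<in> I then R (lkp p) i else 0)" for p i
    using fin by (simp add: T_def lookup_sum lookup_single when_def)
  have supp: "supp_in I (lkp p)" if "p \<in> vs.span B" for p
    using that
  proof (induction rule: vs.span_induct_alt)
    case (step c x y)
    then show ?case by (auto simp: supp_in_def lookup_add lookup_scale B_def lookup_single when_def split: if_splits)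
  qed (simp add: supp_in_def)
  have span: "p \<in> vs.span B" if "supp_in I (lkp p)" for p
  proof -
    have "p = (\<Sum>i\<in>kys p. mon i (lkp p i))" by (rule poly_mapping_sum_terms)
    also have "\<dots> = (\<Sum>i\<in>kys p. ?s (lkp p i) (mon i 1))"
      by (intro sum.cong refl poly_mapping_eqI) (simp add: lookup_scale lookup_single when_def)
    also have "\<dots> \<in> vs.span B"
      using that by (intro vs.span_sum vs.span_scale vs.span_base)
        (auto simp: B_def supp_in_def in_keys_iff)
    finally show ?thesis .
  qed
  have "vs.independent B"
  proof (rule vs.independent_if_scalars_zero)
    show "finite B" using fin by (simp add: B_def)
    fix f x assume s0: "(\<Sum>x\<in>B. ?s (f x) x) = 0" and "x \<in> B"
    then obtain i where i: "i \<in> I" "x = mon i 1" by (auto simp: B_def)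
    have "inj_on (\<lambda>i. mon i (1::rat)) I"
      by (rule inj_onI) (metis keys_single singleton_inject zero_neq_one)
    then have "0 = lkp (\<Sum>j\<in>I. ?s (f (mon j 1)) (mon j 1)) i"
      using s0 by (simp add: B_def sum.reindex)
    also have "\<dots> = f x"
      using i fin by (simp add: lookup_sum lookup_scale lookup_single when_def if_distrib cong: if_cong)
    finally show "f x = 0" by simp
  qed
  moreover have "finite B" using fin by (simp add: B_def)
  moreover have linT: "Vector_Spaces.linear ?s ?s T"
  proof -
    have "R (lkp (x + y)) i = R (lkp x) i + R (lkp y) i" for x y :: "'v \<Rightarrow>\<^sub>0 rat" and i
      using R_add[of "lkp x" "lkp y" i] by (simp add: lookup_add[abs_def])
    moreover have "R (lkp (?s r x)) i = r * R (lkp x) i" for r x i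
      by (cases "pv i") (auto simp: R_def lookup_scale algebra_simps)
    ultimately have "T (x + y) = T x + T y" "T (?s r x) = ?s r (T x)" for x y r
      by (auto intro!: poly_mapping_eqI simp only: lT lookup_add lookup_scale split: if_splits)
    then show ?thesis
      unfolding Vector_Spaces.linear_iff using vs.vector_space_axioms by blast
  qed
  moreover have "T ` B \<subseteq> vs.span B"
    by (auto intro!: span simp: lT supp_in_def)
  moreover have "inj_on T (vs.span B)"
  proof (rule inj_onI)
    fix p q assume pq: "p \<in> vs.span B" "q \<in> vs.span B" "T p = T q"
    have "lkp p = lkp q"
    proof (rule R_inj[OF I supp[OF pq(1)] supp[OF pq(2)]])
      fix i assume "i \<in> I"
      then show "R (lkp p) i = R (lkp q) i" using lT[of p i] lT[of q i] pq(3) by simp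
    qed
    then show "p = q" by (simp only: poly_mapping_eq_iff)
  qed
  ultimately have *: "vs.span B \<subseteq> T ` vs.span B"
    by (intro vs.injective_imp_surjective_on_span)
  have "(\<Sum>i\<in>I. mon i (x i)) \<in> vs.span B"
    by (rule span) (use fin in \<open>auto simp: supp_in_def lookup_sum lookup_single when_def\<close>)
  then obtain p where p: "p \<in> vs.span B" "(\<Sum>i\<in>I. mon i (x i)) = T p" using * by blast
  show ?thesis
  proof (rule that[OF supp[OF p(1)]])
    fix i assume "i \<in> I"
    then show "R (lkp p) i = x i"
      using lT[of p i] p(2)[symmetric] fin by (simp add: lookup_sum lookup_single when_def)
  qed
qed

text \<open>\<open>R\<close> is injective, and its values here are integer vectors in a bounded
  box.\<close>

lemma finite_R_bounded:
  assumes I: "I \<subseteq> V"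
  shows "finite {e :: 'v \<Rightarrow> rat. supp_in I e \<and> (\<forall>i\<in>I. R e i \<in> \<int> \<and> \<bar>R e i\<bar> \<le> N)}"
    (is "finite ?S")
proof -
  have fin: "finite I" using I finite_V finite_subset by blast
  define F where "F e = (\<lambda>i\<in>I. \<lfloor>R e i\<rfloor>)" for e :: "'v \<Rightarrow> rat"
  have "F ` ?S \<subseteq> (\<Pi>\<^sub>E i\<in>I. {-\<lceil>N\<rceil>..\<lceil>N\<rceil>})"
  proof (rule image_subsetI)
    fix e assume e: "e \<in> ?S"
    show "F e \<in> (\<Pi>\<^sub>E i\<in>I. {-\<lceil>N\<rceil>..\<lceil>N\<rceil>})"
    proof (rule PiE_I)
      fix i assume i: "i \<in> I"
      then have "\<bar>R e i\<bar> \<le> N" "R e i \<in> \<int>" using e by auto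
      then obtain k where k: "R e i = of_int k" "\<bar>of_int k :: rat\<bar> \<le> N" by (auto elim: Ints_cases)
      then have "of_int \<bar>k\<bar> \<le> (of_int \<lceil>N\<rceil> :: rat)"
        using le_of_int_ceiling[of N] by (simp del: le_of_int_ceiling)
      then have "\<bar>k\<bar> \<le> \<lceil>N\<rceil>" by (simp only: of_int_le_iff)
      with k have "\<bar>\<lfloor>R e i\<rfloor>\<bar> \<le> \<lceil>N\<rceil>" by simp
      then show "F e i \<in> {-\<lceil>N\<rceil>..\<lceil>N\<rceil>}" using i by (auto simp: F_def)
    qed (simp add: F_def)
  qed
  then have "finite (F ` ?S)" using fin by (meson finite_PiE finite_atLeastAtMost_int finite_subset)
  moreover have "inj_on F ?S"
  proof (rule inj_onI)
    fix e f assume ef: "e \<in> ?S" "f \<in> ?S" "F e = F f"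
    show "e = f"
    proof (rule R_inj[OF I])
      fix i assume i: "i \<in> I"
      have "\<lfloor>R e i\<rfloor> = \<lfloor>R f i\<rfloor>" using ef(3) i by (metis F_def restrict_apply')
      moreover have "of_int \<lfloor>R e i\<rfloor> = R e i" "of_int \<lfloor>R f i\<rfloor> = R f i"
        using ef i by (auto simp: of_int_floor_cancel)
      ultimately show "R e i = R f i" by metis
    qed (use ef in auto)
  qed
  ultimately show ?thesis by (rule finite_imageD)
qed

end

lemma Ints_less_imp_add1_le: "x \<in> \<int> \<Longrightarrow> y \<in> \<int> \<Longrightarrow> x < y \<Longrightarrow> x + 1 \<le> (y::rat)"
proof (elim Ints_cases)
  fix k l assume "x < y" "x = of_int k" "y = of_int l"
  then have "k + 1 \<le> l" by simp
  then have "(of_int (k + 1) :: rat) \<le> of_int l" by (simp only: of_int_le_iff)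
  then show ?thesis using \<open>x = of_int k\<close> \<open>y = of_int l\<close> by simp
qed

text \<open>\<open>I\<close> stands for the variables fixed by a symmetry. If \<open>z_i\<close> is
  fixed, invariance of \<open>z_i^(a i) z_j\<close> forces \<open>z_j\<close> to be fixed; this is
  why \<open>I\<close> is closed under \<open>nx\<close>, whereas predecessors may be
  missing.\<close>

locale inv_sub = inv_struct V a nx pv c for V :: "'v set" and a nx pv c +
  fixes I :: "'v set"
  assumes I_sub: "I \<subseteq> V" and I_closed: "i \<in> I \<Longrightarrow> nx i = Some j \<Longrightarrow> j \<in> I"
begin

lemma I_V: "i \<in> I \<Longrightarrow> i \<in> V"
  using I_sub by blast

lemma finite_I: "finite I"
  using I_sub finite_V finite_subset by blast

text \<open>A monomial with exponents \<open>m\<close> is encoded by the solution \<open>e\<close> of \<open>R e = m + 1\<close>, where \<open>R\<close> is the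
  transposed exponent matrix. In these coordinates the Jacobian relations only move a unit of \<open>e\<close>
  between neighbouring variables.\<close>

definition E :: "('v \<Rightarrow> rat) set" where
  "E = {e. supp_in I e \<and> (\<forall>i\<in>I. R e i \<in> \<int> \<and> 0 \<le> e i \<and> e i \<le> 1) \<and>
     (\<forall>i\<in>I. e i = 0 \<longrightarrow> (\<exists>p. pv i = Some p \<and> e p = 1)) \<and>
     (\<forall>i\<in>I. e i = 1 \<longrightarrow> (\<exists>j. nx i = Some j \<and> e j = 0))}"

definition node :: "('v \<Rightarrow> rat) \<Rightarrow> bool" where
  "node e \<longleftrightarrow> supp_in I e \<and> (\<forall>i\<in>I. R e i \<in> \<int> \<and> 1 \<le> R e i)"

text \<open>Meaningful on a \<open>node\<close>, where \<open>R e\<close> consists of positive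
  integers and neither \<open>nat\<close> nor the truncated subtraction loses anything.\<close>

definition mone :: "('v \<Rightarrow> rat) \<Rightarrow> 'v exponent" where
  "mone e = mexp I (\<lambda>i. nat \<lfloor>R e i\<rfloor> - 1)"

lemma keys_mone: "kys (mone e) \<subseteq> I"
  by (simp add: mone_def keys_mexp finite_I)

lemma lookup_mone:
  assumes "node e" "i \<in> I" shows "of_nat (lkp (mone e) i) + 1 = R e i"
proof -
  obtain k where k: "R e i = of_int k" using assms by (auto simp: node_def elim: Ints_cases)
  then have "1 \<le> k" using assms by (auto simp: node_def)
  then have "nat k - 1 + 1 = nat k" by simp
  then have "of_nat (nat k - 1) + 1 = (of_nat (nat k) :: rat)" by (metis of_nat_1 of_nat_add)
  then show ?thesis using k \<open>1 \<le> k\<close> assms(2) by (simp add: mone_def lookup_mexp finite_I)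
qed

lemma E_supp: "e \<in> E \<Longrightarrow> i \<notin> I \<Longrightarrow> e i = 0"
  by (simp add: E_def supp_in_def)

lemma E_range: "e \<in> E \<Longrightarrow> 0 \<le> e i \<and> e i \<le> 1"
  by (cases "i \<in> I") (auto simp: E_def supp_in_def)

lemma E_ov_range: "e \<in> E \<Longrightarrow> 0 \<le> ov e x \<and> ov e x \<le> 1"
  using E_range by (cases x) auto

text \<open>An integer \<open>R e i\<close> below 1 would make both of its summands vanish, but the
  condition at entries 0 supplies a predecessor with entry 1.\<close>

lemma E_lower:
  assumes e: "e \<in> E" and i: "i \<in> I" shows "1 \<le> R e i"
proof (rule ccontr)
  assume "\<not> 1 \<le> R e i"
  moreover have "R e i \<in> \<int>" using e i by (simp add: E_def)
  ultimately have le: "R e i \<le> 0" using Ints_less_imp_add1_le[of "R e i" 1] by simp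
  have a: "0 < (of_nat (a i) :: rat)" using a_rat_ge2[OF I_V[OF i]] by simp
  have "0 \<le> of_nat (a i) * e i" using E_range[OF e, of i] by simp
  moreover have "0 \<le> ov e (pv i)" using E_ov_range[OF e] by simp
  ultimately have z: "of_nat (a i) * e i = 0" "ov e (pv i) = 0" using le unfolding R_def by linarith+
  then have "e i = 0" using a by simp
  then obtain p where "pv i = Some p" "e p = 1" using e i by (auto simp: E_def)
  then show False using z(2) by simp
qed

text \<open>Exceeding \<open>a i\<close> requires \<open>e i = 1\<close> and a predecessor with
  entry 1, whereas the condition at entries 1 makes the successor of the latter 0.\<close>

lemma E_upper:
  assumes e: "e \<in> E" and i: "i \<in> I" shows "R e i \<le> of_nat (a i)"
proof (rule ccontr)
  assume "\<not> R e i \<le> of_nat (a i)"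
  moreover have "R e i \<in> \<int>" using e i by (simp add: E_def)
  ultimately have le: "of_nat (a i) + 1 \<le> R e i"
    using Ints_less_imp_add1_le[of "of_nat (a i)" "R e i"] by simp
  have a: "0 < (of_nat (a i) :: rat)" using a_rat_ge2[OF I_V[OF i]] by simp
  have "of_nat (a i) * e i \<le> of_nat (a i)" using E_range[OF e, of i] a by (simp add: mult_le_cancel_left1)
  moreover have "ov e (pv i) \<le> 1" using E_ov_range[OF e] by simp
  ultimately have z: "of_nat (a i) * e i = of_nat (a i)" "ov e (pv i) = 1"
    using le unfolding R_def by linarith+
  then have ei: "e i = 1" using a by simp
  obtain p where p: "pv i = Some p" "e p = 1" using z(2) by (cases "pv i") auto
  then have "p \<in> I" using E_supp[OF e, of p] by auto
  then obtain j where "nx p = Some j" "e j = 0" using e p by (auto simp: E_def)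
  moreover have "nx p = Some i" using pv_nx[OF I_V[OF i] p(1)] by simp
  ultimately show False using ei by simp
qed

lemma E_node: "e \<in> E \<Longrightarrow> node e"
  using E_lower by (auto simp: node_def E_def)

lemma finite_E: "finite E"
proof (rule finite_subset)
  define N :: rat where "N = of_nat (\<Sum>i\<in>V. a i)"
  show "E \<subseteq> {e. supp_in I e \<and> (\<forall>i\<in>I. R e i \<in> \<int> \<and> \<bar>R e i\<bar> \<le> N)}"
  proof safe
    fix e i assume e: "e \<in> E" and i: "i \<in> I"
    have "a i \<le> (\<Sum>i\<in>V. a i)" using finite_V I_V[OF i] by (simp add: member_le_sum)
    then have "(of_nat (a i) :: rat) \<le> N" unfolding N_def by (simp only: of_nat_le_iff)
    then show "\<bar>R e i\<bar> \<le> N" using E_upper[OF e i] E_lower[OF e i] by linarith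
  qed (auto simp: E_def)
qed (rule finite_R_bounded[OF I_sub])

section \<open>The dual functionals and the Jacobian relations\<close>

definition shift :: "('v \<Rightarrow> rat) \<Rightarrow> 'v set \<Rightarrow> 'v \<Rightarrow> rat" where
  "shift e U = (\<lambda>i. e i + (ind U i - ov (ind U) (pv i)))"

text \<open>The functional dual to the basis monomial \<open>e\<close>: it collects the monomials that are obtained from
  \<open>e\<close> by moving units from a set \<open>U\<close> of variables, each move contributing a factor \<open>kap\<close>.\<close>

definition Us :: "('v \<Rightarrow> rat) \<Rightarrow> 'v set set" where
  "Us e = {U. U \<subseteq> I \<and> (\<forall>p\<in>U. e p \<noteq> 0 \<and> (\<exists>j. nx p = Some j \<and> j \<notin> U))}"

text \<open>The relation for \<open>j = nx p\<close> has two terms: modulo it, the monomial with the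
  factor \<open>z_p^(a p)\<close> is \<open>kap p\<close> times the one with the factor
  \<open>z_j^(a j - 1)\<close>.\<close>

definition kap :: "'v \<Rightarrow> complex" where
  "kap p = - (of_nat (a (the (nx p))) * c (the (nx p))) / c p"

definition hits :: "('v \<Rightarrow> rat) \<Rightarrow> 'v exponent \<Rightarrow> 'v set set" where
  "hits e m = {U \<in> Us e. \<forall>i\<in>I. R (shift e U) i = of_nat (lkp m i) + 1}"

definition phi :: "('v \<Rightarrow> rat) \<Rightarrow> 'v exponent \<Rightarrow> complex" where
  "phi e m = (\<Sum>U\<in>hits e m. \<Prod>p\<in>U. kap p)"

text \<open>Each \<open>p\<close> in \<open>U\<close> receives one unit of \<open>e\<close> from its
  successor \<open>j\<close>. In terms of exponents \<open>p\<close> gains \<open>a p\<close>,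
  \<open>j\<close> loses \<open>a j - 1\<close>, and the variable after \<open>j\<close> loses
  1.\<close>

lemma R_shift:
  "R (shift e U) i = R e i + of_nat (a i) * ind U i - (of_nat (a i) - 1) * ov (ind U) (pv i)
     - ov (\<lambda>p. ov (ind U) (pv p)) (pv i)"
  by (cases "pv i") (auto simp: R_def shift_def algebra_simps)

lemma ov_ind_cases: "ov (ind U) x = (if \<exists>p\<in>U. x = Some p then 1 else 0)"
  by (cases x) (auto simp: ind_def)

lemma ov_ov_ind_range: "(0::rat) \<le> ov (\<lambda>p. ov (ind U) (pv p)) x \<and> ov (\<lambda>p. ov (ind U) (pv p)) x \<le> (1::rat)"
  by (cases x) (auto simp: ov_ind_cases)

text \<open>The two bounds say that \<open>row j - mon j 1\<close> divides the monomial of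
  \<open>shift e U\<close>. Since \<open>R e\<close> never exceeds \<open>a\<close>, there is no
  slack for the losses caused by \<open>U\<close>: neither \<open>j\<close> nor the two variables
  before it can lie in \<open>U\<close>, and so the predecessor of \<open>j\<close> can be
  added.\<close>

lemma fire_possible:
  assumes e: "e \<in> E" and U: "U \<in> Us e" and j: "j \<in> I"
    and Rj: "of_nat (a j) \<le> R (shift e U) j"
    and Rl: "\<And>l. nx j = Some l \<Longrightarrow> 2 \<le> R (shift e U) l"
  obtains p where "pv j = Some p" "p \<in> I" "p \<notin> U" "insert p U \<in> Us e"
proof -
  let ?Z = "\<lambda>i. ov (\<lambda>p. ov (ind U) (pv p)) (pv i) :: rat"
  have aj: "(2::rat) \<le> of_nat (a j)" by (rule a_rat_ge2[OF I_V[OF j]])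
  have Z: "0 \<le> ?Z i" "?Z i \<le> 1" for i using ov_ov_ind_range by auto
  \<comment> \<open>Otherwise the successor \<open>l\<close> loses \<open>a l - 1\<close> from at
    most \<open>a l\<close>, and the remaining 1 contradicts \<open>Rl\<close>.\<close>
  have jU: "j \<notin> U"
  proof
    assume "j \<in> U"
    then obtain l where l: "nx j = Some l" "l \<notin> U" using U by (auto simp: Us_def)
    then have lI: "l \<in> I" and pl: "pv l = Some j" using I_closed[OF j] nx_pv[OF I_V[OF j]] by auto
    have "ov (ind U) (pv l) = (1::rat)" using pl \<open>j \<in> U\<close> by (simp add: ind_def)
    then have "R (shift e U) l = R e l - (of_nat (a l) - 1) - ?Z l"
      using l by (simp add: R_shift ind_def)
    then show False using Rl[OF l(1)] E_upper[OF e lI] Z[of l] by linarith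
  qed
  have Rj': "R (shift e U) j = R e j - (of_nat (a j) - 1) * ov (ind U) (pv j) - ?Z j"
    using jU by (simp add: R_shift ind_def)
  have pvj: "ov (ind U) (pv j) = (0::rat)"
  proof (rule ccontr)
    assume "ov (ind U) (pv j) \<noteq> (0::rat)"
    then have "ov (ind U) (pv j) = (1::rat)" by (auto simp: ov_ind_cases split: if_splits)
    then show False using Rj' Rj E_upper[OF e j] Z[of j] aj by simp
  qed
  have Zj: "?Z j = 0"
  proof (rule ccontr)
    assume "?Z j \<noteq> 0"
    then have "?Z j = 1" by (cases "pv j") (auto simp: ov_ind_cases split: if_splits)
    then show False using Rj' pvj Rj E_upper[OF e j] by simp
  qed
  have Rej: "R e j = of_nat (a j)" using Rj' pvj Zj Rj E_upper[OF e j] by simp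
  \<comment> \<open>Without a contribution of the predecessor, \<open>R e j = a j\<close> means
    \<open>e j = 1\<close>. Then the successor \<open>l\<close> has entry 0 and
    \<open>R e l = 1\<close>, too small for \<open>Rl\<close>.\<close>
  have "ov e (pv j) \<noteq> 0"
  proof
    assume "ov e (pv j) = 0"
    then have ej: "e j = 1" using Rej aj by (simp add: R_def)
    then obtain l where l: "nx j = Some l" "e l = 0" using e j by (auto simp: E_def)
    then have pl: "pv l = Some j" using nx_pv[OF I_V[OF j]] by auto
    have "l \<notin> U" using l(2) U by (auto simp: Us_def)
    moreover have "ov (ind U) (pv l) = (0::rat)" using pl jU by (simp add: ind_def)
    moreover have "R e l = 1" using pl l ej by (simp add: R_def)
    ultimately show False using Rl[OF l(1)] Z[of l] by (simp add: R_shift ind_def)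
  qed
  then obtain p where p: "pv j = Some p" "e p \<noteq> 0" by (cases "pv j") auto
  have pI: "p \<in> I" using p(2) E_supp[OF e] by blast
  have nxp: "nx p = Some j" using pv_nx[OF I_V[OF j] p(1)] by simp
  then have pj: "j \<noteq> p" using nx_pv[OF I_V[OF pI]] by blast
  have pU: "p \<notin> U" using pvj p(1) by (simp add: ind_def split: if_splits)
  have pp: "nx u \<noteq> Some p" if "u \<in> U" for u
  proof
    assume "nx u = Some p"
    moreover have "u \<in> I" using that U by (auto simp: Us_def)
    ultimately have "pv p = Some u" using nx_pv[OF I_V] by blast
    then have "?Z j = 1" using p(1) that by (simp add: ind_def)
    then show False using Zj by simp
  qed
  have "insert p U \<in> Us e"
    unfolding Us_def
  proof (intro CollectI conjI ballI)
    show "insert p U \<subseteq> I" using pI U by (auto simp: Us_def)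
    fix q assume q: "q \<in> insert p U"
    show "e q \<noteq> 0" using q p U by (auto simp: Us_def)
    show "\<exists>k. nx q = Some k \<and> k \<notin> insert p U"
    proof (cases "q = p")
      case True then show ?thesis using nxp jU pj by auto
    next
      case False
      then have "q \<in> U" using q by simp
      then show ?thesis using U pp[of q] by (fastforce simp: Us_def)
    qed
  qed
  then show ?thesis using that p(1) pI pU by blast
qed

text \<open>Only membership in \<open>U\<close> can raise the value at \<open>p\<close> above its
  bound \<open>a p\<close>; the other two effects of \<open>shift\<close> lower it.\<close>

lemma fired:
  assumes e: "e \<in> E" and U: "U \<in> Us e" and p: "p \<in> I"
    and Rp: "of_nat (a p) + 1 \<le> R (shift e U) p"
  shows "p \<in> U"
proof (rule ccontr)
  assume pU: "p \<notin> U"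
  have "0 \<le> (of_nat (a p) - 1) * (ov (ind U) (pv p) :: rat)"
    using a_rat_ge2[OF I_V[OF p]] by (auto simp: ov_ind_cases)
  then have "R (shift e U) p \<le> R e p"
    using pU ov_ov_ind_range[of U "pv p"] by (simp add: R_shift ind_def)
  then show False using Rp E_upper[OF e p] by simp
qed

text \<open>Inside \<open>V\<close> one unit moves from \<open>j\<close> to \<open>p\<close>. The
  other case is kept apart because \<open>pv\<close> is arbitrary outside \<open>V\<close>.\<close>

lemma shift_insert:
  assumes "p \<in> I" "p \<notin> U" "nx p = Some j"
  shows "shift e (insert p U) = (\<lambda>i. shift e U i + (if i \<in> V then dl p i - dl j i else 
     (ind {p} i - ov (ind {p}) (pv i))))"
proof
  fix i
  have s: "ind (insert p U) k = ind U k + (ind {p} k :: rat)" for k using assms(2) by (auto simp: ind_def)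
  then have s2: "ov (ind (insert p U)) x = ov (ind U) x + (ov (ind {p}) x :: rat)" for x by (cases x) auto
  have "i \<in> V \<Longrightarrow> pv i = Some p \<longleftrightarrow> i = j" 
    using nx_pv[OF I_V[OF assms(1)] assms(3)] assms(3) pv_nx[of i p] by auto
  then have "i \<in> V \<Longrightarrow> ov (ind {p}) (pv i) = (dl j i :: rat)"
    by (cases "pv i") (auto simp: dl_def ind_def)
  then show "shift e (insert p U) i = shift e U i + (if i \<in> V then dl p i - dl j i else 
     (ind {p} i - ov (ind {p}) (pv i)))"
    by (simp add: shift_def s s2 ind_def[of "{p}" i] dl_def)
qed

lemma R_cong:
  fixes e f :: "'v \<Rightarrow> rat"
  assumes "\<And>i. i \<in> V \<Longrightarrow> e i = f i" "i \<in> V" shows "R e i = R f i"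
  using assms pv_nx[of i] by (cases "pv i") (auto simp: R_def)

lemma R_shift_insert:
  assumes "p \<in> I" "p \<notin> U" "nx p = Some j" "i \<in> I"
  shows "R (shift e (insert p U)) i = R (shift e U) i + of_nat (lkp (row p) i) - of_nat (lkp (row j) i)"
proof -
  have jV: "j \<in> V" using nx_pv[OF I_V[OF assms(1)] assms(3)] by simp
  have "R (shift e (insert p U)) i = R (\<lambda>i. shift e U i + (dl p i - dl j i)) i"
    by (rule R_cong) (auto simp: shift_insert[OF assms(1-3)] I_V[OF assms(4)])
  also have "\<dots> = R (shift e U) i + (R (dl p) i - R (dl j) i)"
    by (simp add: R_add R_diff)
  also have "R (dl p) i = (of_nat (lkp (row p) i) :: rat)" by (rule R_dl[OF I_V[OF assms(4)] I_V[OF assms(1)]])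
  also have "R (dl j) i = (of_nat (lkp (row j) i) :: rat)" by (rule R_dl[OF I_V[OF assms(4)] jV])
  finally show ?thesis by simp
qed

lemma lookup_row_self:
  "j \<in> V \<Longrightarrow> lkp (row j - mon j 1) i = (if i = j then a j - 1 else 0) + (if nx j = Some i then 1 else 0)"
  using nx_pv[of j j] by (auto simp: lookup_row lookup_minus lookup_single when_def)

lemma lookup_row_pv:
  "j \<in> V \<Longrightarrow> pv j = Some p \<Longrightarrow> lkp (row p - mon j 1) i = (if i = p then a p else 0)"
  using pv_nx[of j p] nx_pv[of p j] by (auto simp: lookup_row lookup_minus lookup_single when_def)

text \<open>A linear functional with values \<open>w\<close> on monomials vanishes on the Jacobian ideal if and only if
  all \<open>rel w t j\<close> vanish: this is its value on \<open>x\<^sup>t\<close> times the \<open>j\<close>-th partial derivative.\<close>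

definition rel :: "('v exponent \<Rightarrow> complex) \<Rightarrow> 'v exponent \<Rightarrow> 'v \<Rightarrow> complex" where
  "rel w t j = of_nat (a j) * c j * w (t + (row j - mon j 1)) +
     (case pv j of None \<Rightarrow> 0 | Some p \<Rightarrow> if p \<in> I then c p * w (t + (row p - mon j 1)) else 0)"

text \<open>Inserting \<open>p = pv j\<close> is a bijection from the sets \<open>U\<close> that
  reach the first monomial of the relation to those that reach the second. It multiplies the
  contribution by \<open>kap p\<close>, so the two terms cancel. Without a predecessor in
  \<open>I\<close> no \<open>U\<close> reaches the first monomial.\<close>

lemma phi_rel:
  assumes e: "e \<in> E" and j: "j \<in> I"
  shows "rel (phi e) t j = 0"
proof -
  define m1 where "m1 = t + (row j - mon j 1)"
  have jV: "j \<in> V" by (rule I_V[OF j])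
  have aj: "1 \<le> a j" using a_ge2[OF jV] by simp
  have H1: "of_nat (a j) \<le> R (shift e U) j" "\<And>l. nx j = Some l \<Longrightarrow> 2 \<le> R (shift e U) l"
    if "U \<in> hits e m1" for U
  proof -
    have R: "\<And>i. i \<in> I \<Longrightarrow> R (shift e U) i = of_nat (lkp m1 i) + 1" using that by (auto simp: hits_def)
    have "a j \<le> lkp m1 j + 1" using aj lookup_row_self[OF jV, of j] by (simp add: m1_def lookup_add del: One_nat_def)
    then have "(of_nat (a j) :: rat) \<le> of_nat (lkp m1 j + 1)" by (simp only: of_nat_le_iff)
    then show "of_nat (a j) \<le> R (shift e U) j" using R[OF j] by simp
    fix l assume l: "nx j = Some l"
    then have "2 \<le> lkp m1 l + 1" using lookup_row_self[OF jV, of l] by (simp add: m1_def lookup_add del: One_nat_def)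
    then have "(of_nat 2 :: rat) \<le> of_nat (lkp m1 l + 1)" by (simp only: of_nat_le_iff)
    then show "2 \<le> R (shift e U) l" using R[OF I_closed[OF j l]] by simp
  qed
  show ?thesis
  proof (cases "\<exists>p. pv j = Some p \<and> p \<in> I")
    case False
    have "hits e m1 = {}"
    proof (rule ccontr)
      assume "hits e m1 \<noteq> {}"
      then obtain U where U: "U \<in> hits e m1" by blast
      then have "U \<in> Us e" by (simp add: hits_def)
      from fire_possible[OF e this j H1[OF U]] False show False by metis
    qed
    then show ?thesis using False unfolding rel_def m1_def[symmetric] by (auto simp: phi_def split: option.splits)
  next
    case True
    then obtain p where p: "pv j = Some p" "p \<in> I" by blast
    have nxp: "nx p = Some j" using pv_nx[OF jV p(1)] by simp
    have pj: "p \<noteq> j" using nx_pv[OF I_V[OF p(2)] nxp] by blast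
    define m2 where "m2 = t + (row p - mon j 1)"
    \<comment> \<open>The two monomials differ by \<open>row p - row j\<close>, which is exactly the
      effect of inserting \<open>p\<close>.\<close>
    have diff: "of_nat (lkp m2 i) = (of_nat (lkp m1 i) :: rat) + of_nat (lkp (row p) i) - of_nat (lkp (row j) i)" for i
      unfolding m1_def m2_def lookup_add lookup_row_pv[OF jV p(1)] lookup_row_self[OF jV]
      using aj nxp pj by (auto simp: lookup_row of_nat_diff)
    have bij: "bij_betw (insert p) (hits e m1) (hits e m2)"
    proof (rule bij_betw_byWitness[where f' = "\<lambda>U. U - {p}"])
      have 1: "p \<notin> U \<and> insert p U \<in> Us e" if U: "U \<in> hits e m1" for U
      proof -
        have "U \<in> Us e" using U by (simp add: hits_def)
        from fire_possible[OF e this j H1[OF U]] p(1) show ?thesis by (metis option.inject)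
      qed
      show "\<forall>U\<in>hits e m1. insert p U - {p} = U" using 1 by blast
      show "insert p ` hits e m1 \<subseteq> hits e m2"
      proof (rule image_subsetI)
        fix U assume U: "U \<in> hits e m1"
        show "insert p U \<in> hits e m2"
          using 1[OF U] U R_shift_insert[OF p(2) _ nxp, of U] by (auto simp: hits_def diff)
      qed
      have 2: "p \<in> U" if U: "U \<in> hits e m2" for U
      proof (rule fired[OF e _ p(2)])
        show "U \<in> Us e" using U by (simp add: hits_def)
        have "R (shift e U) p = of_nat (lkp m2 p) + 1" using U p(2) by (auto simp: hits_def)
        moreover have "a p \<le> lkp m2 p" unfolding m2_def lookup_add lookup_row_pv[OF jV p(1)] by simp
        then have "(of_nat (a p) :: rat) \<le> of_nat (lkp m2 p)" by (simp only: of_nat_le_iff)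
        ultimately show "of_nat (a p) + 1 \<le> R (shift e U) p" by simp
      qed
      show "\<forall>U\<in>hits e m2. insert p (U - {p}) = U" using 2 by blast
      show "(\<lambda>U. U - {p}) ` hits e m2 \<subseteq> hits e m1"
      proof (rule image_subsetI)
        fix U assume U: "U \<in> hits e m2"
        have "insert p (U - {p}) = U" using 2[OF U] by blast
        then have "R (shift e (U - {p})) i = of_nat (lkp m1 i) + 1" if "i \<in> I" for i
          using R_shift_insert[OF p(2) _ nxp that, of "U - {p}" e] U that by (auto simp: hits_def diff)
        moreover have "U - {p} \<in> Us e" using U by (auto simp: hits_def Us_def)
        ultimately show "U - {p} \<in> hits e m1" by (simp add: hits_def)
      qed
    qed
    have "phi e m2 = (\<Sum>U\<in>hits e m1. \<Prod>q\<in>insert p U. kap q)"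
      unfolding phi_def by (rule sum.reindex_bij_betw[OF bij, symmetric])
    also have "\<dots> = (\<Sum>U\<in>hits e m1. kap p * (\<Prod>q\<in>U. kap q))"
    proof (rule sum.cong[OF refl])
      fix U assume U: "U \<in> hits e m1"
      have Us: "U \<in> Us e" using U by (simp add: hits_def)
      then have "finite U" using finite_I finite_subset by (auto simp: Us_def)
      moreover have "p \<notin> U"
        using fire_possible[OF e Us j H1[OF U]] p(1) by (metis option.inject)
      ultimately show "(\<Prod>q\<in>insert p U. kap q) = kap p * (\<Prod>q\<in>U. kap q)" by simp
    qed
    also have "\<dots> = kap p * phi e m1" by (simp add: phi_def sum_distrib_left)
    finally show ?thesis
      using p nxp c_nz[OF I_V[OF p(2)]] unfolding rel_def m1_def[symmetric]
      by (simp add: kap_def m2_def[symmetric] del: One_nat_def)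
  qed
qed

text \<open>No nonempty \<open>U\<close> leads from \<open>e\<close> to an element of
  \<open>E\<close>. For \<open>p\<close> in \<open>U\<close> the gain \<open>a p\<close> fits below
  the upper bound only if the second predecessor \<open>s\<close> of \<open>p\<close> is in
  \<open>U\<close> as well. With \<open>q\<close> between them this gives
  \<open>e s = a q * a p * e p\<close>, at least four times \<open>e p\<close>, against the choice
  of \<open>p\<close> with \<open>e p\<close> maximal.\<close>

lemma phi_mone:
  assumes e: "e \<in> E" and f: "f \<in> E"
  shows "phi e (mone f) = (if e = f then 1 else 0)"
proof -
  have hits: "hits e (mone f) = {U \<in> Us e. \<forall>i\<in>I. R (shift e U) i = R f i}"
    using lookup_mone[OF E_node[OF f]] by (auto simp: hits_def)
  have empty: "U = {}" if U: "U \<in> hits e (mone f)" for U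
  proof (rule ccontr)
    assume ne: "U \<noteq> {}"
    have Us: "U \<in> Us e" and R: "\<And>i. i \<in> I \<Longrightarrow> R (shift e U) i = R f i" using U by (auto simp: hits)
    have UI: "U \<subseteq> I" using Us by (simp add: Us_def)
    have fin: "finite U" using UI finite_I finite_subset by blast
    obtain p where p: "p \<in> U" and mx: "\<And>q. q \<in> U \<Longrightarrow> e q \<le> e p"
    proof -
      have "Max (e ` U) \<in> e ` U" using fin ne by (intro Max_in) auto
      then obtain p where "p \<in> U" "e p = Max (e ` U)" by force
      then show ?thesis using that fin by simp
    qed
    let ?Z = "\<lambda>i. ov (\<lambda>p. ov (ind U) (pv p)) (pv i) :: rat"
    have pI: "p \<in> I" using p UI by blast
    have ep: "0 < e p" using p Us E_range[OF e, of p] by (auto simp: Us_def order_less_le)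
    have nopv: "ov (ind U) (pv p) = (0::rat)" if p: "p \<in> U" for p
    proof (rule ccontr)
      assume "ov (ind U) (pv p) \<noteq> (0::rat)"
      then obtain q where q: "q \<in> U" "pv p = Some q" by (auto simp: ov_ind_cases split: if_splits)
      have "nx q = Some p" using pv_nx[of p q] q(2) p UI I_V by blast
      then show False using q(1) Us p by (auto simp: Us_def)
    qed
    have "R (shift e U) p = R e p + of_nat (a p) - ?Z p"
      using p nopv[OF p] by (simp add: R_shift ind_def)
    then have "R e p \<le> ?Z p" using R[OF pI] E_upper[OF f pI] by simp
    then have Z1: "?Z p = 1" and Rp: "R e p = 1"
      using E_lower[OF e pI] ov_ov_ind_range[of U "pv p"] by auto
    obtain q s where qs: "pv p = Some q" "pv q = Some s" "s \<in> U"
      using Z1 by (cases "pv p") (auto simp: ov_ind_cases split: if_splits)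
    have sI: "s \<in> I" using qs UI by blast
    have "q \<in> V" using pv_nx[OF I_V[OF pI] qs(1)] by simp
    then have nxs: "nx s = Some q" using pv_nx[OF _ qs(2)] by simp
    then have qI: "q \<in> I" using I_closed[OF sI] by simp
    have qU: "q \<notin> U" using nxs qs(3) Us by (auto simp: Us_def)
    have "R (shift e U) q = R e q - (of_nat (a q) - 1) - ?Z q"
      using qU qs by (simp add: R_shift ind_def)
    then have "of_nat (a q) \<le> R e q"
      using R[OF qI] E_lower[OF f qI] ov_ov_ind_range[of U "pv q"] by simp
    then have Rq: "of_nat (a q) * e q + e s = of_nat (a q)"
      using E_upper[OF e qI] qs by (simp add: R_def)
    have "of_nat (a p) * e p + e q = 1" using Rp qs by (simp add: R_def)
    then have "e s = of_nat (a q) * (of_nat (a p) * e p)"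
      using Rq by (metis add_diff_cancel_left' add_diff_cancel_right' mult.right_neutral right_diff_distrib)
    moreover have "2 * (2 * e p) \<le> of_nat (a q) * (of_nat (a p) * e p)"
      using a_rat_ge2[OF I_V[OF pI]] a_rat_ge2[OF I_V[OF qI]] ep
      by (intro mult_mono mult_right_mono) auto
    ultimately have "e p < e s" using ep by simp
    then show False using mx[OF qs(3)] by simp
  qed
  have R0: "R (shift e {}) i = R e i" for i
    by (cases "pv i") (auto simp: R_shift ov_ind_cases ind_def)
  show ?thesis
  proof (cases "e = f")
    case True
    have "{} \<in> hits e (mone f)" unfolding hits using R0 by (simp add: Us_def True[symmetric])
    then have "hits e (mone f) = {{}}" using empty by blast
    then show ?thesis using True by (simp add: phi_def)
  next
    case False
    have "{} \<notin> hits e (mone f)"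
    proof
      assume "{} \<in> hits e (mone f)"
      then have "\<And>i. i \<in> I \<Longrightarrow> R e i = R f i" by (simp add: hits R0)
      then have "e = f" using e f by (intro R_inj[OF I_sub]) (auto simp: E_def)
      then show False using False by simp
    qed
    then have "hits e (mone f) = {}" using empty by blast
    then show ?thesis using False by (simp add: phi_def)
  qed
qed

text \<open>Moving a unit from \<open>nx p\<close> to \<open>p\<close> changes the pairing of
  \<open>m + 1\<close> with \<open>y\<close> by the difference of two entries of the exponent matrix
  applied to \<open>y\<close>. This difference is an integer if \<open>y\<close> is a symmetry, and
  0 if \<open>y\<close> consists of the weights.\<close>

lemma phi_nonzero_weight:
  assumes e: "e \<in> E" and nz: "phi e m \<noteq> 0"
  obtains U where "U \<subseteq> I" "\<And>p. p \<in> U \<Longrightarrow> nx p \<noteq> None"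
    "\<And>y. (\<Sum>i\<in>I. (of_nat (lkp m i) + 1) * y i) = (\<Sum>i\<in>I. R e i * y i) +
       (\<Sum>p\<in>U. (of_nat (a p) * y p + ov y (nx p)) - (of_nat (a (the (nx p))) * y (the (nx p)) + ov y (nx (the (nx p)))))"
proof -
  obtain U where U: "U \<in> hits e m"
    using nz unfolding phi_def by (metis sum.neutral equals0D ex_in_conv sum.empty)
  then have Us: "U \<in> Us e" and R: "\<And>i. i \<in> I \<Longrightarrow> of_nat (lkp m i) + 1 = R (shift e U) i"
    by (auto simp: hits_def)
  have UI: "U \<subseteq> I" using Us by (simp add: Us_def)
  show ?thesis
  proof (rule that[OF UI])
    fix p assume "p \<in> U" then show "nx p \<noteq> None" using Us by (auto simp: Us_def)
  next
    fix y :: "'v \<Rightarrow> rat"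
    define N where "N i = of_nat (a i) * y i + ov y (nx i)" for i
    have adj: "(\<Sum>i\<in>I. R f i * y i) = (\<Sum>i\<in>I. f i * N i)" if "supp_in I f" for f :: "'v \<Rightarrow> rat"
      unfolding N_def by (rule sum_R_adjoint[OF I_sub I_closed that])
    \<comment> \<open>Adjointness needs a vector supported in \<open>I\<close>. On \<open>V\<close>
      the truncation changes nothing, because \<open>I\<close> is closed under
      \<open>nx\<close>.\<close>
    define s where "s i = (if i \<in> I then shift e U i else 0)" for i
    have outside: "ov (ind U) (pv i) = (0::rat)" if "i \<in> V" "i \<notin> I" for i
    proof (rule ccontr)
      assume "ov (ind U) (pv i) \<noteq> (0::rat)"
      then obtain q where q: "q \<in> U" "pv i = Some q" by (auto simp: ov_ind_cases split: if_splits)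
      then show False using pv_nx[OF that(1) q(2)] I_closed[of q i] UI that(2) by blast
    qed
    have "shift e U i = s i" if "i \<in> V" for i
      using outside[of i] UI E_supp[OF e, of i] that by (auto simp: s_def shift_def ind_def)
    then have "R (shift e U) i = R s i" if "i \<in> I" for i
      by (rule R_cong) (use I_V[OF that] in auto)
    then have "(\<Sum>i\<in>I. (of_nat (lkp m i) + 1) * y i) = (\<Sum>i\<in>I. R s i * y i)"
      using R by simp
    also have "\<dots> = (\<Sum>i\<in>I. s i * N i)" by (rule adj) (simp add: supp_in_def s_def)
    also have "\<dots> = (\<Sum>i\<in>I. e i * N i) + (\<Sum>i\<in>I. ind U i * N i) - (\<Sum>i\<in>I. ov (ind U) (pv i) * N i)"
      by (simp add: s_def shift_def algebra_simps sum.distrib sum_subtractf)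
    also have "(\<Sum>i\<in>I. e i * N i) = (\<Sum>i\<in>I. R e i * y i)"
      by (rule adj[symmetric]) (use e in \<open>simp add: E_def\<close>)
    also have "(\<Sum>i\<in>I. ov (ind U) (pv i) * N i) = (\<Sum>i\<in>I. ind U i * ov N (nx i))"
      by (rule sum_ov_adjoint[OF I_sub I_closed]) (use UI in \<open>auto simp: supp_in_def ind_def\<close>)
    also have "\<dots> = (\<Sum>p\<in>U. ov N (nx p))"
      using UI finite_I by (simp add: ind_def if_distrib[of "\<lambda>x. x * _"] sum.inter_restrict[symmetric] Int_absorb1 cong: if_cong)
    also have "\<dots> = (\<Sum>p\<in>U. N (the (nx p)))"
      using Us by (intro sum.cong) (auto simp: Us_def)
    also have "(\<Sum>i\<in>I. ind U i * N i) = (\<Sum>p\<in>U. N p)"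
      using UI finite_I by (simp add: ind_def if_distrib[of "\<lambda>x. x * _"] sum.inter_restrict[symmetric] Int_absorb1 cong: if_cong)
    finally show "(\<Sum>i\<in>I. (of_nat (lkp m i) + 1) * y i) = (\<Sum>i\<in>I. R e i * y i) +
       (\<Sum>p\<in>U. (of_nat (a p) * y p + ov y (nx p)) - (of_nat (a (the (nx p))) * y (the (nx p)) + ov y (nx (the (nx p)))))"
      by (simp add: N_def sum_subtractf)
  qed
qed

end

section \<open>Functionals that vanish on the relations and on the basis monomials are zero\<close>

context inv_sub
begin

lemma node_supp: "node e \<Longrightarrow> supp_in I e"
  by (simp add: node_def)

lemma mone_eqI:
  assumes "node e" "kys m \<subseteq> I" "\<And>i. i \<in> I \<Longrightarrow> R e i = of_nat (lkp m i) + 1"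
  shows "mone e = m"
  unfolding mone_def
proof (rule mexp_eqI[OF finite_I assms(2)])
  fix i assume "i \<in> I"
  then show "lkp m i = nat \<lfloor>R e i\<rfloor> - 1"
    using assms(3)[of i] by (simp add: nat_add_distrib)
qed

lemma monomial_is_mone:
  assumes m: "kys m \<subseteq> I"
  obtains e where "node e" "mone e = m"
proof -
  obtain e :: "'v \<Rightarrow> rat" where e: "supp_in I e" "\<And>i. i \<in> I \<Longrightarrow> R e i = of_nat (lkp m i) + 1"
    using R_solvable[OF I_sub, of "\<lambda>i. of_nat (lkp m i) + 1"] by metis
  then have "node e" by (simp add: node_def)
  then show ?thesis using that mone_eqI[OF _ m] e(2) by blast
qed

definition move :: "('v \<Rightarrow> rat) \<Rightarrow> 'v \<Rightarrow> 'v \<Rightarrow> 'v \<Rightarrow> rat" where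
  "move e j p = (\<lambda>i. e i + (dl p i - dl j i))"

lemma R_move:
  assumes "i \<in> I" "j \<in> I" "p \<in> I"
  shows "R (move e j p) i = R e i + (of_nat (lkp (row p) i) - of_nat (lkp (row j) i))"
proof -
  have "R (dl k) i = (of_nat (lkp (row k) i) :: rat)" if "k \<in> I" for k
    by (rule R_dl) (use assms that I_V in auto)
  then show ?thesis using assms by (simp add: move_def R_add R_diff)
qed

lemma supp_move: "supp_in I e \<Longrightarrow> j \<in> I \<Longrightarrow> p \<in> I \<Longrightarrow> supp_in I (move e j p)"
  by (auto simp: supp_in_def move_def dl_def)

lemma sum_move: 
  assumes "j \<in> I" "p \<in> I" shows "(\<Sum>i\<in>I. move e j p i * f i) = (\<Sum>i\<in>I. e i * f i) + f p - f j"
proof -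
  have "(\<Sum>i\<in>I. dl k i * f i) = f k" if "k \<in> I" for k
    using that finite_I by (simp add: dl_def if_distrib[of "\<lambda>x. x * _"] cong: if_cong)
  then show ?thesis using assms by (simp add: move_def algebra_simps sum.distrib sum_subtractf)
qed

context
  fixes w :: "'v exponent \<Rightarrow> complex"
  assumes rel: "\<And>t j. kys t \<subseteq> I \<Longrightarrow> j \<in> I \<Longrightarrow> rel w t j = 0"
    and val: "\<And>e. e \<in> E \<Longrightarrow> w (mone e) = 0"
begin

text \<open>Multiplying the \<open>j\<close>-th derivative by \<open>z_j\<close> turns the relations
  into the linear system \<open>R v = 0\<close>, and \<open>R\<close> is injective. In other words,
  every single term of the polynomial lies in its Jacobian ideal.\<close>

lemma w_above_row:
  assumes t: "kys t \<subseteq> I" and i: "i \<in> I"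
  shows "w (t + row i) = 0"
proof -
  define v where "v k = (if k \<in> I then c k * w (t + row k) else 0)" for k
  have "v i = 0"
  proof (rule R_zero_complex[OF I_sub])
    show "supp_in I v" by (simp add: supp_in_def v_def)
    fix j assume j: "j \<in> I"
    have jV: "j \<in> V" by (rule I_V[OF j])
    have 1: "t + mon j 1 + (row j - mon j 1) = t + row j"
      using a_ge2[OF jV] nx_pv[OF jV, of j]
      by (intro poly_mapping_eqI) (auto simp: lookup_add lookup_minus lookup_single when_def lookup_row)
    have 2: "t + mon j 1 + (row p - mon j 1) = t + row p" if "pv j = Some p" for p
      using pv_nx[OF jV that]
      by (intro poly_mapping_eqI) (auto simp: lookup_add lookup_minus lookup_single when_def lookup_row)
    have "kys (t + mon j 1) \<subseteq> I" using t j by (simp add: keys_exponent_add)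
    from rel[OF this j] show "R v j = 0"
      using j by (auto simp: rel_def R_def v_def 1 2 mult.assoc simp del: One_nat_def split: option.splits if_splits)
  qed
  then show ?thesis using i c_nz[OF I_V[OF i]] by (simp add: v_def)
qed

text \<open>As \<open>R e\<close> is the exponent plus 1, the bounds say that \<open>row i\<close>
  divides the monomial.\<close>

lemma w_node_above:
  assumes e: "node e" and i: "i \<in> I" and Ri: "of_nat (a i) + 1 \<le> R e i"
    and Rl: "\<And>l. nx i = Some l \<Longrightarrow> 2 \<le> R e l"
  shows "w (mone e) = 0"
proof -
  have le: "lkp (row i) k \<le> lkp (mone e) k" for k
  proof (cases "k \<in> I")
    case True
    have *: "of_nat (lkp (mone e) k) + 1 = R e k" by (rule lookup_mone[OF e True])
    have "(of_nat (lkp (row i) k) :: rat) + 1 \<le> R e k"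
    proof (cases "k = i")
      case True
      then show ?thesis using Ri nx_pv[OF I_V[OF i], of i] by (auto simp: lookup_row)
    next
      case False
      then show ?thesis using Rl[of k] e \<open>k \<in> I\<close> by (auto simp: lookup_row node_def)
    qed
    then have "(of_nat (lkp (row i) k) :: rat) \<le> of_nat (lkp (mone e) k)" using * by linarith
    then show ?thesis by (simp only: of_nat_le_iff)
  next
    case False
    then show ?thesis using i I_closed[OF i, of k] by (auto simp: lookup_row)
  qed
  have "mone e - row i + row i = mone e"
    by (rule poly_mapping_eqI) (simp add: lookup_add lookup_minus le)
  moreover have "kys (mone e - row i) \<subseteq> I"
    using keys_mone[of e] by (auto simp: in_keys_iff lookup_minus subset_iff)
  ultimately show ?thesis using w_above_row[OF _ i, of "mone e - row i"] by simp
qed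

text \<open>The bounds say that \<open>row j - mon j 1\<close> divides the monomial, so the
  \<open>j\<close>-th relation applies to it. It moves a unit of \<open>e\<close> from
  \<open>j\<close> to the predecessor, or kills the monomial if there is none in
  \<open>I\<close>.\<close>

lemma w_node_rel:
  assumes e: "node e" and j: "j \<in> I" and Rj: "of_nat (a j) \<le> R e j"
    and Rl: "\<And>l. nx j = Some l \<Longrightarrow> 2 \<le> R e l"
  shows "\<not> (\<exists>p. pv j = Some p \<and> p \<in> I) \<Longrightarrow> w (mone e) = 0"
    and "pv j = Some p \<Longrightarrow> p \<in> I \<Longrightarrow> node (move e j p) \<and>
      of_nat (a j) * c j * w (mone e) + c p * w (mone (move e j p)) = 0"
proof -
  have jV: "j \<in> V" by (rule I_V[OF j])
  let ?d = "row j - mon j 1"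
  define t where "t = mone e - ?d"
  have aj: "1 \<le> a j" using a_ge2[OF jV] by simp
  have le: "lkp ?d k \<le> lkp (mone e) k" for k
  proof (cases "k \<in> I")
    case True
    have *: "of_nat (lkp (mone e) k) + 1 = R e k" by (rule lookup_mone[OF e True])
    have "(of_nat (lkp ?d k) :: rat) + 1 \<le> R e k"
      unfolding lookup_row_self[OF jV]
      using Rj Rl[of k] e True aj nx_pv[OF jV, of j] by (auto simp: node_def of_nat_diff)
    then have "(of_nat (lkp ?d k) :: rat) \<le> of_nat (lkp (mone e) k)" using * by linarith
    then show ?thesis by (simp only: of_nat_le_iff)
  next
    case False
    then show ?thesis unfolding lookup_row_self[OF jV] using j I_closed[OF j, of k] by auto
  qed
  have te: "t + ?d = mone e"
    by (rule poly_mapping_eqI) (use le in \<open>simp add: t_def lookup_add lookup_minus[of "mone e"]\<close>)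
  have kt: "kys t \<subseteq> I"
    using keys_mone[of e] by (auto simp: t_def in_keys_iff lookup_minus[of "mone e"] subset_iff)
  note r = rel[OF kt j]
  show "w (mone e) = 0" if "\<not> (\<exists>p. pv j = Some p \<and> p \<in> I)"
    using r that aj c_nz[OF jV] unfolding rel_def te by (auto split: option.splits)
  show "node (move e j p) \<and> of_nat (a j) * c j * w (mone e) + c p * w (mone (move e j p)) = 0"
    if p: "pv j = Some p" "p \<in> I"
  proof -
    let ?d' = "row p - mon j 1"
    have nxp: "nx p = Some j" using pv_nx[OF jV p(1)] by simp
    have R': "R (move e j p) i = of_nat (lkp (t + ?d') i) + 1" if i: "i \<in> I" for i
    proof -
      have "R e i = of_nat (lkp (t + ?d) i) + 1" unfolding te using lookup_mone[OF e i] by simp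
      moreover have "(of_nat (lkp (row p) i) :: rat) - of_nat (lkp (row j) i) = of_nat (lkp ?d' i) - of_nat (lkp ?d i)"
        unfolding lookup_row_self[OF jV] lookup_row_pv[OF jV p(1)] using aj nxp
        by (auto simp: lookup_row of_nat_diff)
      ultimately show ?thesis using R_move[OF i j p(2), of e] by (simp add: lookup_add)
    qed
    have n: "node (move e j p)"
      unfolding node_def using supp_move[OF node_supp[OF e] j p(2)] R' by auto
    have "mone (move e j p) = t + ?d'"
    proof (rule mone_eqI[OF n _ R'])
      show "kys (t + ?d') \<subseteq> I"
        using kt p(2) lookup_row_pv[OF jV p(1)] by (auto simp: keys_exponent_add in_keys_iff split: if_splits)
    qed
    then show ?thesis using r n p unfolding rel_def te by simp
  qed
qed

lemma finite_nodes_bounded: "finite {e. node e \<and> (\<forall>i\<in>I. \<bar>e i\<bar> \<le> N)}"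
proof -
  define M where "M = (\<Sum>i\<in>I. of_nat (a i) + 1) * \<bar>N\<bar>"
  have "{e. node e \<and> (\<forall>i\<in>I. \<bar>e i\<bar> \<le> N)} \<subseteq> {e. supp_in I e \<and> (\<forall>i\<in>I. R e i \<in> \<int> \<and> \<bar>R e i\<bar> \<le> M)}"
  proof safe
    fix e i assume e: "node e" "\<forall>i\<in>I. \<bar>e i\<bar> \<le> N" and i: "i \<in> I"
    have 1: "\<bar>e k\<bar> \<le> \<bar>N\<bar>" for k
      using e by (cases "k \<in> I") (force simp: node_def supp_in_def)+
    have "\<bar>R e i\<bar> \<le> of_nat (a i) * \<bar>e i\<bar> + \<bar>ov e (pv i)\<bar>"
      unfolding R_def by (rule order_trans[OF abs_triangle_ineq]) (simp add: abs_mult)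
    also have "\<dots> \<le> of_nat (a i) * \<bar>N\<bar> + \<bar>N\<bar>"
      using 1 by (intro add_mono mult_left_mono) (cases "pv i"; simp)+
    also have "\<dots> = (of_nat (a i) + 1) * \<bar>N\<bar>" by (simp add: algebra_simps)
    also have "\<dots> \<le> M" unfolding M_def
      using i finite_I by (intro mult_right_mono member_le_sum) auto
    finally show "\<bar>R e i\<bar> \<le> M" .
  qed (auto simp: node_def)
  then show ?thesis using finite_R_bounded[OF I_sub] finite_subset by blast
qed

text \<open>Minimising \<open>\<Sum>e\<^sub>i\<^sup>2\<close> among the nodes on which \<open>w\<close> does not vanish: an entry above 1 can always be
  moved to the next variable, which decreases the sum of squares.\<close>

lemma w_zero_or_box:
  assumes "node e0" "w (mone e0) \<noteq> 0"
  obtains e where "node e" "w (mone e) \<noteq> 0" "\<And>i. i \<in> I \<Longrightarrow> 0 \<le> e i \<and> e i \<le> 1"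
proof -
  define Q where "Q e = (\<Sum>i\<in>I. e i * e i)" for e :: "'v \<Rightarrow> rat"
  define S where "S = {e. node e \<and> w (mone e) \<noteq> 0 \<and> Q e \<le> Q e0}"
  have "S \<subseteq> {e. node e \<and> (\<forall>i\<in>I. \<bar>e i\<bar> \<le> Q e0 + 1)}"
  proof safe
    fix e i assume e: "e \<in> S" and i: "i \<in> I"
    have "\<bar>e i\<bar> * \<bar>e i\<bar> \<le> Q e"
      unfolding Q_def using finite_I i member_le_sum[of i I "\<lambda>i. e i * e i"] by auto
    then have "\<bar>e i\<bar> * \<bar>e i\<bar> \<le> Q e0" using e by (simp add: S_def)
    moreover have "0 \<le> (\<bar>e i\<bar> - 1) * (\<bar>e i\<bar> - 1)" by simp
    then have "2 * \<bar>e i\<bar> \<le> \<bar>e i\<bar> * \<bar>e i\<bar> + 1" by (simp add: algebra_simps)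
    ultimately show "\<bar>e i\<bar> \<le> Q e0 + 1" by linarith
  qed (auto simp: S_def)
  then have finS: "finite S" using finite_nodes_bounded finite_subset by blast
  have "e0 \<in> S" using assms by (simp add: S_def)
  then obtain e where e: "e \<in> S" and min: "\<And>f. f \<in> S \<Longrightarrow> Q e \<le> Q f"
    using ex_is_arg_min_if_finite[OF finS, of Q] by (force simp: is_arg_min_linorder)
  have ne: "node e" and we: "w (mone e) \<noteq> 0" using e by (auto simp: S_def)
  show ?thesis
  proof (rule that[OF ne we], rule ccontr)
    fix k assume k: "k \<in> I" and bad: "\<not> (0 \<le> e k \<and> e k \<le> 1)"
    \<comment> \<open>The entry farthest from 1/2 is taken; every other entry, and the value 0 of a
      missing neighbour, is then at most as far from 1/2.\<close>
    define M where "M = Max ((\<lambda>i. \<bar>e i - 1/2\<bar>) ` I)"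
    have "M \<in> (\<lambda>i. \<bar>e i - 1/2\<bar>) ` I" unfolding M_def using finite_I k by (intro Max_in) auto
    then obtain i where i: "i \<in> I" "M = \<bar>e i - 1/2\<bar>" by blast
    have leM: "\<bar>e l - 1/2\<bar> \<le> \<bar>e i - 1/2\<bar>" if "l \<in> I" for l
      using finite_I that i(2) unfolding M_def by (metis Max_ge finite_imageI imageI)
    have big: "1/2 < \<bar>e i - 1/2\<bar>" using leM[OF k] bad by (auto simp: abs_if split: if_splits)
    have ai: "(2::rat) \<le> of_nat (a i)" by (rule a_rat_ge2[OF I_V[OF i(1)]])
    have Ri: "1 \<le> R e i" "R e i \<in> \<int>" using ne i(1) by (auto simp: node_def)
    have ov_le: "\<bar>ov e (pv i) - 1/2\<bar> \<le> \<bar>e i - 1/2\<bar>"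
    proof (cases "pv i")
      case (Some p)
      then show ?thesis using leM[of p] ne big by (cases "p \<in> I") (auto simp: node_def supp_in_def)
    qed (use big in simp)
    have ei: "1 < e i"
    proof (rule ccontr)
      assume "\<not> 1 < e i"
      then have neg: "e i < 0" using big by (auto simp: abs_if split: if_splits)
      then have "of_nat (a i) * e i \<le> 2 * e i" using ai by (intro mult_right_mono_neg) auto
      moreover have "ov e (pv i) \<le> 1 - e i" using ov_le neg by (auto simp: abs_if split: if_splits)
      ultimately show False using Ri(1) neg unfolding R_def by linarith
    qed
    have "2 * (e i - 1) \<le> of_nat (a i) * (e i - 1)" using ai ei by (intro mult_right_mono) auto
    then have "of_nat (a i) < R e i" using ov_le ei
      by (auto simp: R_def abs_if algebra_simps split: if_splits)
    then have Rbig: "of_nat (a i) + 1 \<le> R e i" using Ri(2) by (intro Ints_less_imp_add1_le) auto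
    \<comment> \<open>If \<open>row i\<close> divided the monomial, \<open>w\<close> would vanish.
      The obstruction must be at the successor, whose entry turns out to be negative.\<close>
    obtain l where l: "nx i = Some l" "R e l < 2"
      using w_node_above[OF ne i(1) Rbig] we by (metis not_le)
    have lI: "l \<in> I" by (rule I_closed[OF i(1) l(1)])
    have pl: "pv l = Some i" "l \<noteq> i" using nx_pv[OF I_V[OF i(1)] l(1)] by auto
    have "R e l = 1"
      using l(2) ne lI Ints_less_imp_add1_le[of "R e l" 2] Ints_less_imp_add1_le[of 1 "R e l"]
      by (force simp: node_def)
    then have el: "of_nat (a l) * e l = 1 - e i" using pl(1) by (simp add: R_def algebra_simps)
    then have "of_nat (a l) * e l < 0" using ei by simp
    then have eln: "e l < 0" using a_rat_ge2[OF I_V[OF lI]] by (simp add: mult_less_0_iff)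
    let ?e' = "move e i l"
    have R': "R ?e' k = R e k + (of_nat (lkp (row l) k) - of_nat (lkp (row i) k))" if "k \<in> I" for k
      by (rule R_move[OF that i(1) lI])
    have n': "node ?e'"
      unfolding node_def
    proof (intro conjI ballI)
      show "supp_in I ?e'" by (rule supp_move[OF node_supp[OF ne] i(1) lI])
      fix k assume k: "k \<in> I"
      have "R e k \<in> \<int>" "1 \<le> R e k" using ne k by (auto simp: node_def)
      then show "R ?e' k \<in> \<int>" using R'[OF k] by simp
      have "nx i \<noteq> Some i" using l pl by auto
      then show "1 \<le> R ?e' k"
        using \<open>1 \<le> R e k\<close> Rbig l(1) pl(2) a_rat_ge2[OF I_V[OF lI]] unfolding R'[OF k]
        by (auto simp: lookup_row)
    qed
    \<comment> \<open>The relation is read backwards: applied at \<open>l\<close> to the moved node,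
      it leads back to \<open>e\<close>.\<close>
    have bk: "move ?e' l i = e" by (auto simp: move_def)
    have "of_nat (a l) * c l * w (mone ?e') + c i * w (mone e) = 0"
    proof -
      have "of_nat (a l) \<le> R ?e' l"
        unfolding R'[OF lI] \<open>R e l = 1\<close> using l pl by (auto simp: lookup_row)
      moreover have "2 \<le> R ?e' k" if k: "nx l = Some k" for k
      proof -
        have kI: "k \<in> I" by (rule I_closed[OF lI k])
        have kl: "k \<noteq> l" using nx_pv[OF I_V[OF lI] k] by simp
        have "1 \<le> R e k" using ne kI by (simp add: node_def)
        then show ?thesis unfolding R'[OF kI] using k kl l(1) Rbig by (auto simp: lookup_row)
      qed
      ultimately show ?thesis using w_node_rel(2)[OF n' lI _ _ pl(1) i(1)] bk by simp
    qed
    then have "w (mone ?e') \<noteq> 0" using we c_nz[OF I_V[OF i(1)]] by auto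
    \<comment> \<open>The sum of squares changes by \<open>2 * (e l - e i + 1)\<close>, negative
      since \<open>e l < 0\<close> and \<open>1 < e i\<close>.\<close>
    moreover have Q': "Q ?e' < Q e"
    proof -
      have "Q ?e' = (\<Sum>k\<in>I. move e i l k * ?e' k)" by (simp add: Q_def)
      also have "\<dots> = (\<Sum>k\<in>I. e k * ?e' k) + ?e' l - ?e' i" by (rule sum_move[OF i(1) lI])
      also have "(\<Sum>k\<in>I. e k * ?e' k) = Q e + e l - e i"
        using sum_move[OF i(1) lI, of e e] by (simp add: Q_def mult.commute)
      finally have "Q ?e' = Q e + e l - e i + ?e' l - ?e' i" .
      moreover have "?e' l - ?e' i = e l - e i + 2" using pl(2) by (simp add: move_def dl_def)
      ultimately show ?thesis using ei eln by simp
    qed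
    ultimately have "?e' \<in> S" using n' e by (simp add: S_def)
    then show False using min Q' by force
  qed
qed

text \<open>On the finite set of nodes with entries in \<open>[0, 1]\<close> the weighted modulus of \<open>w\<close> would have no
  maximum: moving an entry 1 to the previous variable doubles it at least.\<close>

lemma w_box_zero: "\<not> (node e0 \<and> w (mone e0) \<noteq> 0 \<and> (\<forall>i\<in>I. 0 \<le> e0 i \<and> e0 i \<le> 1))"
proof
  define S where "S = {e. node e \<and> w (mone e) \<noteq> 0 \<and> (\<forall>i\<in>I. 0 \<le> e i \<and> e i \<le> 1)}"
  assume "node e0 \<and> w (mone e0) \<noteq> 0 \<and> (\<forall>i\<in>I. 0 \<le> e0 i \<and> e0 i \<le> 1)"
  then have ne: "S \<noteq> {}" by (auto simp: S_def)
  have "S \<subseteq> {e. node e \<and> (\<forall>i\<in>I. \<bar>e i\<bar> \<le> 1)}" by (auto simp: S_def)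
  then have fin: "finite S" using finite_nodes_bounded finite_subset by blast
  \<comment> \<open>\<open>exp (L e)\<close> is the product of the \<open>cmod (c i)\<close> raised
    to the powers \<open>e i\<close>. It absorbs the coefficients, so that a move from
    \<open>i\<close> multiplies \<open>N\<close> by exactly \<open>a i\<close>.\<close>
  define L where "L e = (\<Sum>i\<in>I. of_rat (e i) * ln (cmod (c i)))" for e
  define N where "N e = cmod (w (mone e)) * exp (L e)" for e
  have "Max (N ` S) \<in> N ` S" using fin ne by (intro Max_in) auto
  then obtain e where e: "e \<in> S" and mx: "\<And>f. f \<in> S \<Longrightarrow> N f \<le> N e"
    using fin by (metis (no_types, lifting) Max_ge finite_imageI imageE imageI)
  have nod: "node e" and we: "w (mone e) \<noteq> 0" and box: "\<And>i. i \<in> I \<Longrightarrow> 0 \<le> e i \<and> e i \<le> 1"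
    using e by (auto simp: S_def)
  have sup: "supp_in I e" by (rule node_supp[OF nod])
  have box': "0 \<le> e i" "e i \<le> 1" for i using box sup by (cases "i \<in> I"; simp add: supp_in_def)+
  have ovbox: "0 \<le> ov e x" "ov e x \<le> 1" for x using box' by (cases x; simp)+
  have "e \<notin> E" using val we by blast
  moreover have "\<exists>p. pv i = Some p \<and> e p = 1" if "i \<in> I" "e i = 0" for i
  proof -
    have "1 \<le> ov e (pv i)" using nod that by (auto simp: node_def R_def)
    then show ?thesis using ovbox(2)[of "pv i"] by (cases "pv i") auto
  qed
  \<comment> \<open>The condition at entries 0 follows from \<open>1 \<le> R e\<close>, so a node
    outside \<open>E\<close> violates the condition at some entry 1.\<close>
  ultimately obtain i where i: "i \<in> I" "e i = 1" and viol: "\<And>j. nx i = Some j \<Longrightarrow> e j \<noteq> 0"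
    using nod box by (auto simp: E_def node_def)
  have ai: "(2::rat) \<le> of_nat (a i)" by (rule a_rat_ge2[OF I_V[OF i(1)]])
  have Rl: "2 \<le> R e l" if l: "nx i = Some l" for l
  proof -
    have lI: "l \<in> I" by (rule I_closed[OF i(1) l])
    have "pv l = Some i" using nx_pv[OF I_V[OF i(1)] l] by auto
    then have "R e l = of_nat (a l) * e l + 1" using i(2) by (simp add: R_def)
    moreover have "0 < e l" using viol[OF l] box'(1)[of l] by simp
    ultimately have "1 < R e l" using a_rat_ge2[OF I_V[OF lI]] by simp
    then show ?thesis
      using nod lI Ints_less_imp_add1_le[of 1 "R e l"] by (simp add: node_def)
  qed
  have Ri: "R e i = of_nat (a i) + ov e (pv i)" using i(2) by (simp add: R_def)
  have "ov e (pv i) = R e i - of_nat (a i)" using Ri by simp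
  then have "ov e (pv i) \<in> \<int>" using nod i(1) by (auto simp: node_def)
  \<comment> \<open>A predecessor with entry 1 would give \<open>R e i = a i + 1\<close>, and
    \<open>row i\<close> would divide the monomial.\<close>
  moreover have "ov e (pv i) \<noteq> 1"
    using w_node_above[OF nod i(1) _ Rl] we Ri by auto
  ultimately have ov0: "ov e (pv i) = 0"
    using ovbox[of "pv i"] Ints_less_imp_add1_le[of 0 "ov e (pv i)"] by force
  have Ri': "of_nat (a i) \<le> R e i" using Ri ov0 by simp
  obtain p where p: "pv i = Some p" "p \<in> I"
    using w_node_rel(1)[OF nod i(1) Ri' Rl] we by blast
  let ?e' = "move e i p"
  have n': "node ?e'" and r: "of_nat (a i) * c i * w (mone e) + c p * w (mone ?e') = 0"
    using w_node_rel(2)[OF nod i(1) Ri' Rl p] by auto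
  have ep: "e p = 0" using ov0 p by simp
  have pi: "p \<noteq> i" using ep i by auto
  have nz: "c i \<noteq> 0" "c p \<noteq> 0" using c_nz I_V i p by auto
  have w': "cmod (w (mone ?e')) * cmod (c p) = real (a i) * cmod (c i) * cmod (w (mone e))"
  proof -
    have "c p * w (mone ?e') = - (of_nat (a i) * c i * w (mone e))" using r by (simp add: eq_neg_iff_add_eq_0 add.commute)
    then have "cmod (c p * w (mone ?e')) = cmod (of_nat (a i) * c i * w (mone e))" by simp
    then show ?thesis by (simp add: norm_mult mult.commute)
  qed
  have "a i \<noteq> 0" using a_ge2[OF I_V[OF i(1)]] by simp
  then have "w (mone ?e') \<noteq> 0" using w' we nz by auto
  then have S': "?e' \<in> S"
    using n' box i p ep pi by (auto simp: S_def move_def dl_def)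
  have "L ?e' = L e + ln (cmod (c p)) - ln (cmod (c i))"
  proof -
    have 1: "(\<Sum>k\<in>I. of_rat (dl j k) * ln (cmod (c k))) = ln (cmod (c j))" if "j \<in> I" for j
    proof -
      have "(\<Sum>k\<in>I. of_rat (dl j k) * ln (cmod (c k))) = (\<Sum>k\<in>I. if k = j then ln (cmod (c k)) else 0)"
        by (rule sum.cong) (auto simp: dl_def)
      then show ?thesis using that finite_I by simp
    qed
    have "L ?e' = L e + ((\<Sum>k\<in>I. of_rat (dl p k) * ln (cmod (c k))) - (\<Sum>k\<in>I. of_rat (dl i k) * ln (cmod (c k))))"
      by (simp add: L_def move_def of_rat_add of_rat_diff algebra_simps sum.distrib sum_subtractf)
    then show ?thesis using 1 i p by simp
  qed
  then have "exp (L ?e') = exp (L e) * cmod (c p) / cmod (c i)"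
    using nz by (simp add: exp_add exp_diff)
  then have "N ?e' = (cmod (w (mone ?e')) * cmod (c p)) * exp (L e) / cmod (c i)"
    by (simp add: N_def algebra_simps)
  also have "\<dots> = real (a i) * N e" using nz by (simp add: w' N_def)
  finally have "N ?e' = real (a i) * N e" .
  moreover have "0 < N e" using we by (simp add: N_def)
  then have "N e < real (a i) * N e" using a_ge2[OF I_V[OF i(1)]] by simp
  ultimately show False using mx[OF S'] by simp
qed

lemma w_zero:
  assumes "kys m \<subseteq> I" shows "w m = 0"
proof (rule ccontr)
  assume "w m \<noteq> 0"
  moreover obtain e where "node e" "mone e = m" using monomial_is_mone[OF assms] .
  ultimately show False using w_zero_or_box[of e] w_box_zero by metis
qed

end

end

lemma cis_two_pi_Ints: "k \<in> \<int> \<Longrightarrow> cis (2 * pi * of_rat k) = 1"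
proof (elim Ints_cases)
  fix n :: int assume "k = of_int n"
  then show ?thesis by (simp add: cis_multiple_2pi)
qed

lemma ideal_jacobian_ideal:
  assumes "\<And>i. i \<in> I \<Longrightarrow> mpoly_deriv i (restrict_poly I W) \<in> carrier (mpoly_ring I)"
  shows "ideal (jacobian_ideal I W) (mpoly_ring I)"
proof -
  interpret cring "mpoly_ring I" by (rule cring_mpoly_ring)
  show ?thesis unfolding jacobian_ideal_def
    by (rule genideal_ideal) (use assms in auto)
qed

section \<open>The Jacobian ideal as the common kernel of the dual functionals\<close>

context inv_struct
begin

text \<open>The exponent matrix applied to \<open>h\<close>, that is, the weights of the terms:
  integral for a symmetry, 1 for the weights of the polynomial.\<close>

definition symm_weights :: "('v \<Rightarrow> rat) \<Rightarrow> 'v \<Rightarrow> rat" where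
  "symm_weights h i = of_nat (a i) * h i + ov h (nx i)"

lemma row_inj: "inj_on row V"
proof (rule inj_onI)
  fix i j assume i: "i \<in> V" and j: "j \<in> V" and eq: "row i = row j"
  show "i = j"
  proof (rule ccontr)
    assume "i \<noteq> j"
    then have "lkp (row j) i \<le> 1" by (simp add: lookup_row)
    moreover have "2 \<le> lkp (row i) i" using a_ge2[OF i] by (simp add: lookup_row)
    ultimately show False using eq by simp
  qed
qed

lemma lookup_wpoly:
  assumes "I \<subseteq> V" and that: "i \<in> V"
  shows "lkp (wpoly I) (row i) = (if i \<in> I then c i else 0)"
proof -
  have fin: "finite I" using assms finite_V finite_subset by blast
  have "lkp (wpoly I) (row i) = (\<Sum>k\<in>I. if k = i then c k else 0)"
    unfolding wpoly_def lookup_sum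
  proof (rule sum.cong[OF refl])
    fix k assume "k \<in> I"
    then show "lkp (mon (row k) (c k)) (row i) = (if k = i then c k else 0)"
      using inj_onD[OF row_inj, of k i] assms that by (auto simp: lookup_single when_def)
  qed
  then show ?thesis using fin by simp
qed

lemma keys_wpoly:
  assumes "I \<subseteq> V" shows "kys (wpoly I) = row ` I"
proof
  show "kys (wpoly I) \<subseteq> row ` I"
  proof
    fix m assume "m \<in> kys (wpoly I)"
    then have "(\<Sum>k\<in>I. lkp (mon (row k) (c k)) m) \<noteq> 0"
      by (simp add: in_keys_iff wpoly_def lookup_sum)
    then obtain k where "k \<in> I" "lkp (mon (row k) (c k)) m \<noteq> 0"
      by (rule sum.not_neutral_contains_not_neutral)
    then show "m \<in> row ` I" by (auto simp: lookup_single when_def split: if_splits)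
  qed
  show "row ` I \<subseteq> kys (wpoly I)"
    using lookup_wpoly[OF assms] c_nz assms by (auto simp: in_keys_iff)
qed

lemma keys_row_subset: 
  assumes "i \<in> V" shows "kys (row i) \<subseteq> I \<longleftrightarrow> i \<in> I \<and> (\<forall>j. nx i = Some j \<longrightarrow> j \<in> I)"
  using a_ge2[OF assms] nx_pv[OF assms] by (auto simp: subset_iff in_keys_iff lookup_row)

end

context inv_sub
begin

text \<open>As \<open>I\<close> is closed under \<open>nx\<close>, a term involves only variables of
  \<open>I\<close> as soon as its first variable is in \<open>I\<close>.\<close>

lemma restrict_wpoly: "restrict_poly I (wpoly V) = wpoly I"
proof -
  have "{m \<in> kys (wpoly V). kys m \<subseteq> I} = row ` I"
  proof -
    have "kys (row i) \<subseteq> I \<longleftrightarrow> i \<in> I" if "i \<in> V" for i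
      using keys_row_subset[OF that] I_closed by blast
    then show ?thesis using I_sub by (auto simp: keys_wpoly)
  qed
  then have "restrict_poly I (wpoly V) = (\<Sum>i\<in>I. mon (row i) (lkp (wpoly V) (row i)))"
    unfolding restrict_poly_def
    using sum.reindex[OF inj_on_subset[OF row_inj I_sub], of "\<lambda>m. mon m (lkp (wpoly V) m)"] by simp
  also have "\<dots> = wpoly I"
    unfolding wpoly_def[of I] by (rule sum.cong) (auto simp: lookup_wpoly I_V)
  finally show ?thesis .
qed

lemma mpoly_deriv_wpoly:
  assumes j: "j \<in> I"
  shows "mpoly_deriv j (wpoly I) = mon (row j - mon j 1) (of_nat (a j) * c j) +
    (case pv j of None \<Rightarrow> 0 | Some p \<Rightarrow> if p \<in> I then mon (row p - mon j 1) (c p) else 0)"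
    (is "_ = ?A + ?B")
proof -
  have jV: "j \<in> V" by (rule I_V[OF j])
  let ?t = "\<lambda>i. mon (row i - mon j 1) (of_nat (lkp (row i) j) * c i)"
  have "mpoly_deriv j (wpoly I) = (\<Sum>i\<in>I. ?t i)"
    unfolding mpoly_deriv_eq_mterm wpoly_def mterm_sum by simp
  also have "\<dots> = ?t j + (\<Sum>i\<in>I - {j}. ?t i)"
    using finite_I j by (simp add: sum.remove)
  also have "?t j = ?A" using nx_pv[OF jV, of j] by (auto simp: lookup_row)
  also have "(\<Sum>i\<in>I - {j}. ?t i) = (\<Sum>i\<in>I - {j}. if pv j = Some i then mon (row i - mon j 1) (c i) else 0)"
    using nx_iff_pv[OF I_V jV] by (intro sum.cong) (auto simp: lookup_row)
  also have "\<dots> = ?B"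
  proof (cases "\<exists>p\<in>I. pv j = Some p")
    case True
    then obtain p where p: "p \<in> I" "pv j = Some p" by blast
    then have "p \<noteq> j" using pv_nx[OF jV p(2)] nx_pv[of p j] by auto
    have "(\<Sum>i\<in>I - {j}. if pv j = Some i then mon (row i - mon j 1) (c i) else 0) =
      (\<Sum>i\<in>I - {j}. if i = p then mon (row i - mon j 1) (c i) else 0)"
      using p by (intro sum.cong) auto
    also have "\<dots> = mon (row p - mon j 1) (c p)" using finite_I p \<open>p \<noteq> j\<close> by simp
    finally show ?thesis using p by simp
  next
    case False
    then show ?thesis by (auto split: option.splits intro!: sum.neutral)
  qed
  finally show ?thesis .
qed

lemma mlin_deriv: "j \<in> I \<Longrightarrow> mlin w (mon t 1 * mpoly_deriv j (wpoly I)) = rel w t j"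
  by (auto simp: mlin_single_mult mpoly_deriv_wpoly mlin_add rel_def mult_ac split: option.splits)

lemma deriv_closed:
  assumes j: "j \<in> I" shows "mpoly_deriv j (wpoly I) \<in> carrier (mpoly_ring I)"
proof -
  have jV: "j \<in> V" by (rule I_V[OF j])
  have 1: "kys (row j - mon j 1) \<subseteq> I"
    unfolding subset_iff in_keys_iff lookup_row_self[OF jV] using j I_closed by auto
  have 2: "kys (row p - mon j 1) \<subseteq> I" if "pv j = Some p" "p \<in> I" for p
    unfolding subset_iff in_keys_iff lookup_row_pv[OF jV that(1)] using that by auto
  show ?thesis unfolding mpoly_deriv_wpoly[OF j]
    using 1 2 by (auto simp del: One_nat_def split: option.splits
       intro!: mpoly_ring_add_closed mpoly_ring_single_closed mpoly_ring_zero_closed)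
qed

abbreviation Jac :: "'v mpoly set" where "Jac \<equiv> jacobian_ideal I (wpoly V)"

lemma Jac_ideal: "ideal Jac (mpoly_ring I)"
  by (rule ideal_jacobian_ideal) (simp add: restrict_wpoly deriv_closed)

lemma Jac_deriv: "j \<in> I \<Longrightarrow> mpoly_deriv j (wpoly I) \<in> Jac"
proof -
  interpret cring "mpoly_ring I" by (rule cring_mpoly_ring)
  assume "j \<in> I"
  have "(\<lambda>i. mpoly_deriv i (restrict_poly I (wpoly V))) ` I \<subseteq> Jac"
    unfolding jacobian_ideal_def
    by (rule genideal_self) (auto simp: restrict_wpoly deriv_closed)
  then show ?thesis using \<open>j \<in> I\<close> by (auto simp: restrict_wpoly)
qed

lemma Jac_add: "f \<in> Jac \<Longrightarrow> g \<in> Jac \<Longrightarrow> f + g \<in> Jac"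
  using additive_subgroup.a_closed[OF ideal.axioms(1)[OF Jac_ideal]] by simp

lemma Jac_mult: "f \<in> Jac \<Longrightarrow> g \<in> carrier (mpoly_ring I) \<Longrightarrow> g * f \<in> Jac"
  using ideal.I_l_closed[OF Jac_ideal] by simp

lemma Jac_carrier: "Jac \<subseteq> carrier (mpoly_ring I)"
  using additive_subgroup.a_subset[OF ideal.axioms(1)[OF Jac_ideal]] .

lemma Jac_zero: "0 \<in> Jac"
  using additive_subgroup.zero_closed[OF ideal.axioms(1)[OF Jac_ideal]] by simp

text \<open>\<open>phi_rel\<close> covers monomial multiples of the generators. The polynomials all
  of whose monomial multiples are killed by \<open>phi e\<close> form an ideal, which therefore
  contains the Jacobian ideal.\<close>

lemma Jac_phi:
  assumes f: "f \<in> Jac" and e: "e \<in> E" shows "mlin (phi e) f = 0"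
proof -
  interpret cring "mpoly_ring I" by (rule cring_mpoly_ring)
  define N where "N = {f \<in> carrier (mpoly_ring I).
    \<forall>t. kys t \<subseteq> I \<longrightarrow> mlin (phi e) (mon t 1 * f) = 0}"
  have mult: "x * f \<in> N" if f: "f \<in> N" and x: "x \<in> carrier (mpoly_ring I)" for x f
  proof -
    have "mlin (phi e) (mon t 1 * (x * f)) = 0" if t: "kys t \<subseteq> I" for t
    proof (induction x rule: poly_mapping_term_induct)
      case (single m d)
      then have "kys (t + m) \<subseteq> I" using x t by (auto simp: carrier_mpoly_ring keys_exponent_add)
      then have "mlin (phi e) (mon (t + m) 1 * f) = 0" using f by (simp add: N_def)
      then have "mlin (phi e) (mon (t + m) d * f) = 0" by (simp add: mlin_single_mult)
      then show ?case by (simp add: mult.assoc[symmetric] mult_single)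
    qed (auto simp: algebra_simps mlin_add)
    then show ?thesis using f x by (simp add: N_def mpoly_ring_mult_closed)
  qed
  have "ideal N (mpoly_ring I)"
  proof (rule idealI[OF ring_axioms])
    show "subgroup N (add_monoid (mpoly_ring I))"
    proof (rule subgroup.intro)
      show "inv\<^bsub>add_monoid (mpoly_ring I)\<^esub> x \<in> N" if "x \<in> N" for x
      proof -
        have "inv\<^bsub>add_monoid (mpoly_ring I)\<^esub> x = - x"
          using a_inv_mpoly_ring[of x I] that unfolding a_inv_def by (simp add: N_def)
        moreover have "- x \<in> N"
          using that by (simp add: N_def mpoly_ring_uminus_closed mlin_uminus)
        ultimately show ?thesis by simp
      qed
    qed (auto simp: N_def mpoly_ring_add_closed mpoly_ring_zero_closed algebra_simps mlin_add)
  next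
    fix f x assume "f \<in> N" "x \<in> carrier (mpoly_ring I)"
    then have "x * f \<in> N" by (rule mult)
    then show "x \<otimes>\<^bsub>mpoly_ring I\<^esub> f \<in> N" "f \<otimes>\<^bsub>mpoly_ring I\<^esub> x \<in> N"
      by (auto simp: mult.commute)
  qed
  moreover have "(\<lambda>i. mpoly_deriv i (restrict_poly I (wpoly V))) ` I \<subseteq> N"
    by (auto simp: restrict_wpoly N_def deriv_closed mlin_deriv phi_rel[OF e])
  ultimately have "Jac \<subseteq> N" unfolding jacobian_ideal_def by (rule genideal_minimal)
  then have "f \<in> N" using f by blast
  then have "kys t \<subseteq> I \<Longrightarrow> mlin (phi e) (mon t 1 * f) = 0" for t :: "'v exponent"
    by (simp add: N_def)
  from this[of 0] show ?thesis by simp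
qed

lemma phi_basis:
  assumes e: "e \<in> E"
  shows "mlin (phi e) (\<Sum>e'\<in>E. mon (mone e') (b e')) = b e"
proof -
  have "mlin (phi e) (\<Sum>e'\<in>E. mon (mone e') (b e')) = (\<Sum>e'\<in>E. if e' = e then b e' else 0)"
    unfolding mlin_sum by (rule sum.cong) (auto simp: phi_mone[OF e])
  then show ?thesis using e finite_E by simp
qed

text \<open>If some monomial were not congruent to a combination of basis monomials, a separating
  functional would vanish on the ideal and on the basis but not on that monomial, against
  \<open>w_zero\<close>.\<close>

lemma spanning:
  assumes f: "f \<in> carrier (mpoly_ring I)"
  obtains b where "f - (\<Sum>e\<in>E. mon (mone e) (b e)) \<in> Jac"
proof -
  define S where "S = {f \<in> carrier (mpoly_ring I). \<exists>b. f - (\<Sum>e\<in>E. mon (mone e) (b e)) \<in> Jac}"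
  have bas: "(\<Sum>e\<in>E. mon (mone e) (b e)) \<in> carrier (mpoly_ring I)" for b
    by (intro mpoly_ring_sum_closed mpoly_ring_single_closed keys_mone)
  have JS: "f \<in> S" if "f \<in> Jac" for f
    unfolding S_def using that Jac_carrier by (auto intro!: exI[of _ "\<lambda>_. 0"])
  have add: "f + g \<in> S" if "f \<in> S" "g \<in> S" for f g
  proof -
    obtain b d where "f - (\<Sum>e\<in>E. mon (mone e) (b e)) \<in> Jac" "g - (\<Sum>e\<in>E. mon (mone e) (d e)) \<in> Jac"
      using \<open>f \<in> S\<close> \<open>g \<in> S\<close> by (auto simp: S_def)
    from Jac_add[OF this] have "f + g - (\<Sum>e\<in>E. mon (mone e) (b e + d e)) \<in> Jac"
      by (simp add: single_add sum.distrib algebra_simps)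
    then show ?thesis using that by (auto simp: S_def mpoly_ring_add_closed)
  qed
  have scale: "mon 0 d * f \<in> S" if "f \<in> S" for d f
  proof -
    obtain b where b: "f - (\<Sum>e\<in>E. mon (mone e) (b e)) \<in> Jac" using \<open>f \<in> S\<close> by (auto simp: S_def)
    have "mon 0 d \<in> carrier (mpoly_ring I)" by (rule mpoly_ring_single_closed) simp
    from Jac_mult[OF b this] have "mon 0 d * f - (\<Sum>e\<in>E. mon (mone e) (d * b e)) \<in> Jac"
      by (simp add: right_diff_distrib sum_distrib_left mult_single)
    moreover have "mon 0 d * f \<in> carrier (mpoly_ring I)"
      using that by (intro mpoly_ring_mult_closed mpoly_ring_single_closed) (auto simp: S_def)
    ultimately show ?thesis by (auto simp: S_def)
  qed
  have scale': "Poly_Mapping.map ((*) d) f \<in> S" if "f \<in> S" for d f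
  proof -
    have "Poly_Mapping.map ((*) d) f = mon 0 d * f" by (rule mult_map_scale_conv_mult)
    then show ?thesis using scale[OF that] by simp
  qed
  have monS: "mon m 1 \<in> S" if m: "kys m \<subseteq> I" for m
  proof (rule ccontr)
    assume "mon m 1 \<notin> S"
    then obtain w where w: "\<And>g. g \<in> S \<Longrightarrow> mlin w g = 0" "mlin w (mon m 1) \<noteq> 0"
      using separating_functional[OF JS[OF Jac_zero] add scale'] by blast
    have "w m = 0"
    proof (rule w_zero[OF _ _ m])
      fix t :: "'v exponent" and j assume t: "kys t \<subseteq> I" and j: "j \<in> I"
      have "mon t 1 * mpoly_deriv j (wpoly I) \<in> Jac"
        by (rule Jac_mult[OF Jac_deriv[OF j] mpoly_ring_single_closed[OF t]])
      then show "rel w t j = 0" using w(1) JS mlin_deriv[OF j] by metis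
    next
      fix e assume e: "e \<in> E"
      have "(\<Sum>e'\<in>E. mon (mone e') (if e' = e then 1 else 0)) = mon (mone e) (1::complex)"
      proof -
        have "(\<Sum>e'\<in>E. mon (mone e') (if e' = e then 1 else (0::complex))) =
          (\<Sum>e'\<in>E. if e' = e then mon (mone e') 1 else 0)"
          by (rule sum.cong) auto
        then show ?thesis using e finite_E by simp
      qed
      then have "mon (mone e) 1 - (\<Sum>e'\<in>E. mon (mone e') (if e' = e then 1 else 0)) \<in> Jac"
        using Jac_zero by simp
      then have "\<exists>b. mon (mone e) 1 - (\<Sum>e'\<in>E. mon (mone e') (b e')) \<in> Jac"
        by (intro exI[of _ "\<lambda>e'. if e' = e then 1 else 0"])
      then have "mon (mone e) 1 \<in> S"
        using mpoly_ring_single_closed[OF keys_mone] by (simp add: S_def)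
      then show "w (mone e) = 0" using w(1) by fastforce
    qed
    then show False using w(2) by simp
  qed
  have "f \<in> S"
  proof -
    have eq: "f = (\<Sum>m\<in>kys f. mon 0 (lkp f m) * mon m 1)"
      by (subst poly_mapping_sum_terms[of f]) (simp add: mult_single)
    have "(\<Sum>m\<in>T. mon 0 (lkp f m) * mon m 1) \<in> S" if "T \<subseteq> kys f" for T
      using finite_subset[OF that finite_keys] that
    proof (induction T rule: finite_induct)
      case empty show ?case using JS[OF Jac_zero] by simp
    next
      case (insert m T)
      then have "kys m \<subseteq> I" using f by (auto simp: carrier_mpoly_ring)
      then show ?case using insert add scale monS by simp
    qed
    from this[of "kys f"] show ?thesis by (simp only: eq[symmetric] order_refl)
  qed
  then show ?thesis using that by (auto simp: S_def)
qed

text \<open>Modulo the ideal a polynomial is a combination of basis monomials, and by duality its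
  coefficients are the values of the functionals \<open>phi e\<close>.\<close>

theorem Jac_eq: "Jac = {f \<in> carrier (mpoly_ring I). \<forall>e\<in>E. mlin (phi e) f = 0}"
proof (intro equalityI subsetI CollectI conjI ballI)
  fix f assume f: "f \<in> {f \<in> carrier (mpoly_ring I). \<forall>e\<in>E. mlin (phi e) f = 0}"
  then have "f \<in> carrier (mpoly_ring I)" by simp
  then obtain b where b: "f - (\<Sum>e\<in>E. mon (mone e) (b e)) \<in> Jac" by (rule spanning)
  have "b e = 0" if e: "e \<in> E" for e
  proof -
    have "0 = mlin (phi e) (f - (\<Sum>e\<in>E. mon (mone e) (b e)))" using Jac_phi[OF b e] by simp
    also have "\<dots> = - b e" using f e by (simp add: mlin_diff phi_basis[OF e])
    finally show ?thesis by simp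
  qed
  then show "f \<in> Jac" using b by simp
qed (use Jac_carrier Jac_phi in auto)

text \<open>All monomials on which \<open>phi e\<close> is nonzero carry the same character of
  \<open>h\<close>, because their weights differ by integers.\<close>

lemma phi_form_action:
  assumes e: "e \<in> E" and h: "\<And>i. i \<in> I \<Longrightarrow> symm_weights h i \<in> \<int>"
  shows "mlin (phi e) (form_action I h f) = cis (2 * pi * of_rat (\<Sum>i\<in>I. R e i * h i)) * mlin (phi e) f"
proof -
  have key: "form_char I h m * phi e m = cis (2 * pi * of_rat (\<Sum>i\<in>I. R e i * h i)) * phi e m" for m
  proof (cases "phi e m = 0")
    case False
    then obtain U where U: "U \<subseteq> I" "\<And>p. p \<in> U \<Longrightarrow> nx p \<noteq> None"
      "\<And>y. (\<Sum>i\<in>I. (of_nat (lkp m i) + 1) * y i) = (\<Sum>i\<in>I. R e i * y i) +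
       (\<Sum>p\<in>U. (of_nat (a p) * y p + ov y (nx p)) - (of_nat (a (the (nx p))) * y (the (nx p)) + ov y (nx (the (nx p)))))"
      using phi_nonzero_weight[OF e] by blast
    define k where "k = (\<Sum>p\<in>U. symm_weights h p - symm_weights h (the (nx p)))"
    have "k \<in> \<int>" unfolding k_def
    proof (rule Ints_sum)
      fix p assume p: "p \<in> U"
      then obtain j where "nx p = Some j" using U(2) by blast
      then show "symm_weights h p - symm_weights h (the (nx p)) \<in> \<int>"
        using h[of p] h[of j] I_closed[of p j] p U(1) by auto
    qed
    moreover have "(\<Sum>i\<in>I. (of_nat (lkp m i) + 1) * h i) = (\<Sum>i\<in>I. R e i * h i) + k"
      using U(3)[of h] by (simp add: k_def symm_weights_def)
    ultimately show ?thesis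
      unfolding form_char_def
      by (simp add: of_rat_add distrib_left cis_mult[symmetric] cis_two_pi_Ints)
  qed simp
  show ?thesis
    unfolding form_action_eq_mterm mlin_mterm id_apply key by (simp add: mlin_def sum_distrib_right algebra_simps)
qed

text \<open>The exponent matrix maps the weights to the all-ones vector, so adjointness turns the
  pairing of \<open>R e\<close> with the weights into the sum of the entries of
  \<open>e\<close>.\<close>

lemma phi_degree:
  assumes e: "e \<in> E" and nz: "phi e m \<noteq> 0" and q: "\<And>i. i \<in> I \<Longrightarrow> symm_weights q i = 1"
  shows "(\<Sum>i\<in>I. (of_nat (lkp m i) + 1) * q i) = (\<Sum>i\<in>I. e i)"
proof -
  obtain U where U: "U \<subseteq> I" "\<And>p. p \<in> U \<Longrightarrow> nx p \<noteq> None"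
      "\<And>y. (\<Sum>i\<in>I. (of_nat (lkp m i) + 1) * y i) = (\<Sum>i\<in>I. R e i * y i) +
       (\<Sum>p\<in>U. (of_nat (a p) * y p + ov y (nx p)) - (of_nat (a (the (nx p))) * y (the (nx p)) + ov y (nx (the (nx p)))))"
    using phi_nonzero_weight[OF e nz] by blast
  have "(\<Sum>p\<in>U. symm_weights q p - symm_weights q (the (nx p))) = 0"
  proof (rule sum.neutral, rule ballI)
    fix p assume p: "p \<in> U"
    then obtain j where "nx p = Some j" using U(2) by blast
    then show "symm_weights q p - symm_weights q (the (nx p)) = 0"
      using q[of p] q[of j] I_closed[of p j] p U(1) by auto
  qed
  then have "(\<Sum>i\<in>I. (of_nat (lkp m i) + 1) * q i) = (\<Sum>i\<in>I. R e i * q i)"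
    using U(3)[of q] by (simp add: symm_weights_def)
  also have "\<dots> = (\<Sum>i\<in>I. e i * symm_weights q i)"
    unfolding symm_weights_def
    by (rule sum_R_adjoint[OF I_sub I_closed]) (use E_supp[OF e] in \<open>auto simp: supp_in_def\<close>)
  also have "\<dots> = (\<Sum>i\<in>I. e i)" using q by simp
  finally show ?thesis .
qed

end

section \<open>Coordinates on state spaces\<close>

text \<open>What the comparison needs to know about the sectors of one state space: functionals that
  cut out the Jacobian ideal, monomials dual to them, and for each functional an eigenvalue
  \<open>ch\<close> of the group and a single bidegree. Both sides of the mirror are
  instances.\<close>

locale milnor_coords =
  fixes V :: "'v set" and W :: "'v mpoly" and H :: "('v \<Rightarrow> rat) set"
    and B :: "('v \<Rightarrow> rat) \<Rightarrow> 'e set" and ph :: "('v \<Rightarrow> rat) \<Rightarrow> 'e \<Rightarrow> 'v exponent \<Rightarrow> complex"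
    and mn :: "('v \<Rightarrow> rat) \<Rightarrow> 'e \<Rightarrow> 'v exponent"
    and ch :: "('v \<Rightarrow> rat) \<Rightarrow> 'e \<Rightarrow> ('v \<Rightarrow> rat) \<Rightarrow> complex"
    and bd :: "'v exponent \<Rightarrow> ('v \<Rightarrow> rat) \<Rightarrow> rat \<times> rat"
  assumes finite_H: "finite H"
    and finite_B: "g \<in> H \<Longrightarrow> finite (B g)"
    and ideal_J: "g \<in> H \<Longrightarrow> ideal (jacobian_ideal (fixed_vars V g) W) (mpoly_ring (fixed_vars V g))"
    and J_eq: "g \<in> H \<Longrightarrow> jacobian_ideal (fixed_vars V g) W =
      {f \<in> carrier (mpoly_ring (fixed_vars V g)). \<forall>e\<in>B g. mlin (ph g e) f = 0}"
    and keys_mn: "g \<in> H \<Longrightarrow> e \<in> B g \<Longrightarrow> kys (mn g e) \<subseteq> fixed_vars V g"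
    and dual: "g \<in> H \<Longrightarrow> e \<in> B g \<Longrightarrow> e' \<in> B g \<Longrightarrow> ph g e (mn g e') = (if e = e' then 1 else 0)"
    and act: "g \<in> H \<Longrightarrow> e \<in> B g \<Longrightarrow> h \<in> H \<Longrightarrow>
      mlin (ph g e) (form_action (fixed_vars V g) h f) = ch g e h * mlin (ph g e) f"
    and ch_nz: "g \<in> H \<Longrightarrow> e \<in> B g \<Longrightarrow> h \<in> H \<Longrightarrow> ch g e h \<noteq> 0"
    and bd_eq: "g \<in> H \<Longrightarrow> e \<in> B g \<Longrightarrow> ph g e m \<noteq> 0 \<Longrightarrow> bd m g = bd (mn g e) g"
begin

abbreviation "fx g \<equiv> fixed_vars V g"
abbreviation "Rg g \<equiv> mpoly_ring (fixed_vars V g)"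
abbreviation "Qg g \<equiv> milnor_ring (fixed_vars V g) W"
abbreviation "cl g \<equiv> milnor_class (fixed_vars V g) W"
abbreviation "M \<equiv> state_space V W H"

lemma cl_eq:
  assumes g: "g \<in> H" and f: "f \<in> carrier (Rg g)"
  shows "cl g f = {f' \<in> carrier (Rg g). \<forall>e\<in>B g. mlin (ph g e) f' = mlin (ph g e) f}"
proof (intro equalityI subsetI)
  fix f' assume "f' \<in> cl g f"
  then obtain j where j: "j \<in> jacobian_ideal (fx g) W" "f' = j + f"
    by (auto simp: milnor_class_def a_r_coset_def r_coset_def)
  then show "f' \<in> {f' \<in> carrier (Rg g). \<forall>e\<in>B g. mlin (ph g e) f' = mlin (ph g e) f}"
    using f by (auto simp: J_eq[OF g] mlin_add mpoly_ring_add_closed)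
next
  fix f' assume f': "f' \<in> {f' \<in> carrier (Rg g). \<forall>e\<in>B g. mlin (ph g e) f' = mlin (ph g e) f}"
  then have "f' - f \<in> jacobian_ideal (fx g) W"
    using f by (auto simp: J_eq[OF g] mlin_diff mpoly_ring_diff_closed)
  moreover have "f' = (f' - f) + f" by simp
  ultimately show "f' \<in> cl g f"
    unfolding milnor_class_def a_r_coset_def r_coset_def by force
qed

lemma cl_self: "g \<in> H \<Longrightarrow> f \<in> carrier (Rg g) \<Longrightarrow> f \<in> cl g f"
  by (simp add: cl_eq)

lemma cl_eq_iff:
  assumes "g \<in> H" "f \<in> carrier (Rg g)" "f' \<in> carrier (Rg g)"
  shows "cl g f = cl g f' \<longleftrightarrow> (\<forall>e\<in>B g. mlin (ph g e) f = mlin (ph g e) f')"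
  using assms cl_self[OF assms(1,2)] by (auto simp: cl_eq)

lemma carrier_Qg: "carrier (Qg g) = cl g ` carrier (Rg g)"
  by (auto simp: milnor_ring_def milnor_class_def FactRing_def A_RCOSETS_def RCOSETS_def a_r_coset_def)

lemma cl_add: "g \<in> H \<Longrightarrow> f \<in> carrier (Rg g) \<Longrightarrow> f' \<in> carrier (Rg g) \<Longrightarrow> cl g f \<oplus>\<^bsub>Qg g\<^esub> cl g f' = cl g (f + f')"
  using ring_hom_add[OF ideal.rcos_ring_hom[OF ideal_J], of g f f']
  by (simp add: milnor_ring_def milnor_class_def)

lemma cl_mult: "g \<in> H \<Longrightarrow> f \<in> carrier (Rg g) \<Longrightarrow> f' \<in> carrier (Rg g) \<Longrightarrow> cl g f \<otimes>\<^bsub>Qg g\<^esub> cl g f' = cl g (f * f')"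
  using ring_hom_mult[OF ideal.rcos_ring_hom[OF ideal_J], of g f f']
  by (simp add: milnor_ring_def milnor_class_def)

lemma zero_Qg: "g \<in> H \<Longrightarrow> \<zero>\<^bsub>Qg g\<^esub> = cl g 0"
  by (simp add: cl_eq mpoly_ring_zero_closed milnor_ring_def FactRing_def J_eq)

text \<open>The choice of a representative is harmless because the functionals are constant on
  classes.\<close>

definition crd :: "('v \<Rightarrow> rat) \<Rightarrow> 'v mpoly set \<Rightarrow> 'e \<Rightarrow> complex" where
  "crd g C e = mlin (ph g e) (SOME f. f \<in> C)"

lemma crd_cl:
  assumes "g \<in> H" "f \<in> carrier (Rg g)" "e \<in> B g" shows "crd g (cl g f) e = mlin (ph g e) f"
proof -
  have "(SOME f'. f' \<in> cl g f) \<in> cl g f" by (rule someI) (rule cl_self[OF assms(1,2)])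
  then show ?thesis using assms by (simp add: crd_def cl_eq)
qed

lemma form_action_closed: "f \<in> carrier (mpoly_ring I) \<Longrightarrow> form_action I h f \<in> carrier (mpoly_ring I)"
  by (simp add: form_action_eq_mterm mterm_id_closed)

lemma form_action_inverse: "form_action I h (form_action I (\<lambda>i. - h i) f) = f"
  unfolding form_action_eq_mterm mterm_comp
  by (rule mterm_id) (simp add: form_char_def cis_mult of_rat_minus sum_negf)

text \<open>The action of \<open>h\<close> is invertible and scales the coordinate \<open>e\<close>
  by \<open>ch g e h\<close>, so it maps classes onto classes. An invariant class has zero
  coordinates wherever the character is nontrivial.\<close>

lemma cl_in_sector_iff:
  assumes g: "g \<in> H" and f: "f \<in> carrier (Rg g)"
  shows "cl g f \<in> sector V W H g \<longleftrightarrow> (\<forall>h\<in>H. \<forall>e\<in>B g. ch g e h = 1 \<or> mlin (ph g e) f = 0)"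
proof -
  have img: "form_action (fx g) h ` cl g f = cl g (form_action (fx g) h f)" if h: "h \<in> H" for h
  proof (intro equalityI subsetI)
    fix y assume "y \<in> form_action (fx g) h ` cl g f"
    then show "y \<in> cl g (form_action (fx g) h f)"
      using f by (auto simp: cl_eq[OF g] form_action_closed act[OF g _ h])
  next
    fix y assume y: "y \<in> cl g (form_action (fx g) h f)"
    let ?x = "form_action (fx g) (\<lambda>i. - h i) y"
    have yc: "y \<in> carrier (Rg g)" using y f by (simp add: cl_eq[OF g] form_action_closed)
    have "mlin (ph g e) ?x = mlin (ph g e) f" if e: "e \<in> B g" for e
    proof -
      have "ch g e h * mlin (ph g e) ?x = mlin (ph g e) y"
        using act[OF g e h, of ?x] by (simp add: form_action_inverse)
      also have "\<dots> = ch g e h * mlin (ph g e) f"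
        using y e f by (simp add: cl_eq[OF g] form_action_closed act[OF g e h])
      finally show ?thesis using ch_nz[OF g e h] by simp
    qed
    then have "?x \<in> cl g f" using f yc by (simp add: cl_eq[OF g] form_action_closed)
    then show "y \<in> form_action (fx g) h ` cl g f"
      by (rule rev_image_eqI) (simp add: form_action_inverse)
  qed
  have "cl g f \<in> sector V W H g \<longleftrightarrow> (\<forall>h\<in>H. cl g (form_action (fx g) h f) = cl g f)"
    using f by (auto simp: sector_def carrier_Qg img)
  also have "\<dots> \<longleftrightarrow> (\<forall>h\<in>H. \<forall>e\<in>B g. ch g e h * mlin (ph g e) f = mlin (ph g e) f)"
    using f by (auto simp: cl_eq_iff[OF g] form_action_closed act[OF g])
  finally show ?thesis by auto
qed

definition P :: "(('v \<Rightarrow> rat) \<times> 'e) set" where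
  "P = {(g, e). g \<in> H \<and> e \<in> B g \<and> (\<forall>h\<in>H. ch g e h = 1)}"

text \<open>The extension by 0 identifies the state space with the functions that vanish outside
  \<open>P\<close>; the inverse map is \<open>Y\<close>.\<close>

definition X :: "(('v \<Rightarrow> rat) \<Rightarrow> 'v mpoly set) \<Rightarrow> ('v \<Rightarrow> rat) \<times> 'e \<Rightarrow> complex" where
  "X s p = (if p \<in> P then crd (fst p) (s (fst p)) (snd p) else 0)"

definition poly_of :: "(('v \<Rightarrow> rat) \<times> 'e \<Rightarrow> complex) \<Rightarrow> ('v \<Rightarrow> rat) \<Rightarrow> 'v mpoly" where
  "poly_of x g = (\<Sum>e\<in>B g. mon (mn g e) (x (g, e)))"

definition Y :: "(('v \<Rightarrow> rat) \<times> 'e \<Rightarrow> complex) \<Rightarrow> ('v \<Rightarrow> rat) \<Rightarrow> 'v mpoly set" where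
  "Y x = (\<lambda>g\<in>H. cl g (poly_of x g))"

lemma carrier_M: "carrier M = (\<Pi>\<^sub>E g\<in>H. sector V W H g)"
  using finite_H by (simp add: state_space_def)

lemma M_rep:
  assumes s: "s \<in> carrier M" and g: "g \<in> H"
  obtains f where "f \<in> carrier (Rg g)" "s g = cl g f"
    "\<And>h e. h \<in> H \<Longrightarrow> e \<in> B g \<Longrightarrow> ch g e h = 1 \<or> mlin (ph g e) f = 0"
proof -
  have sg: "s g \<in> sector V W H g" using s g by (auto simp: carrier_M)
  then obtain f where "f \<in> carrier (Rg g)" "s g = cl g f" by (auto simp: sector_def carrier_Qg)
  then show ?thesis using that sg cl_in_sector_iff[OF g] by metis
qed

lemma poly_of_closed: "g \<in> H \<Longrightarrow> poly_of x g \<in> carrier (Rg g)"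
  unfolding poly_of_def by (intro mpoly_ring_sum_closed mpoly_ring_single_closed keys_mn)

lemma mlin_poly_of: 
  assumes g: "g \<in> H" and e: "e \<in> B g" shows "mlin (ph g e) (poly_of x g) = x (g, e)"
proof -
  have "mlin (ph g e) (poly_of x g) = (\<Sum>e'\<in>B g. if e' = e then x (g, e') else 0)"
    unfolding poly_of_def mlin_sum by (rule sum.cong) (auto simp: dual[OF g e])
  then show ?thesis using e finite_B[OF g] by simp
qed

lemma Y_closed:
  assumes "\<And>p. p \<notin> P \<Longrightarrow> x p = 0" shows "Y x \<in> carrier M"
proof -
  have "cl g (poly_of x g) \<in> sector V W H g" if g: "g \<in> H" for g
    unfolding cl_in_sector_iff[OF g poly_of_closed[OF g]]
    using assms[of "(g, _)"] g by (auto simp: mlin_poly_of[OF g] P_def)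
  then show ?thesis by (auto simp: carrier_M Y_def)
qed

lemma X_Y: 
  assumes "\<And>p. p \<notin> P \<Longrightarrow> x p = 0" shows "X (Y x) = x"
proof
  fix p show "X (Y x) p = x p"
  proof (cases "p \<in> P")
    case True
    then show ?thesis
      by (cases p) (auto simp: X_def Y_def P_def crd_cl poly_of_closed mlin_poly_of)
  qed (use assms in \<open>simp add: X_def\<close>)
qed

lemma X_outside: "p \<notin> P \<Longrightarrow> X s p = 0"
  by (simp add: X_def)

text \<open>Outside \<open>P\<close> both sides are 0: some character is nontrivial there, so
  invariance kills the value of the functional.\<close>

lemma X_rep:
  assumes "s \<in> carrier M" "g \<in> H" "f \<in> carrier (Rg g)" "s g = cl g f" "e \<in> B g"
  shows "X s (g, e) = mlin (ph g e) f"
proof (cases "(g, e) \<in> P")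
  case True
  then show ?thesis using assms by (simp add: X_def crd_cl)
next
  case False
  then obtain h where "h \<in> H" "ch g e h \<noteq> 1" using assms by (auto simp: P_def)
  moreover have "cl g f \<in> sector V W H g" using assms(1,2,4) unfolding carrier_M by (metis PiE_mem)
  ultimately show ?thesis using False assms cl_in_sector_iff[OF assms(2,3)] by (auto simp: X_outside)
qed

lemma X_inj:
  assumes s: "s \<in> carrier M" and t: "t \<in> carrier M" and eq: "X s = X t"
  shows "s = t"
proof
  fix g show "s g = t g"
  proof (cases "g \<in> H")
    case True
    obtain f where f: "f \<in> carrier (Rg g)" "s g = cl g f" using M_rep[OF s True] by metis
    obtain f' where f': "f' \<in> carrier (Rg g)" "t g = cl g f'" using M_rep[OF t True] by metis
    have "mlin (ph g e) f = mlin (ph g e) f'" if "e \<in> B g" for e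
      using X_rep[OF s True f that] X_rep[OF t True f' that] eq by simp
    then show ?thesis using f f' cl_eq_iff[OF True] by metis
  next
    case False
    then show ?thesis using s t by (auto simp: carrier_M PiE_def extensional_def)
  qed
qed

lemma Y_X: 
  assumes "s \<in> carrier M" shows "Y (X s) = s"
  by (rule X_inj[OF Y_closed assms]) (auto simp: X_outside X_Y)

lemma M_add_rep:
  assumes "s \<in> carrier M" "t \<in> carrier M" "g \<in> H" "f \<in> carrier (Rg g)" "s g = cl g f"
    "f' \<in> carrier (Rg g)" "t g = cl g f'"
  shows "(s \<oplus>\<^bsub>M\<^esub> t) g = cl g (f + f')"
  using assms by (simp add: state_space_def Let_def cl_add)

lemma add_eq_Y: 
  assumes s: "s \<in> carrier M" and t: "t \<in> carrier M"
  shows "s \<oplus>\<^bsub>M\<^esub> t = Y (\<lambda>p. X s p + X t p)"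
proof
  fix g show "(s \<oplus>\<^bsub>M\<^esub> t) g = Y (\<lambda>p. X s p + X t p) g"
  proof (cases "g \<in> H")
    case True
    obtain f where f: "f \<in> carrier (Rg g)" "s g = cl g f" using M_rep[OF s True] by metis
    obtain f' where f': "f' \<in> carrier (Rg g)" "t g = cl g f'" using M_rep[OF t True] by metis
    have "cl g (f + f') = cl g (poly_of (\<lambda>p. X s p + X t p) g)"
      unfolding cl_eq_iff[OF True mpoly_ring_add_closed[OF f(1) f'(1)] poly_of_closed[OF True]]
      using X_rep[OF s True f] X_rep[OF t True f'] by (simp add: mlin_add mlin_poly_of[OF True])
    then show ?thesis using M_add_rep[OF s t True f f'] True by (simp add: Y_def)
  qed (simp add: state_space_def Let_def Y_def)
qed

lemma smult_eq_Y: 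
  assumes s: "s \<in> carrier M"
  shows "r \<odot>\<^bsub>M\<^esub> s = Y (\<lambda>p. r * X s p)"
proof
  fix g show "(r \<odot>\<^bsub>M\<^esub> s) g = Y (\<lambda>p. r * X s p) g"
  proof (cases "g \<in> H")
    case True
    obtain f where f: "f \<in> carrier (Rg g)" "s g = cl g f" using M_rep[OF s True] by metis
    have r: "mon 0 r \<in> carrier (Rg g)" by (rule mpoly_ring_single_closed) simp
    have "cl g (mon 0 r * f) = cl g (poly_of (\<lambda>p. r * X s p) g)"
      unfolding cl_eq_iff[OF True mpoly_ring_mult_closed[OF r f(1)] poly_of_closed[OF True]]
      using X_rep[OF s True f] by (simp add: mlin_single_mult mlin_poly_of[OF True])
    then show ?thesis using True f r by (simp add: state_space_def Let_def Y_def cl_mult)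
  qed (simp add: state_space_def Let_def Y_def)
qed

lemma zero_eq_Y: "\<zero>\<^bsub>M\<^esub> = Y (\<lambda>_. 0)"
proof
  fix g show "\<zero>\<^bsub>M\<^esub> g = Y (\<lambda>_. 0) g"
    by (cases "g \<in> H") (simp_all add: state_space_def Let_def Y_def zero_Qg poly_of_def)
qed

lemma add_closed: "s \<in> carrier M \<Longrightarrow> t \<in> carrier M \<Longrightarrow> s \<oplus>\<^bsub>M\<^esub> t \<in> carrier M"
  by (simp add: add_eq_Y Y_closed X_outside)

lemma smult_closed: "s \<in> carrier M \<Longrightarrow> r \<odot>\<^bsub>M\<^esub> s \<in> carrier M"
  by (simp add: smult_eq_Y Y_closed X_outside)

lemma zero_closed: "\<zero>\<^bsub>M\<^esub> \<in> carrier M"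
  by (simp add: zero_eq_Y Y_closed)

lemma X_add: "s \<in> carrier M \<Longrightarrow> t \<in> carrier M \<Longrightarrow> X (s \<oplus>\<^bsub>M\<^esub> t) = (\<lambda>p. X s p + X t p)"
  by (simp add: add_eq_Y X_Y X_outside)

lemma X_smult: "s \<in> carrier M \<Longrightarrow> X (r \<odot>\<^bsub>M\<^esub> s) = (\<lambda>p. r * X s p)"
  by (simp add: smult_eq_Y X_Y X_outside)

lemma X_zero: "X (\<zero>\<^bsub>M\<^esub>) = (\<lambda>_. 0)"
  by (simp add: zero_eq_Y X_Y)

text \<open>Each axiom is checked in coordinates, since \<open>X\<close> is injective and respects
  the operations.\<close>

lemma vectorspace_M: "vectorspace (class_ring :: complex ring) M"
proof -
  note cl = add_closed smult_closed zero_closed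
  note Xs = X_add X_smult X_zero
  have "abelian_group M"
  proof (rule abelian_groupI)
    fix x assume x: "x \<in> carrier M"
    show "\<exists>y\<in>carrier M. y \<oplus>\<^bsub>M\<^esub> x = \<zero>\<^bsub>M\<^esub>"
    proof
      show "(-1) \<odot>\<^bsub>M\<^esub> x \<in> carrier M" by (rule smult_closed[OF x])
      show "(-1) \<odot>\<^bsub>M\<^esub> x \<oplus>\<^bsub>M\<^esub> x = \<zero>\<^bsub>M\<^esub>"
        by (rule X_inj) (simp_all add: cl Xs x)
    qed
    show "\<zero>\<^bsub>M\<^esub> \<oplus>\<^bsub>M\<^esub> x = x" by (rule X_inj) (simp_all add: cl Xs x)
    fix y assume y: "y \<in> carrier M"
    show "x \<oplus>\<^bsub>M\<^esub> y \<in> carrier M" by (rule add_closed[OF x y])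
    show "x \<oplus>\<^bsub>M\<^esub> y = y \<oplus>\<^bsub>M\<^esub> x" by (rule X_inj) (simp_all add: cl Xs x y add.commute)
    fix z assume z: "z \<in> carrier M"
    show "x \<oplus>\<^bsub>M\<^esub> y \<oplus>\<^bsub>M\<^esub> z = x \<oplus>\<^bsub>M\<^esub> (y \<oplus>\<^bsub>M\<^esub> z)"
      by (rule X_inj) (simp_all add: cl Xs x y z add.assoc)
  qed (rule zero_closed)
  then have "module (class_ring :: complex ring) M"
  proof (intro moduleI)
    show "cring (class_ring :: complex ring)" by (rule class_cring.cring_axioms)
    fix a b :: complex and x y assume x: "x \<in> carrier M"
    show "a \<odot>\<^bsub>M\<^esub> x \<in> carrier M" by (rule smult_closed[OF x])
    show "(a \<oplus>\<^bsub>class_ring\<^esub> b) \<odot>\<^bsub>M\<^esub> x = a \<odot>\<^bsub>M\<^esub> x \<oplus>\<^bsub>M\<^esub> b \<odot>\<^bsub>M\<^esub> x"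
      by (rule X_inj) (simp_all add: cl Xs x distrib_right)
    show "(a \<otimes>\<^bsub>class_ring\<^esub> b) \<odot>\<^bsub>M\<^esub> x = a \<odot>\<^bsub>M\<^esub> (b \<odot>\<^bsub>M\<^esub> x)"
      by (rule X_inj) (simp_all add: cl Xs x mult.assoc)
    show "\<one>\<^bsub>class_ring\<^esub> \<odot>\<^bsub>M\<^esub> x = x"
      by (rule X_inj) (simp_all add: cl Xs x)
    assume y: "y \<in> carrier M"
    show "a \<odot>\<^bsub>M\<^esub> (x \<oplus>\<^bsub>M\<^esub> y) = a \<odot>\<^bsub>M\<^esub> x \<oplus>\<^bsub>M\<^esub> a \<odot>\<^bsub>M\<^esub> y"
      by (rule X_inj) (simp_all add: cl Xs x y distrib_left)
  qed
  then show ?thesis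
    by (intro vectorspace.intro class_field)
qed

text \<open>A homogeneous representative has no coordinates in other bidegrees, because
  \<open>ph g e\<close> sees only monomials of the bidegree of \<open>mn g e\<close>. Conversely the
  combination of basis monomials given by the coordinates is a homogeneous representative.\<close>

lemma homogeneous_iff:
  assumes s: "s \<in> carrier M"
  shows "s \<in> homogeneous_part V W H bd d \<longleftrightarrow> (\<forall>(g, e)\<in>P. X s (g, e) \<noteq> 0 \<longrightarrow> bd (mn g e) g = d)"
proof
  assume hom: "s \<in> homogeneous_part V W H bd d"
  show "\<forall>(g, e)\<in>P. X s (g, e) \<noteq> 0 \<longrightarrow> bd (mn g e) g = d"
  proof (clarify)
    fix g e assume p: "(g, e) \<in> P" and nz: "X s (g, e) \<noteq> 0"
    have g: "g \<in> H" and e: "e \<in> B g" using p by (auto simp: P_def)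
    obtain f where f: "f \<in> carrier (Rg g)" "s g = cl g f" "\<forall>m\<in>kys f. bd m g = d"
      using hom g by (auto simp: homogeneous_part_def)
    have "mlin (ph g e) f \<noteq> 0" using X_rep[OF s g f(1,2) e] nz by simp
    then obtain m where "m \<in> kys f" "ph g e m \<noteq> 0"
      unfolding mlin_def by (metis (no_types, lifting) mult_not_zero sum.not_neutral_contains_not_neutral)
    then show "bd (mn g e) g = d" using bd_eq[OF g e] f(3) by metis
  qed
next
  assume X: "\<forall>(g, e)\<in>P. X s (g, e) \<noteq> 0 \<longrightarrow> bd (mn g e) g = d"
  show "s \<in> homogeneous_part V W H bd d"
    unfolding homogeneous_part_def
  proof (intro CollectI conjI ballI)
    fix g assume g: "g \<in> H"
    have "s g = cl g (poly_of (X s) g)"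
      by (subst Y_X[OF s, symmetric]) (simp add: Y_def g)
    moreover have "bd m g = d" if "m \<in> kys (poly_of (X s) g)" for m
    proof -
      have "(\<Sum>e\<in>B g. lkp (mon (mn g e) (X s (g, e))) m) \<noteq> 0"
        using that by (simp add: poly_of_def in_keys_iff lookup_sum)
      then obtain e where e: "e \<in> B g" "lkp (mon (mn g e) (X s (g, e))) m \<noteq> 0"
        by (rule sum.not_neutral_contains_not_neutral)
      then have "m = mn g e" "X s (g, e) \<noteq> 0" by (auto simp: lookup_single when_def split: if_splits)
      moreover have "(g, e) \<in> P" using \<open>X s (g, e) \<noteq> 0\<close> X_outside by blast
      ultimately show "bd m g = d" using X by auto
    qed
    ultimately show "\<exists>f\<in>carrier (Rg g). s g = cl g f \<and> (\<forall>m\<in>kys f. bd m g = d)"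
      using poly_of_closed[OF g] by blast
  qed (rule s)
qed

end

text \<open>The map relabels the coordinates along \<open>\<beta>\<close>; it respects bidegrees
  because the labels do.\<close>

lemma state_space_isomorphism:
  fixes ph1 :: "('v \<Rightarrow> rat) \<Rightarrow> 'e \<Rightarrow> 'v exponent \<Rightarrow> complex"
    and ph2 :: "('v \<Rightarrow> rat) \<Rightarrow> 'f \<Rightarrow> 'v exponent \<Rightarrow> complex"
  assumes "milnor_coords V W1 H1 B1 ph1 mn1 ch1 bd1" and "milnor_coords V W2 H2 B2 ph2 mn2 ch2 bd2"
    and bij: "bij_betw \<beta> (milnor_coords.P H1 B1 ch1) (milnor_coords.P H2 B2 ch2)"
    and bd: "\<And>g e h c. (g, e) \<in> milnor_coords.P H1 B1 ch1 \<Longrightarrow> \<beta> (g, e) = (h, c) \<Longrightarrow>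
      bd1 (mn1 g e) g = bd2 (mn2 h c) h"
  shows "\<exists>\<Phi>. linear_map (class_ring :: complex ring) (state_space V W1 H1) (state_space V W2 H2) \<Phi> \<and>
    bij_betw \<Phi> (carrier (state_space V W1 H1)) (carrier (state_space V W2 H2)) \<and>
    (\<forall>d. \<Phi> ` homogeneous_part V W1 H1 bd1 d = homogeneous_part V W2 H2 bd2 d)"
proof -
  interpret A: milnor_coords V W1 H1 B1 ph1 mn1 ch1 bd1 by fact
  interpret B: milnor_coords V W2 H2 B2 ph2 mn2 ch2 bd2 by fact
  define \<gamma> where "\<gamma> = inv_into A.P \<beta>"
  have \<gamma>P: "\<gamma> p \<in> A.P" if "p \<in> B.P" for p
    unfolding \<gamma>_def using bij that by (metis bij_betw_def inv_into_into)
  have \<beta>P: "\<beta> p \<in> B.P" if "p \<in> A.P" for p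
    using bij that by (auto simp: bij_betw_def)
  have \<gamma>\<beta>: "\<gamma> (\<beta> p) = p" if "p \<in> A.P" for p
    unfolding \<gamma>_def using bij that by (metis bij_betw_inv_into_left)
  have \<beta>\<gamma>: "\<beta> (\<gamma> p) = p" if "p \<in> B.P" for p
    unfolding \<gamma>_def using bij that by (metis bij_betw_inv_into_right)
  define \<Phi> where "\<Phi> s = B.Y (\<lambda>p. if p \<in> B.P then A.X s (\<gamma> p) else 0)" for s
  define \<Psi> where "\<Psi> t = A.Y (\<lambda>p. if p \<in> A.P then B.X t (\<beta> p) else 0)" for t
  have \<Phi>c: "\<Phi> s \<in> carrier B.M" for s unfolding \<Phi>_def by (rule B.Y_closed) simp
  have \<Psi>c: "\<Psi> s \<in> carrier A.M" for s unfolding \<Psi>_def by (rule A.Y_closed) simp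
  have X\<Phi>: "B.X (\<Phi> s) = (\<lambda>p. if p \<in> B.P then A.X s (\<gamma> p) else 0)" for s
    unfolding \<Phi>_def by (rule B.X_Y) simp
  have X\<Psi>: "A.X (\<Psi> s) = (\<lambda>p. if p \<in> A.P then B.X s (\<beta> p) else 0)" for s
    unfolding \<Psi>_def by (rule A.X_Y) simp
  have \<Psi>\<Phi>: "\<Psi> (\<Phi> s) = s" if "s \<in> carrier A.M" for s
    by (rule A.X_inj[OF \<Psi>c that]) (auto simp: X\<Psi> X\<Phi> \<gamma>\<beta> \<beta>P A.X_outside)
  have \<Phi>\<Psi>: "\<Phi> (\<Psi> s) = s" if "s \<in> carrier B.M" for s
    by (rule B.X_inj[OF \<Phi>c that]) (auto simp: X\<Psi> X\<Phi> \<beta>\<gamma> \<gamma>P B.X_outside)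
  have bijM: "bij_betw \<Phi> (carrier A.M) (carrier B.M)"
    by (rule bij_betw_byWitness[where f' = \<Psi>]) (use \<Psi>\<Phi> \<Phi>\<Psi> \<Phi>c \<Psi>c in auto)
  have hom: "\<Phi> s \<in> homogeneous_part V W2 H2 bd2 d \<longleftrightarrow> s \<in> homogeneous_part V W1 H1 bd1 d"
    if s: "s \<in> carrier A.M" for s d
  proof -
    have "(\<forall>(h, c)\<in>B.P. B.X (\<Phi> s) (h, c) \<noteq> 0 \<longrightarrow> bd2 (mn2 h c) h = d) \<longleftrightarrow>
      (\<forall>(g, e)\<in>A.P. A.X s (g, e) \<noteq> 0 \<longrightarrow> bd1 (mn1 g e) g = d)" (is "?l = ?r")
    proof
      assume l: ?l
      show ?r
      proof clarify
        fix g e assume p: "(g, e) \<in> A.P" "A.X s (g, e) \<noteq> 0"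
        obtain h c where hc: "\<beta> (g, e) = (h, c)" by (cases "\<beta> (g, e)")
        have "(h, c) \<in> B.P" "\<gamma> (h, c) = (g, e)" using \<beta>P[OF p(1)] \<gamma>\<beta>[OF p(1)] hc by auto
        then have "bd2 (mn2 h c) h = d" using l p(2) by (auto simp: X\<Phi>)
        then show "bd1 (mn1 g e) g = d" using bd[OF p(1) hc] by simp
      qed
    next
      assume r: ?r
      show ?l
      proof clarify
        fix h c assume p: "(h, c) \<in> B.P" "B.X (\<Phi> s) (h, c) \<noteq> 0"
        obtain g e where ge: "\<gamma> (h, c) = (g, e)" by (cases "\<gamma> (h, c)")
        have *: "(g, e) \<in> A.P" "\<beta> (g, e) = (h, c)" using \<gamma>P[OF p(1)] \<beta>\<gamma>[OF p(1)] ge by auto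
        then have "bd1 (mn1 g e) g = d" using r p ge by (auto simp: X\<Phi>)
        then show "bd2 (mn2 h c) h = d" using bd[OF *] by simp
      qed
    qed
    then show ?thesis by (simp add: A.homogeneous_iff[OF s] B.homogeneous_iff[OF \<Phi>c])
  qed
  have "linear_map (class_ring :: complex ring) A.M B.M \<Phi>"
  proof -
    have "\<Phi> \<in> LinearCombinations.module_hom (class_ring :: complex ring) A.M B.M"
      unfolding LinearCombinations.module_hom_def
    proof (intro CollectI conjI allI impI)
      show "\<Phi> \<in> carrier A.M \<rightarrow> carrier B.M" using \<Phi>c by auto
    next
      fix s t assume "s \<in> carrier A.M \<and> t \<in> carrier A.M"
      then show "\<Phi> (s \<oplus>\<^bsub>A.M\<^esub> t) = \<Phi> s \<oplus>\<^bsub>B.M\<^esub> \<Phi> t"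
        by (intro B.X_inj) (auto simp: \<Phi>c B.add_closed B.X_add A.X_add X\<Phi>)
    next
      fix r :: complex and s assume "r \<in> carrier class_ring \<and> s \<in> carrier A.M"
      then show "\<Phi> (r \<odot>\<^bsub>A.M\<^esub> s) = r \<odot>\<^bsub>B.M\<^esub> \<Phi> s"
        by (intro B.X_inj) (auto simp: \<Phi>c B.smult_closed B.X_smult A.X_smult X\<Phi>)
    qed
    then show ?thesis
      using A.vectorspace_M B.vectorspace_M
      by (intro linear_map.intro mod_hom.intro mod_hom_axioms.intro) (auto simp: vectorspace_def)
  qed
  moreover have "\<Phi> ` homogeneous_part V W1 H1 bd1 d = homogeneous_part V W2 H2 bd2 d" for d
  proof (intro equalityI subsetI)
    fix t assume "t \<in> \<Phi> ` homogeneous_part V W1 H1 bd1 d"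
    then obtain s where s: "s \<in> homogeneous_part V W1 H1 bd1 d" "t = \<Phi> s" by blast
    then have "s \<in> carrier A.M" by (simp add: homogeneous_part_def)
    then show "t \<in> homogeneous_part V W2 H2 bd2 d" using hom s by simp
  next
    fix t assume t: "t \<in> homogeneous_part V W2 H2 bd2 d"
    then have tc: "t \<in> carrier B.M" by (simp add: homogeneous_part_def)
    then have "\<Psi> t \<in> homogeneous_part V W1 H1 bd1 d"
      using hom[OF \<Psi>c, of t d] \<Phi>\<Psi>[OF tc] t by simp
    then show "t \<in> \<Phi> ` homogeneous_part V W1 H1 bd1 d" using \<Phi>\<Psi>[OF tc] by (metis imageI)
  qed
  ultimately show ?thesis using bijM by blast
qed

section \<open>Duality of sector and monomial\<close>

lemma frac_minus_self_Ints: "frac x - (x::rat) \<in> \<int>"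
  by (simp add: frac_def)

lemma Ints_frac_zero: "x \<in> \<int> \<Longrightarrow> 0 \<le> x \<Longrightarrow> x < (1::rat) \<Longrightarrow> x = 0"
  using Ints_less_imp_add1_le[of 0 x] by (cases "x = 0") auto

lemma frac_unit: "0 \<le> x \<Longrightarrow> x < (1::rat) \<Longrightarrow> frac x = x"
  by (simp add: frac_eq)

context inv_struct
begin

text \<open>The maximal symmetry group, described by integrality of a matrix product instead of
  evaluation of the polynomial; \<open>G_max_eq\<close> identifies the two.\<close>

definition Gm :: "('v \<Rightarrow> rat) set" where
  "Gm = {g. (\<forall>j\<in>V. 0 \<le> g j \<and> g j < 1) \<and> (\<forall>j. j \<notin> V \<longrightarrow> g j = 0) \<and>
     (\<forall>i\<in>V. symm_weights g i \<in> \<int>)}"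

lemma fixed_closed:
  assumes g: "g \<in> Gm" and i: "i \<in> fixed_vars V g" and j: "nx i = Some j"
  shows "j \<in> fixed_vars V g"
proof -
  have iV: "i \<in> V" "g i = 0" using i by (auto simp: fixed_vars_def)
  have jV: "j \<in> V" using nx_pv[OF iV(1) j] by simp
  have "symm_weights g i \<in> \<int>" using g iV by (simp add: Gm_def)
  then have "g j \<in> \<int>" using iV j by (simp add: symm_weights_def)
  then have "g j = 0" using Ints_frac_zero g jV by (simp add: Gm_def)
  then show ?thesis using jV by (simp add: fixed_vars_def)
qed

lemma inv_sub_fixed: "g \<in> Gm \<Longrightarrow> inv_sub V a nx pv c (fixed_vars V g)"
proof unfold_locales
  assume g: "g \<in> Gm"
  show "fixed_vars V g \<subseteq> V" by (auto simp: fixed_vars_def)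
  show "j \<in> fixed_vars V g" if "i \<in> fixed_vars V g" "nx i = Some j" for i j
    by (rule fixed_closed[OF g that])
qed

definition PP :: "(('v \<Rightarrow> rat) \<times> ('v \<Rightarrow> rat)) set" where
  "PP = {(g, e). g \<in> Gm \<and> e \<in> inv_sub.E a nx pv (fixed_vars V g)}"

lemma PP_iff: "(g, e) \<in> PP \<longleftrightarrow> g \<in> Gm \<and> supp_in (fixed_vars V g) e \<and>
    (\<forall>i\<in>fixed_vars V g. R e i \<in> \<int> \<and> 0 \<le> e i \<and> e i \<le> 1) \<and>
     (\<forall>i\<in>fixed_vars V g. e i = 0 \<longrightarrow> (\<exists>p. pv i = Some p \<and> e p = 1)) \<and>
     (\<forall>i\<in>fixed_vars V g. e i = 1 \<longrightarrow> (\<exists>j. nx i = Some j \<and> e j = 0))"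
  using inv_sub.E_def[OF inv_sub_fixed] by (auto simp: PP_def)

lemma PP_props:
  assumes p: "(g, e) \<in> PP"
  shows "g \<in> Gm" "i \<notin> V \<Longrightarrow> e i = 0" "g i \<noteq> 0 \<Longrightarrow> e i = 0" "0 \<le> e i \<and> e i \<le> 1"
    "0 \<le> g i \<and> g i < 1" "i \<in> V \<Longrightarrow> R e i \<in> \<int>"
    "i \<notin> fixed_vars V g \<Longrightarrow> i \<in> V \<Longrightarrow> R e i = 0"
    "i \<in> V \<Longrightarrow> symm_weights g i \<in> \<int>"
    "g i = 0 \<Longrightarrow> i \<in> V \<Longrightarrow> e i = 0 \<Longrightarrow> (\<exists>p. pv i = Some p \<and> e p = 1 \<and> g p = 0)"
    "g i = 0 \<Longrightarrow> i \<in> V \<Longrightarrow> e i = 1 \<Longrightarrow> (\<exists>j. nx i = Some j \<and> e j = 0 \<and> g j = 0)"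
proof -
  show g: "g \<in> Gm" using p by (simp add: PP_iff)
  show s1: "i \<notin> V \<Longrightarrow> e i = 0" for i using p by (auto simp: PP_iff supp_in_def fixed_vars_def)
  show s2: "g i \<noteq> 0 \<Longrightarrow> e i = 0" for i using p by (auto simp: PP_iff supp_in_def fixed_vars_def)
  show "0 \<le> e i \<and> e i \<le> 1"
    using s1[of i] s2[of i] p by (cases "i \<in> fixed_vars V g") (auto simp: PP_iff fixed_vars_def)
  show "0 \<le> g i \<and> g i < 1" using g by (cases "i \<in> V") (auto simp: Gm_def)
  show z: "R e i = 0" if i: "i \<notin> fixed_vars V g" "i \<in> V"
  proof -
    have "e i = 0" using s2[of i] i by (auto simp: fixed_vars_def)
    moreover have "ov e (pv i) = 0"
    proof (cases "pv i")
      case (Some q)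
      have "nx q = Some i" "q \<in> V" using pv_nx[OF i(2) Some] by auto
      then have "q \<notin> fixed_vars V g" using fixed_closed[OF g] i by blast
      then show ?thesis using Some s2[of q] \<open>q \<in> V\<close> by (auto simp: fixed_vars_def)
    qed simp
    ultimately show ?thesis by (simp add: R_def)
  qed
  show "i \<in> V \<Longrightarrow> R e i \<in> \<int>" using z p by (cases "i \<in> fixed_vars V g") (auto simp: PP_iff)
  show "i \<in> V \<Longrightarrow> symm_weights g i \<in> \<int>" using g by (simp add: Gm_def)
  show "\<exists>p. pv i = Some p \<and> e p = 1 \<and> g p = 0" if i: "g i = 0" "i \<in> V" "e i = 0"
  proof -
    obtain q where q: "pv i = Some q" "e q = 1" using p i by (auto simp: PP_iff fixed_vars_def)
    then have "g q = 0" using s2[of q] by auto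
    then show ?thesis using q by blast
  qed
  show "\<exists>j. nx i = Some j \<and> e j = 0 \<and> g j = 0" if i: "g i = 0" "i \<in> V" "e i = 1"
  proof -
    obtain j where j: "nx i = Some j" "e j = 0" using p i by (auto simp: PP_iff fixed_vars_def)
    have "i \<in> fixed_vars V g" using i by (simp add: fixed_vars_def)
    then have "j \<in> fixed_vars V g" using fixed_closed[OF g _ j(1)] by blast
    then show ?thesis using j by (auto simp: fixed_vars_def)
  qed
qed

text \<open>At fixed variables an entry 1 is followed by an entry 0 and an entry 0 is preceded by an
  entry 1, so \<open>nx\<close> and \<open>pv\<close> give inverse bijections. This balances the
  exchange of 0 and 1 in the duality.\<close>

lemma PP_card_zero_one:
  assumes p: "(g, e) \<in> PP"
  shows "card {i \<in> V. g i = 0 \<and> e i = 1} = card {i \<in> V. g i = 0 \<and> e i = 0}"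
proof (rule bij_betw_same_card[of "\<lambda>i. the (nx i)"], rule bij_betw_byWitness[where f' = "\<lambda>i. the (pv i)"])
  have 1: "\<exists>j. nx i = Some j \<and> e j = 0 \<and> g j = 0 \<and> pv j = Some i \<and> j \<in> V"
    if "i \<in> {i \<in> V. g i = 0 \<and> e i = 1}" for i
    using that PP_props(10)[OF p, of i] nx_pv[of i] by auto
  have 2: "\<exists>q. pv i = Some q \<and> e q = 1 \<and> g q = 0 \<and> nx q = Some i \<and> q \<in> V"
    if "i \<in> {i \<in> V. g i = 0 \<and> e i = 0}" for i
    using that PP_props(9)[OF p, of i] pv_nx[of i] by auto
  show "\<forall>i\<in>{i \<in> V. g i = 0 \<and> e i = 1}. the (pv (the (nx i))) = i" using 1 by fastforce
  show "\<forall>i\<in>{i \<in> V. g i = 0 \<and> e i = 0}. the (nx (the (pv i))) = i" using 2 by fastforce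
  show "(\<lambda>i. the (nx i)) ` {i \<in> V. g i = 0 \<and> e i = 1} \<subseteq> {i \<in> V. g i = 0 \<and> e i = 0}" using 1 by fastforce
  show "(\<lambda>i. the (pv i)) ` {i \<in> V. g i = 0 \<and> e i = 0} \<subseteq> {i \<in> V. g i = 0 \<and> e i = 1}" using 2 by fastforce
qed

end

text \<open>Krawitz duality in the coordinates \<open>e\<close>: the fractional part of \<open>e\<close> becomes the group element and
  \<open>g\<close> becomes the fractional part of the new \<open>e\<close>.\<close>

definition kdual :: "'v set \<Rightarrow> ('v \<Rightarrow> 'v) \<Rightarrow> ('v \<Rightarrow> rat) \<times> ('v \<Rightarrow> rat) \<Rightarrow> ('v \<Rightarrow> rat) \<times> ('v \<Rightarrow> rat)" where
  "kdual V \<pi> = (\<lambda>(g, e).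
     (\<lambda>j. if j \<in> V then frac (e (\<pi> j)) else 0,
      \<lambda>j. if j \<in> V then
        if g (\<pi> j) \<noteq> 0 then g (\<pi> j)
        else if e (\<pi> j) = 0 \<or> e (\<pi> j) = 1 then 1 - e (\<pi> j) else 0 else 0))"

lemma frac_cases_unit:
  assumes "0 \<le> x" "x \<le> (1::rat)"
  shows "frac x = (if x = 0 \<or> x = 1 then 0 else x)"
  using assms frac_unit[of x] by (auto simp: frac_def)

text \<open>The second structure is the transpose of the first, with all arrows reversed. The
  renaming \<open>\<pi>\<close> is needed because an exponent matrix may list the terms in any
  order: row \<open>i\<close> is the term whose first variable is \<open>\<pi> i\<close>.\<close>

locale krawitz =
  W: inv_struct V a nx pv c + T: inv_struct V aT nxT pvT cT
  for V :: "'v set" and a nx pv c aT nxT pvT cT +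
  fixes \<pi> \<rho> :: "'v \<Rightarrow> 'v"
  assumes pi_V: "i \<in> V \<Longrightarrow> \<pi> i \<in> V" and rho_V: "i \<in> V \<Longrightarrow> \<rho> i \<in> V"
    and rho_pi: "i \<in> V \<Longrightarrow> \<rho> (\<pi> i) = i" and pi_rho: "i \<in> V \<Longrightarrow> \<pi> (\<rho> i) = i"
    and aT_eq: "i \<in> V \<Longrightarrow> aT i = a (\<pi> i)"
    and pv_pi: "i \<in> V \<Longrightarrow> pv (\<pi> i) = map_option \<pi> (nxT i)"
    and nx_pi: "i \<in> V \<Longrightarrow> nx (\<pi> i) = map_option \<pi> (pvT i)"
begin

lemma krawitz_swap: "krawitz V aT nxT pvT cT a nx pv c \<rho> \<pi>"
proof
  fix i assume i: "i \<in> V"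
  show "\<rho> i \<in> V" "\<pi> i \<in> V" "\<pi> (\<rho> i) = i" "\<rho> (\<pi> i) = i"
    using i pi_V rho_V pi_rho rho_pi by auto
  show "a i = aT (\<rho> i)" using i rho_V pi_rho aT_eq by simp
  have "nx i = map_option \<pi> (pvT (\<rho> i))" using nx_pi[OF rho_V[OF i]] pi_rho[OF i] by simp
  then show "pvT (\<rho> i) = map_option \<rho> (nx i)"
    using T.pv_nx[OF rho_V[OF i]] rho_pi by (cases "pvT (\<rho> i)") auto
  have "pv i = map_option \<pi> (nxT (\<rho> i))" using pv_pi[OF rho_V[OF i]] pi_rho[OF i] by simp
  then show "nxT (\<rho> i) = map_option \<rho> (pv i)"
    using T.nx_pv[OF rho_V[OF i]] rho_pi by (cases "nxT (\<rho> i)") auto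
qed

lemma bij_pi: "bij_betw \<pi> V V"
  by (rule bij_betw_byWitness[where f' = \<rho>]) (use pi_V rho_V pi_rho rho_pi in auto)

lemma sum_pi: "(\<Sum>j\<in>V. f (\<pi> j)) = (\<Sum>i\<in>V. f i)"
  by (rule sum.reindex_bij_betw[OF bij_pi])

lemma ov_map: "ov f (map_option \<pi> x) = ov (\<lambda>j. f (\<pi> j)) x"
  by (cases x) auto

text \<open>Up to renaming and integers the new pair is \<open>(e, g)\<close>. Hence the integrality
  conditions on \<open>symm_weights\<close> and on \<open>R\<close> change places, and exchanging 0
  with 1 along with \<open>nx\<close> and \<open>pv\<close> preserves the conditions at these
  entries.\<close>

lemma kdual_PP:
  assumes p: "(g, e) \<in> W.PP" shows "kdual V \<pi> (g, e) \<in> T.PP"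
proof -
  define h where "h j = (if j \<in> V then frac (e (\<pi> j)) else 0)" for j
  define d where "d j = (if j \<in> V then
        if g (\<pi> j) \<noteq> 0 then g (\<pi> j)
        else if e (\<pi> j) = 0 \<or> e (\<pi> j) = 1 then 1 - e (\<pi> j) else 0 else 0)" for j
  have kd: "kdual V \<pi> (g, e) = (h, d)" by (simp add: kdual_def h_def d_def fun_eq_iff)
  note pr = W.PP_props[OF p]
  have erange: "0 \<le> e i" "e i \<le> 1" for i using pr(4)[of i] by auto
  have grange: "0 \<le> g i" "g i < 1" for i using pr(5)[of i] by auto
  have h_e: "h j - e (\<pi> j) \<in> \<int>" if "j \<in> V" for j
    using that frac_minus_self_Ints by (simp add: h_def)
  have d_g: "d j - g (\<pi> j) \<in> \<int>" if "j \<in> V" for j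
    using that by (auto simp: d_def)
  have h0: "h j = (if e (\<pi> j) = 0 \<or> e (\<pi> j) = 1 then 0 else e (\<pi> j))" if "j \<in> V" for j
    using that frac_cases_unit[OF erange] by (simp add: h_def)
  have drange: "0 \<le> d j \<and> d j \<le> 1" for j
    using grange[of "\<pi> j"] erange[of "\<pi> j"] by (auto simp: d_def)
  have hG: "h \<in> T.Gm"
    unfolding T.Gm_def
  proof (intro CollectI conjI ballI allI impI)
    fix j assume j: "j \<in> V"
    show "0 \<le> h j" "h j < 1" using j by (auto simp: h_def frac_lt_1)
    have "ov h (nxT j) - ov e (pv (\<pi> j)) \<in> \<int>"
      unfolding pv_pi[OF j] ov_map using T.nx_pv[OF j] h_e by (cases "nxT j") auto
    moreover have "of_nat (aT j) * (h j - e (\<pi> j)) \<in> \<int>" using h_e[OF j] by simp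
    moreover have "T.symm_weights h j = W.R e (\<pi> j) + of_nat (aT j) * (h j - e (\<pi> j)) + (ov h (nxT j) - ov e (pv (\<pi> j)))"
      using aT_eq[OF j] by (simp add: T.symm_weights_def W.R_def algebra_simps)
    ultimately show "T.symm_weights h j \<in> \<int>" using pr(6)[OF pi_V[OF j]] by simp
  qed (simp add: h_def)
  have fxh: "j \<in> fixed_vars V h \<longleftrightarrow> j \<in> V \<and> (e (\<pi> j) = 0 \<or> e (\<pi> j) = 1)" for j
    using h0[of j] by (auto simp: fixed_vars_def)
  have "(h, d) \<in> T.PP"
    unfolding T.PP_iff
  proof (intro conjI ballI impI hG)
    show "supp_in (fixed_vars V h) d"
      unfolding supp_in_def
    proof (intro allI impI)
      fix j assume "j \<notin> fixed_vars V h"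
      then show "d j = 0" using pr(3)[of "\<pi> j"] by (auto simp: fxh d_def)
    qed
    fix j assume j: "j \<in> fixed_vars V h"
    then have jV: "j \<in> V" by (simp add: fixed_vars_def)
    have "ov d (pvT j) - ov g (nx (\<pi> j)) \<in> \<int>"
      unfolding nx_pi[OF jV] ov_map using T.pv_nx[OF jV] d_g by (cases "pvT j") auto
    moreover have "of_nat (aT j) * (d j - g (\<pi> j)) \<in> \<int>" using d_g[OF jV] by simp
    moreover have "T.R d j = W.symm_weights g (\<pi> j) + of_nat (aT j) * (d j - g (\<pi> j)) + (ov d (pvT j) - ov g (nx (\<pi> j)))"
      using aT_eq[OF jV] by (simp add: W.symm_weights_def T.R_def algebra_simps)
    ultimately show "T.R d j \<in> \<int>" using pr(8)[OF pi_V[OF jV]] by simp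
    show "0 \<le> d j" "d j \<le> 1" using drange by auto
    show "\<exists>p. pvT j = Some p \<and> d p = 1" if "d j = 0"
    proof -
      have "g (\<pi> j) = 0" "e (\<pi> j) = 1" using that j by (auto simp: d_def fxh split: if_splits)
      then obtain k where k: "nx (\<pi> j) = Some k" "e k = 0" "g k = 0"
        using pr(10)[OF _ pi_V[OF jV]] by blast
      then obtain q where q: "pvT j = Some q" "k = \<pi> q" using nx_pi[OF jV] by auto
      have "q \<in> V" using T.pv_nx[OF jV q(1)] by simp
      then have "d q = 1" using k q by (simp add: d_def)
      then show ?thesis using q by blast
    qed
    show "\<exists>k. nxT j = Some k \<and> d k = 0" if "d j = 1"
    proof -
      have "g (\<pi> j) = 0" "e (\<pi> j) = 0"
        using that j grange[of "\<pi> j"] by (auto simp: d_def fxh split: if_splits)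
      then obtain k where k: "pv (\<pi> j) = Some k" "e k = 1" "g k = 0"
        using pr(9)[OF _ pi_V[OF jV]] by blast
      then obtain q where q: "nxT j = Some q" "k = \<pi> q" using pv_pi[OF jV] by auto
      have "q \<in> V" using T.nx_pv[OF jV q(1)] by simp
      then have "d q = 0" using k q by (simp add: d_def)
      then show ?thesis using q by blast
    qed
  qed
  then show ?thesis by (simp add: kd)
qed

text \<open>An entry of \<open>e\<close> strictly between 0 and 1 is kept as its own fractional
  part; the entries 0 and 1, which have the same fractional part, are told apart by the second
  component.\<close>

lemma kdual_inverse:
  assumes p: "(g, e) \<in> W.PP" shows "kdual V \<rho> (kdual V \<pi> (g, e)) = (g, e)"
proof -
  note pr = W.PP_props[OF p]
  have erange: "0 \<le> e i" "e i \<le> 1" for i using pr(4)[of i] by auto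
  have grange: "0 \<le> g i" "g i < 1" for i using pr(5)[of i] by auto
  have g0: "g i = 0" if "i \<notin> V" for i using pr(1) that by (simp add: W.Gm_def)
  have fg: "frac (g i) = g i" for i by (rule frac_unit[OF grange])
  have fe: "frac (e i) = (if e i = 0 \<or> e i = 1 then 0 else e i)" for i
    by (rule frac_cases_unit[OF erange])
  have g1: "g i \<noteq> 1" for i using grange(2)[of i] by auto
  show ?thesis
  proof (rule prod_eqI)
    show "fst (kdual V \<rho> (kdual V \<pi> (g, e))) = fst (g, e)"
      using g0 by (auto simp: kdual_def fun_eq_iff rho_V pi_rho fg)
    show "snd (kdual V \<rho> (kdual V \<pi> (g, e))) = snd (g, e)"
      using pr(2,3) by (auto simp: kdual_def fun_eq_iff rho_V pi_rho fe g1)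
  qed
qed

text \<open>The second identity holds entry by entry. In the first, the entries 0 and 1 of
  \<open>e\<close> at fixed variables are off by 1 in opposite directions, and there are equally
  many of them.\<close>

lemma kdual_degree:
  assumes p: "(g, e) \<in> W.PP" and k: "kdual V \<pi> (g, e) = (h, d)"
  shows "(\<Sum>i\<in>V. e i) + (\<Sum>i\<in>V. g i) = (\<Sum>i\<in>V. d i) + (\<Sum>i\<in>V. h i)"
    and "of_nat (card (fixed_vars V g)) - (\<Sum>i\<in>V. e i) + (\<Sum>i\<in>V. g i) = (\<Sum>i\<in>V. d i) + (\<Sum>i\<in>V. frac (- h i))"
proof -
  note pr = W.PP_props[OF p]
  have erange: "0 \<le> e i" "e i \<le> 1" for i using pr(4)[of i] by auto
  have grange: "0 \<le> g i" "g i < 1" for i using pr(5)[of i] by auto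
  define d' where "d' i = (if g i \<noteq> 0 then g i else if e i = 0 \<or> e i = 1 then 1 - e i else 0)" for i
  have d: "(\<Sum>i\<in>V. d i) = (\<Sum>i\<in>V. d' i)"
    unfolding sum_pi[of d', symmetric] using k by (intro sum.cong) (auto simp: kdual_def d'_def)
  have h: "(\<Sum>i\<in>V. f (h i)) = (\<Sum>i\<in>V. f (frac (e i)))" for f :: "rat \<Rightarrow> rat"
    unfolding sum_pi[of "\<lambda>i. f (frac (e i))", symmetric] using k by (intro sum.cong) (auto simp: kdual_def)
  have fr: "frac (e i) = (if e i = 0 \<or> e i = 1 then 0 else e i)" for i
    by (rule frac_cases_unit[OF erange])
  have z: "(\<Sum>i\<in>V. if g i = 0 \<and> e i = 1 then 1 else 0) = (\<Sum>i\<in>V. if g i = 0 \<and> e i = 0 then (1::rat) else 0)"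
    using W.PP_card_zero_one[OF p] W.finite_V by (simp add: sum.If_cases Int_def conj_commute)
  have "e i + g i + (if g i = 0 \<and> e i = 0 then 1 else 0) = d' i + frac (e i) + (if g i = 0 \<and> e i = 1 then 1 else 0)" if "i \<in> V" for i
    unfolding fr d'_def using pr(3)[of i] by auto
  then have "(\<Sum>i\<in>V. e i + g i + (if g i = 0 \<and> e i = 0 then 1 else 0)) = (\<Sum>i\<in>V. d' i + frac (e i) + (if g i = 0 \<and> e i = 1 then 1 else 0))"
    by (intro sum.cong) auto
  then show "(\<Sum>i\<in>V. e i) + (\<Sum>i\<in>V. g i) = (\<Sum>i\<in>V. d i) + (\<Sum>i\<in>V. h i)"
    unfolding d h[of "\<lambda>x. x"] sum.distrib z by simp
  have fr': "frac (- frac (e i)) = (if e i = 0 \<or> e i = 1 then 0 else 1 - e i)" for i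
  proof (cases "e i = 0 \<or> e i = 1")
    case False
    then have "0 < e i" "e i < 1" using erange[of i] by auto
    moreover have "e i \<notin> \<int>" using Ints_frac_zero[of "e i"] calculation by auto
    ultimately have "frac (- e i) = 1 - e i" by (simp add: frac_neg frac_unit)
    then show ?thesis using False by (simp add: fr)
  qed (auto simp: fr)
  have "of_nat (card (fixed_vars V g)) = (\<Sum>i\<in>V. if g i = 0 then (1::rat) else 0)"
    using W.finite_V by (simp add: sum.If_cases Int_def fixed_vars_def)
  moreover have "(if g i = 0 then 1 else 0) - e i + g i = d' i + frac (- frac (e i))" if "i \<in> V" for i
    unfolding fr' d'_def using pr(3)[of i] by auto
  then have "(\<Sum>i\<in>V. (if g i = 0 then 1 else 0) - e i + g i) = (\<Sum>i\<in>V. d' i + frac (- frac (e i)))"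
    by (intro sum.cong) auto
  ultimately show "of_nat (card (fixed_vars V g)) - (\<Sum>i\<in>V. e i) + (\<Sum>i\<in>V. g i) = (\<Sum>i\<in>V. d i) + (\<Sum>i\<in>V. frac (- h i))"
    unfolding d h[of "\<lambda>x. frac (- x)"] by (simp add: sum.distrib sum_subtractf)
qed

text \<open>The product of \<open>h\<close>, the exponent matrix and \<open>k\<close> that defines
  the transposed group, with rows renamed by \<open>\<pi>\<close>.\<close>

definition pair :: "('v \<Rightarrow> rat) \<Rightarrow> ('v \<Rightarrow> rat) \<Rightarrow> rat" where
  "pair h k = (\<Sum>i\<in>V. h i * W.symm_weights k (\<pi> i))"

text \<open>The matrix may be applied to either argument. The two forms make the pairing well
  defined modulo integers in each argument.\<close>

lemma pair_alt: "pair h k = (\<Sum>j\<in>V. k (\<pi> j) * T.symm_weights h j)"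
proof -
  define k' where "k' j = (if j \<in> V then k (\<pi> j) else 0)" for j
  have "W.symm_weights k (\<pi> j) = T.R k' j" if j: "j \<in> V" for j
  proof -
    have "ov k (nx (\<pi> j)) = ov k' (pvT j)"
      unfolding nx_pi[OF j] ov_map using T.pv_nx[OF j] by (cases "pvT j") (auto simp: k'_def)
    then show ?thesis using j aT_eq[OF j] by (simp add: W.symm_weights_def T.R_def k'_def)
  qed
  then have "pair h k = (\<Sum>j\<in>V. T.R k' j * h j)" by (simp add: pair_def mult.commute)
  also have "\<dots> = (\<Sum>j\<in>V. k' j * (of_nat (aT j) * h j + ov h (nxT j)))"
    by (rule T.sum_R_adjoint) (auto simp: supp_in_def k'_def dest: T.nx_pv)
  finally show ?thesis by (simp add: k'_def T.symm_weights_def)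
qed

lemma pair_add_right:
  assumes h: "h \<in> T.Gm" and k: "\<And>i. i \<in> V \<Longrightarrow> k' i - (k i + l i) \<in> \<int>"
  shows "pair h k' - (pair h k + pair h l) \<in> \<int>"
proof -
  have "pair h k' - (pair h k + pair h l) = (\<Sum>j\<in>V. (k' (\<pi> j) - (k (\<pi> j) + l (\<pi> j))) * T.symm_weights h j)"
    unfolding pair_alt by (simp add: sum_subtractf sum.distrib algebra_simps)
  also have "\<dots> \<in> \<int>"
    using h k pi_V by (intro Ints_sum Ints_mult) (auto simp: T.Gm_def)
  finally show ?thesis .
qed

lemma pair_add_left:
  assumes k: "k \<in> W.Gm" and h: "\<And>i. i \<in> V \<Longrightarrow> h' i - (h i + l i) \<in> \<int>"
  shows "pair h' k - (pair h k + pair l k) \<in> \<int>"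
proof -
  have "pair h' k - (pair h k + pair l k) = (\<Sum>j\<in>V. (h' j - (h j + l j)) * W.symm_weights k (\<pi> j))"
    unfolding pair_def by (simp add: sum_subtractf sum.distrib algebra_simps)
  also have "\<dots> \<in> \<int>"
    using h k pi_V by (intro Ints_sum Ints_mult) (auto simp: W.Gm_def)
  finally show ?thesis .
qed

text \<open>By adjointness the exponent of the character is \<open>e\<close> paired with the
  exponent matrix applied to \<open>k\<close>, and the dual sector \<open>h\<close> agrees with
  \<open>e\<close> modulo integers. So invariance under \<open>k\<close> means that \<open>h\<close>
  and \<open>k\<close> pair to an integer.\<close>

lemma character_pair:
  assumes p: "(g, e) \<in> W.PP" and k: "k \<in> W.Gm" and kd: "kdual V \<pi> (g, e) = (h, d)"
  shows "(\<Sum>i\<in>fixed_vars V g. W.R e i * k i) - pair h k \<in> \<int>"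
proof -
  note pr = W.PP_props[OF p]
  have fin: "finite V" by (rule W.finite_V)
  have "(\<Sum>i\<in>fixed_vars V g. W.R e i * k i) = (\<Sum>i\<in>V. W.R e i * k i)"
    by (rule sum.mono_neutral_left) (use fin pr(7) in \<open>auto simp: fixed_vars_def\<close>)
  also have "\<dots> = (\<Sum>i\<in>V. e i * (of_nat (a i) * k i + ov k (nx i)))"
    by (rule W.sum_R_adjoint) (auto simp: supp_in_def pr(2) dest: W.nx_pv)
  also have "\<dots> = (\<Sum>i\<in>V. e (\<pi> i) * W.symm_weights k (\<pi> i))"
    unfolding W.symm_weights_def[symmetric] by (rule sum_pi[symmetric])
  finally have "(\<Sum>i\<in>fixed_vars V g. W.R e i * k i) - pair h k = (\<Sum>i\<in>V. (e (\<pi> i) - h i) * W.symm_weights k (\<pi> i))"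
    unfolding pair_def by (simp add: sum_subtractf algebra_simps)
  also have "\<dots> \<in> \<int>"
  proof (intro Ints_sum Ints_mult)
    fix i assume i: "i \<in> V"
    have "h i = frac (e (\<pi> i))" using kd i by (auto simp: kdual_def)
    then show "e (\<pi> i) - h i \<in> \<int>" using frac_minus_self_Ints[of "e (\<pi> i)"] by (simp add: frac_def)
    show "W.symm_weights k (\<pi> i) \<in> \<int>" using k pi_V[OF i] by (simp add: W.Gm_def)
  qed
  finally show ?thesis .
qed

end

section \<open>Diagonal symmetries and weights\<close>

abbreviation mval :: "('v \<Rightarrow> complex) \<Rightarrow> 'v exponent \<Rightarrow> complex" where
  "mval z m \<equiv> (\<Prod>j\<in>kys m. z j ^ lkp m j)"

lemma mval_mult: "mval (\<lambda>j. w j * z j) m = mval w m * mval z m"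
  by (simp add: power_mult_distrib prod.distrib)

text \<open>If \<open>m\<close> and \<open>m0\<close> differ at the variable \<open>j\<close>,
  scaling it by 2 multiplies them by different factors. Subtracting the right multiple of the
  relation removes \<open>m0\<close> and leaves a relation on fewer monomials.\<close>

lemma monomials_independent:
  assumes "finite S" "\<And>z. (\<Sum>m\<in>S. d m * mval z m) = 0" "m \<in> S"
  shows "d m = 0"
  using assms
proof (induction S arbitrary: d m rule: finite_induct)
  case empty then show ?case by simp
next
  case (insert m0 S)
  have *: "d m = 0" if m: "m \<in> S" for m
  proof -
    have sep: "d m * (mval w m - mval w m0) = 0" for w
    proof (rule insert.IH[OF _ m])
      fix z
      have "0 = (\<Sum>m\<in>insert m0 S. d m * mval (\<lambda>j. w j * z j) m) - mval w m0 * (\<Sum>m\<in>insert m0 S. d m * mval z m)"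
        by (simp only: insert.prems mult_zero_right diff_zero)
      also have "\<dots> = (\<Sum>m\<in>S. d m * (mval w m - mval w m0) * mval z m)"
        using insert.hyps unfolding mval_mult
        by (simp add: algebra_simps sum_distrib_left sum_subtractf)
      finally show "(\<Sum>m\<in>S. d m * (mval w m - mval w m0) * mval z m) = 0" by simp
    qed
    have "m \<noteq> m0" using m insert.hyps by blast
    then obtain j where j: "lkp m j \<noteq> lkp m0 j" by (metis poly_mapping_eqI)
    define w :: "_ \<Rightarrow> complex" where "w i = (if i = j then 2 else 1)" for i
    have w: "mval w n = 2 ^ lkp n j" for n
    proof -
      have "mval w n = (\<Prod>i\<in>kys n. if i = j then 2 ^ lkp n i else 1)"
        by (rule prod.cong) (auto simp: w_def)
      also have "\<dots> = (if j \<in> kys n then 2 ^ lkp n j else 1)" by simp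
      finally show ?thesis by (auto simp: in_keys_iff)
    qed
    have "mval w m \<noteq> mval w m0"
    proof
      assume "mval w m = mval w m0"
      then have "cmod (2 ^ lkp m j) = cmod (2 ^ lkp m0 j)" by (simp only: w)
      then have "(2::real) ^ lkp m j = 2 ^ lkp m0 j" by (simp add: norm_power)
      then show False using j by simp
    qed
    then show ?thesis using sep[of w] by (metis mult_eq_0_iff right_minus_eq)
  qed
  have "(\<Sum>m\<in>insert m0 S. d m * mval (\<lambda>_. 1) m) = 0" by (rule insert.prems)
  then have "d m0 = 0" using insert.hyps * by simp
  then show ?case using * insert.prems by blast
qed

lemma prod_cis: "(\<Prod>j\<in>A. cis (f j)) = cis (\<Sum>j\<in>A. f j)"
  by (induction A rule: infinite_finite_induct) (auto simp: cis_mult)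

lemma cis_two_pi_eq_1_iff: "cis (2 * pi * of_rat x) = 1 \<longleftrightarrow> x \<in> \<int>"
proof
  assume "cis (2 * pi * of_rat x) = 1"
  then have "cos (2 * pi * of_rat x) = 1" by (metis cis.simps(1) one_complex.simps(1))
  then obtain n :: int where "2 * pi * of_rat x = n * 2 * pi" by (auto simp: cos_one_2pi_int)
  then have "of_rat x = (of_rat (of_int n) :: real)" by simp
  then have "x = of_int n" by (simp only: of_rat_eq_iff)
  then show "x \<in> \<int>" by simp
qed (rule cis_two_pi_Ints)

lemma frac_eqI: "x - y \<in> \<int> \<Longrightarrow> frac x = frac (y::rat)"
proof (elim Ints_cases)
  fix k assume "x - y = of_int k"
  then have "x = y + of_int k" by simp
  then show ?thesis by (simp add: frac_def)
qed

lemma QZ_simps [simp]: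
  "carrier (QZ_group V) = {g. (\<forall>j\<in>V. 0 \<le> g j \<and> g j < 1) \<and> (\<forall>j. j \<notin> V \<longrightarrow> g j = 0)}"
  "mult (QZ_group V) g h = (\<lambda>j. frac (g j + h j))" "one (QZ_group V) = (\<lambda>_. 0)"
  by (simp_all add: QZ_group_def)

lemma frac_add_assoc: "frac (frac (x + y) + z) = frac (x + frac (y + (z::rat)))"
proof (rule frac_eqI)
  have "frac (x + y) + z - (x + frac (y + z)) = (frac (x + y) - (x + y)) - (frac (y + z) - (y + z))" by simp
  also have "\<dots> \<in> \<int>" by (rule Ints_diff[OF frac_minus_self_Ints frac_minus_self_Ints])
  finally show "frac (x + y) + z - (x + frac (y + z)) \<in> \<int>" .
qed

lemma frac_neg_add_self: "frac (frac (- x) + x) = (0::rat)"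
proof -
  have "frac (frac (- x) + x) = frac 0"
    by (rule frac_eqI) (use frac_minus_self_Ints[of "- x"] in simp)
  then show ?thesis by simp
qed

lemma group_QZ: "group (QZ_group V)"
proof (rule groupI)
  fix x y z assume x: "x \<in> carrier (QZ_group V)" and "y \<in> carrier (QZ_group V)" "z \<in> carrier (QZ_group V)"
  then show "x \<otimes>\<^bsub>QZ_group V\<^esub> y \<in> carrier (QZ_group V)" by (auto simp: frac_lt_1)
  show "x \<otimes>\<^bsub>QZ_group V\<^esub> y \<otimes>\<^bsub>QZ_group V\<^esub> z = x \<otimes>\<^bsub>QZ_group V\<^esub> (y \<otimes>\<^bsub>QZ_group V\<^esub> z)"
    by (simp add: frac_add_assoc add.assoc)
next
  fix x assume x: "x \<in> carrier (QZ_group V)"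
  show "\<one>\<^bsub>QZ_group V\<^esub> \<otimes>\<^bsub>QZ_group V\<^esub> x = x"
  proof
    fix j show "(\<one>\<^bsub>QZ_group V\<^esub> \<otimes>\<^bsub>QZ_group V\<^esub> x) j = x j"
      using x frac_unit[of "x j"] by (cases "j \<in> V") auto
  qed
  show "\<exists>y\<in>carrier (QZ_group V). y \<otimes>\<^bsub>QZ_group V\<^esub> x = \<one>\<^bsub>QZ_group V\<^esub>"
    by (rule bexI[of _ "\<lambda>j. frac (- x j)"])
       (use x in \<open>auto simp: fun_eq_iff frac_neg_add_self frac_lt_1\<close>)
qed auto

lemma inv_QZ:
  assumes "g \<in> carrier (QZ_group V)" shows "inv\<^bsub>QZ_group V\<^esub> g = (\<lambda>j. frac (- g j))"
proof -
  interpret group "QZ_group V" by (rule group_QZ)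
  show ?thesis
    by (rule inv_equality) (use assms in \<open>auto simp: fun_eq_iff frac_neg_add_self frac_lt_1\<close>)
qed

text \<open>Translating the sum by some \<open>y\<close> with \<open>f y \<noteq> 1\<close>
  multiplies it by \<open>f y\<close>, so it vanishes.\<close>

lemma (in group) character_sum:
  fixes f :: "'a \<Rightarrow> complex"
  assumes S: "subgroup S G" and fin: "finite S"
    and hom: "\<And>x y. x \<in> S \<Longrightarrow> y \<in> S \<Longrightarrow> f (x \<otimes> y) = f x * f y"
  shows "(\<Sum>x\<in>S. f x) = (if \<forall>x\<in>S. f x = 1 then of_nat (card S) else 0)"
proof (cases "\<forall>x\<in>S. f x = 1")
  case False
  then obtain y where y: "y \<in> S" "f y \<noteq> 1" by blast
  have inj: "inj_on (\<lambda>x. y \<otimes> x) S"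
  proof (rule inj_onI)
    fix u v assume "u \<in> S" "v \<in> S" "y \<otimes> u = y \<otimes> v"
    then show "u = v" using y(1) subgroup.subset[OF S] by (metis Units_eq Units_l_cancel subsetD)
  qed
  have "(\<lambda>x. y \<otimes> x) ` S = S"
    by (rule endo_inj_surj[OF fin _ inj]) (use y(1) subgroup.m_closed[OF S] in auto)
  then have "(\<Sum>x\<in>S. f x) = (\<Sum>x\<in>S. f (y \<otimes> x))"
    using sum.reindex[OF inj, of f] by simp
  also have "\<dots> = f y * (\<Sum>x\<in>S. f x)"
    using y(1) by (simp add: hom sum_distrib_left)
  finally have "(\<Sum>x\<in>S. f x) = 0" using y(2) by simp
  then show ?thesis by (simp only: False if_False)
qed simp

section \<open>Symmetries and weights from the exponent matrix\<close>

context inv_struct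
begin

text \<open>Reversing the arrows transposes the exponent matrix, so results on \<open>R\<close>
  become results on \<open>symm_weights\<close>.\<close>

lemma swap: "inv_struct V a pv nx c"
proof unfold_locales
  show "j \<in> V \<and> j \<noteq> i \<and> nx j = Some i" if "i \<in> V" "pv i = Some j" for i j
    using pv_nx[OF that] nx_pv[of j i] by auto
  show "i \<in> V \<and> pv i = Some j" if "j \<in> V" "nx j = Some i" for i j
    using nx_pv[OF that] by simp
qed (use finite_V a_ge2 c_nz in auto)

lemma symm_weights_swap: "symm_weights = inv_struct.R a nx"
  using inv_struct.R_def[OF swap, where ?'b = rat] by (auto simp: symm_weights_def fun_eq_iff)

lemma sum_row: "i \<in> V \<Longrightarrow> (\<Sum>j\<in>V. of_nat (lkp (row i) j) * g j) = symm_weights g i"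
proof -
  assume i: "i \<in> V"
  have "(\<Sum>j\<in>V. of_nat (lkp (row i) j) * g j) =
    (\<Sum>j\<in>V. if j = i then of_nat (a i) * g j else 0) + (\<Sum>j\<in>V. if nx i = Some j then g j else 0)"
    unfolding sum.distrib[symmetric] by (rule sum.cong) (auto simp: lookup_row algebra_simps)
  also have "(\<Sum>j\<in>V. if nx i = Some j then g j else 0) = ov g (nx i)"
  proof (cases "nx i")
    case (Some k)
    then have "k \<in> V" using nx_pv[OF i] by simp
    have "(\<Sum>j\<in>V. if nx i = Some j then g j else 0) = (\<Sum>j\<in>V. if j = k then g j else 0)"
      by (rule sum.cong) (auto simp: Some)
    then show ?thesis using Some \<open>k \<in> V\<close> finite_V by simp
  qed simp
  finally show ?thesis using i finite_V by (simp add: symm_weights_def)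
qed

lemma keys_row_V: "i \<in> V \<Longrightarrow> kys (row i) \<subseteq> V"
  using nx_pv[of i] by (auto simp: keys_row_subset)

text \<open>The action multiplies each term by a root of unity, and independence of monomials forces
  every one of these factors to be 1.\<close>

lemma G_max_eq: "G_max V (wpoly V) = Gm"
proof -
  have key: "(\<forall>z. mpoly_eval (\<lambda>j. cis (2 * pi * of_rat (g j)) * z j) (wpoly V) = mpoly_eval z (wpoly V))
     \<longleftrightarrow> (\<forall>i\<in>V. symm_weights g i \<in> \<int>)" for g :: "'v \<Rightarrow> rat"
  proof -
    let ?x = "\<lambda>j. cis (2 * pi * of_rat (g j))"
    have "mval ?x (row i) = cis (2 * pi * of_rat (symm_weights g i))" if i: "i \<in> V" for i
    proof -
      have "mval ?x (row i) = (\<Prod>j\<in>V. ?x j ^ lkp (row i) j)"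
        by (rule monomial_eval_superset[OF finite_V keys_row_V[OF i]])
      also have "\<dots> = cis (\<Sum>j\<in>V. real (lkp (row i) j) * (2 * pi * of_rat (g j)))"
        by (simp only: Complex.DeMoivre prod_cis)
      also have "(\<Sum>j\<in>V. real (lkp (row i) j) * (2 * pi * of_rat (g j))) = 2 * pi * of_rat (\<Sum>j\<in>V. of_nat (lkp (row i) j) * g j)"
        by (simp add: of_rat_sum of_rat_mult sum_distrib_left mult_ac)
      finally show ?thesis using sum_row[OF i, of g] by simp
    qed
    then have 1: "mval ?x (row i) = 1 \<longleftrightarrow> symm_weights g i \<in> \<int>" if "i \<in> V" for i
      using that by (simp add: cis_two_pi_eq_1_iff)
    have 2: "mpoly_eval (\<lambda>j. ?x j * z j) (wpoly V) - mpoly_eval z (wpoly V) =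
        (\<Sum>m\<in>kys (wpoly V). (lkp (wpoly V) m * (mval ?x m - 1)) * mval z m)" for z
      unfolding mpoly_eval_def mval_mult by (simp add: algebra_simps sum_subtractf)
    have "(\<forall>z. mpoly_eval (\<lambda>j. ?x j * z j) (wpoly V) = mpoly_eval z (wpoly V)) \<longleftrightarrow>
        (\<forall>z. (\<Sum>m\<in>kys (wpoly V). (lkp (wpoly V) m * (mval ?x m - 1)) * mval z m) = 0)"
      unfolding 2[symmetric] by simp
    also have "\<dots> \<longleftrightarrow> (\<forall>m\<in>kys (wpoly V). lkp (wpoly V) m * (mval ?x m - 1) = 0)"
    proof (intro iffI ballI allI)
      fix m assume "\<forall>z. (\<Sum>m\<in>kys (wpoly V). (lkp (wpoly V) m * (mval ?x m - 1)) * mval z m) = 0" "m \<in> kys (wpoly V)"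
      then show "lkp (wpoly V) m * (mval ?x m - 1) = 0"
        using monomials_independent[of "kys (wpoly V)" "\<lambda>m. lkp (wpoly V) m * (mval ?x m - 1)" m] by simp
    next
      fix z assume *: "\<forall>m\<in>kys (wpoly V). lkp (wpoly V) m * (mval ?x m - 1) = 0"
      show "(\<Sum>m\<in>kys (wpoly V). (lkp (wpoly V) m * (mval ?x m - 1)) * mval z m) = 0"
        using * by (intro sum.neutral ballI) (simp only: mult_zero_left)
    qed
    also have "\<dots> \<longleftrightarrow> (\<forall>m\<in>kys (wpoly V). mval ?x m = 1)"
      by (intro ball_cong refl) (auto simp: in_keys_iff)
    also have "\<dots> \<longleftrightarrow> (\<forall>i\<in>V. symm_weights g i \<in> \<int>)"
      using 1 by (simp add: keys_wpoly)
    finally show ?thesis .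
  qed
  show ?thesis unfolding G_max_def Gm_def key by auto
qed

lemma finite_Gm: "finite Gm"
proof (rule finite_subset)
  define N :: rat where "N = of_nat (\<Sum>i\<in>V. a i) + 1"
  show "Gm \<subseteq> {e. supp_in V e \<and> (\<forall>i\<in>V. inv_struct.R a nx e i \<in> \<int> \<and> \<bar>inv_struct.R a nx e i\<bar> \<le> N)}"
  proof safe
    fix g i assume g: "g \<in> Gm" and i: "i \<in> V"
    have r: "0 \<le> g k" "g k \<le> 1" for k using g by (cases "k \<in> V"; force simp: Gm_def)+
    have "0 \<le> ov g (nx i)" "ov g (nx i) \<le> 1" using r by (cases "nx i"; simp)+
    moreover have "of_nat (a i) * g i \<le> of_nat (a i)" "0 \<le> of_nat (a i) * g i"
      using r[of i] by (auto intro: mult_left_le)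
    moreover have "a i \<le> (\<Sum>i\<in>V. a i)" using finite_V i by (simp add: member_le_sum)
    then have "(of_nat (a i) :: rat) \<le> of_nat (\<Sum>i\<in>V. a i)" by (simp only: of_nat_le_iff)
    ultimately show "\<bar>inv_struct.R a nx g i\<bar> \<le> N"
      unfolding symm_weights_swap[symmetric] symm_weights_def N_def by linarith
  qed (auto simp: Gm_def supp_in_def symm_weights_swap)
qed (rule inv_struct.finite_R_bounded[OF swap order_refl])

lemma Gm_carrier: "Gm \<subseteq> carrier (QZ_group V)"
  by (auto simp: Gm_def)

lemma symm_weights_diff: "symm_weights g i - symm_weights h i = symm_weights (\<lambda>j. g j - h j) i"
  by (cases "nx i") (auto simp: symm_weights_def algebra_simps)

lemma symm_weights_Ints: "i \<in> V \<Longrightarrow> (\<And>j. j \<in> V \<Longrightarrow> g j \<in> \<int>) \<Longrightarrow> symm_weights g i \<in> \<int>"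
  using nx_pv[of i] by (cases "nx i") (auto simp: symm_weights_def)

lemma symm_weights_cong_Ints:
  assumes "i \<in> V" "\<And>j. j \<in> V \<Longrightarrow> g j - h j \<in> \<int>" "symm_weights h i \<in> \<int>"
  shows "symm_weights g i \<in> \<int>"
proof -
  have "symm_weights g i - symm_weights h i \<in> \<int>"
    unfolding symm_weights_diff by (rule symm_weights_Ints) (use assms in auto)
  then show ?thesis using assms(3) by (metis Ints_add diff_add_cancel)
qed

lemma Gm_frac:
  assumes "\<And>i. i \<in> V \<Longrightarrow> symm_weights y i \<in> \<int>"
  shows "(\<lambda>j. if j \<in> V then frac (y j) else 0) \<in> Gm"
proof -
  have "symm_weights (\<lambda>j. if j \<in> V then frac (y j) else 0) i \<in> \<int>" if "i \<in> V" for i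
    by (rule symm_weights_cong_Ints[OF that, of _ y])
       (use frac_minus_self_Ints assms[OF that] in auto)
  then show ?thesis by (simp add: Gm_def frac_lt_1)
qed

lemma subgroup_Gm: "subgroup Gm (QZ_group V)"
proof (rule group.subgroupI[OF group_QZ Gm_carrier])
  have "(\<lambda>_. 0) \<in> Gm" by (auto simp: Gm_def intro: symm_weights_Ints)
  then show "Gm \<noteq> {}" by blast
  fix g assume g: "g \<in> Gm"
  have "symm_weights (\<lambda>j. - g j) i \<in> \<int>" if "i \<in> V" for i
  proof -
    have "symm_weights (\<lambda>j. - g j) i = - symm_weights g i"
      by (cases "nx i") (auto simp: symm_weights_def)
    then show ?thesis using g that by (simp add: Gm_def)
  qed
  from Gm_frac[OF this] have "(\<lambda>j. if j \<in> V then frac (- g j) else 0) \<in> Gm" .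
  moreover have "(\<lambda>j. if j \<in> V then frac (- g j) else 0) = (\<lambda>j. frac (- g j))"
    using g by (auto simp: Gm_def)
  moreover have "g \<in> carrier (QZ_group V)" using g Gm_carrier by blast
  ultimately show "inv\<^bsub>QZ_group V\<^esub> g \<in> Gm" by (simp only: inv_QZ)
  fix h assume h: "h \<in> Gm"
  have "symm_weights (\<lambda>j. g j + h j) i \<in> \<int>" if "i \<in> V" for i
  proof -
    have "symm_weights (\<lambda>j. g j + h j) i = symm_weights g i + symm_weights h i"
      by (cases "nx i") (auto simp: symm_weights_def algebra_simps)
    then show ?thesis using g h that by (simp add: Gm_def)
  qed
  from Gm_frac[OF this] have "(\<lambda>j. if j \<in> V then frac (g j + h j) else 0) \<in> Gm" .
  moreover have "(\<lambda>j. if j \<in> V then frac (g j + h j) else 0) = (\<lambda>j. frac (g j + h j))"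
    using g h by (auto simp: Gm_def)
  ultimately show "g \<otimes>\<^bsub>QZ_group V\<^esub> h \<in> Gm" by simp
qed

text \<open>Where \<open>\<bar>q i - 1/2\<bar>\<close> is maximal, the equation \<open>a i * q i + q (nx i) = 1\<close> shows that the maximum is
  at most \<open>1/2\<close>.\<close>

lemma weight_solution_range:
  assumes q: "\<And>i. i \<in> V \<Longrightarrow> symm_weights q i = 1" and i: "i \<in> V"
  shows "0 < q i" "q i \<le> 1/2"
proof -
  define M where "M = Max ((\<lambda>i. \<bar>q i - 1/2\<bar>) ` V)"
  have le: "\<bar>q k - 1/2\<bar> \<le> M" if "k \<in> V" for k
    unfolding M_def using finite_V that by (intro Max_ge) auto
  have "M \<in> (\<lambda>i. \<bar>q i - 1/2\<bar>) ` V" unfolding M_def using finite_V i by (intro Max_in) auto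
  then obtain k where k: "k \<in> V" "M = \<bar>q k - 1/2\<bar>" by blast
  have "M \<le> 1/2"
  proof (rule ccontr)
    assume M: "\<not> M \<le> 1/2"
    have ovM: "\<bar>1/2 - ov q (nx k)\<bar> \<le> M"
      using M le nx_pv[OF k(1)] by (cases "nx k") (auto simp: abs_minus_commute)
    have ak: "2 \<le> (of_nat (a k) :: rat)" by (rule a_rat_ge2[OF k(1)])
    have ovq: "ov q (nx k) = 1 - of_nat (a k) * q k"
      using q[OF k(1)] by (simp add: symm_weights_def)
    \<comment> \<open>Centred at 1/2, the equation bounds \<open>a k * M\<close> by
      \<open>M + (a k - 1) / 2\<close>, which is impossible for \<open>M > 1/2\<close>.\<close>
    have "of_nat (a k) * (q k - 1/2) = (1/2 - ov q (nx k)) - (of_nat (a k) - 1) / 2"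
      unfolding ovq by (simp add: field_simps)
    then have "\<bar>of_nat (a k) * (q k - 1/2)\<bar> \<le> \<bar>1/2 - ov q (nx k)\<bar> + \<bar>(of_nat (a k) - 1) / 2\<bar>"
      by (simp only: abs_triangle_ineq4)
    also have "\<bar>(of_nat (a k) - 1) / 2\<bar> = (of_nat (a k) - 1) / (2::rat)" using ak by simp
    finally have "\<bar>of_nat (a k) * (q k - 1/2)\<bar> \<le> M + (of_nat (a k) - 1) / 2"
      using ovM by linarith
    then have "of_nat (a k) * M \<le> M + (of_nat (a k) - 1) / 2"
      using k(2) by (simp add: abs_mult)
    then have "(of_nat (a k) - 1) * (M - 1/2) \<le> 0" by (simp add: algebra_simps)
    moreover have "0 < (of_nat (a k) - 1) * (M - 1/2)" using M ak by (intro mult_pos_pos) auto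
    ultimately show False by simp
  qed
  then have r: "0 \<le> q k" "q k \<le> 1" if "k \<in> V" for k
    using le[OF that] by (auto simp: abs_le_iff)
  have eq: "of_nat (a k) * q k = 1 - ov q (nx k)" if "k \<in> V" for k
    using q[OF that] by (simp add: symm_weights_def)
  have half: "q k \<le> 1/2" if kV: "k \<in> V" for k
  proof -
    have "0 \<le> ov q (nx k)" using r nx_pv[OF kV] by (cases "nx k") auto
    then have "of_nat (a k) * q k \<le> 1" using eq[OF kV] by simp
    moreover have "2 * q k \<le> of_nat (a k) * q k" using a_rat_ge2[OF kV] r[OF kV] by (intro mult_right_mono)
    ultimately show ?thesis by simp
  qed
  have "ov q (nx i) \<le> 1/2" using half nx_pv[OF i] by (cases "nx i") auto
  then have "0 < of_nat (a i) * q i" using eq[OF i] by simp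
  then show "0 < q i" using r(1)[OF i] by (cases "q i = 0") auto
  show "q i \<le> 1/2" by (rule half[OF i])
qed

text \<open>The weights solve a linear system with the invertible exponent matrix. The bound 1/2
  makes the fractional parts in the grading operator harmless.\<close>

lemma weights_wpoly:
  obtains "\<And>i. i \<in> V \<Longrightarrow> symm_weights (weights V (wpoly V)) i = 1"
    "\<And>i. i \<in> V \<Longrightarrow> 0 < weights V (wpoly V) i \<and> weights V (wpoly V) i \<le> 1/2"
    "\<And>i. i \<notin> V \<Longrightarrow> weights V (wpoly V) i = 0"
proof -
  have iff: "is_weights V (wpoly V) q \<longleftrightarrow> (\<forall>i\<in>V. 0 < q i) \<and> supp_in V q \<and> (\<forall>i\<in>V. symm_weights q i = 1)" for q
    unfolding is_weights_def supp_in_def keys_wpoly[OF order_refl] using sum_row[of _ q]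
    by (auto simp: mult.commute)
  obtain q :: "'v \<Rightarrow> rat" where q: "supp_in V q" "\<And>i. i \<in> V \<Longrightarrow> symm_weights q i = 1"
    using inv_struct.R_solvable[OF swap order_refl, of "\<lambda>_. 1"] symm_weights_swap by metis
  have isq: "is_weights V (wpoly V) q" using q weight_solution_range[OF q(2)] by (auto simp: iff)
  have "weights V (wpoly V) = q"
    unfolding weights_def
  proof (rule the_equality)
    show "is_weights V (wpoly V) q" by (rule isq)
    fix q' assume q': "is_weights V (wpoly V) q'"
    show "q' = q"
      by (rule inv_struct.R_inj[OF swap order_refl]) (use q q' in \<open>auto simp: iff symm_weights_swap[symmetric]\<close>)
  qed
  then show ?thesis using that[of] q weight_solution_range[OF q(2)] by (auto simp: supp_in_def)
qed

end

section \<open>The perfect pairing of the two symmetry groups\<close>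

context krawitz
begin

lemma pair_swap: "krawitz.pair V aT nxT \<rho> k h = pair h k"
proof -
  have "krawitz.pair V aT nxT \<rho> k h = (\<Sum>i\<in>V. k i * T.symm_weights h (\<rho> i))"
    by (rule krawitz.pair_def[OF krawitz_swap])
  also have "\<dots> = (\<Sum>j\<in>V. k (\<pi> j) * T.symm_weights h (\<rho> (\<pi> j)))"
    by (rule sum_pi[symmetric])
  finally show ?thesis by (simp add: pair_alt rho_pi)
qed

text \<open>A suitable vector of the inverse matrix, reduced modulo integers, is a symmetry on the
  transposed side and pairs with \<open>k\<close> to the single entry \<open>k i\<close>, modulo
  integers.\<close>

lemma pair_nondegenerate:
  assumes k: "k \<in> W.Gm" and 0: "\<And>h. h \<in> T.Gm \<Longrightarrow> pair h k \<in> \<int>"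
  shows "k = (\<lambda>_. 0)"
proof
  fix i show "k i = 0"
  proof (cases "i \<in> V")
    case True
    define j where "j = \<rho> i"
    have j: "j \<in> V" "\<pi> j = i" using True rho_V pi_rho by (auto simp: j_def)
    obtain y :: "'v \<Rightarrow> rat" where y: "\<And>l. l \<in> V \<Longrightarrow> T.symm_weights y l = (if l = j then 1 else 0)"
      using inv_struct.R_solvable[OF T.swap order_refl, of "\<lambda>l. if l = j then 1 else 0"] T.symm_weights_swap by metis
    define h where "h = (\<lambda>j. if j \<in> V then frac (y j) else 0)"
    have "h \<in> T.Gm" unfolding h_def by (rule T.Gm_frac) (simp add: y)
    then have hk: "pair h k \<in> \<int>" by (rule 0)
    have hyk: "pair h k - (pair y k + pair (\<lambda>_. 0) k) \<in> \<int>"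
      by (rule pair_add_left[OF k]) (simp add: h_def frac_minus_self_Ints)
    moreover have "pair (\<lambda>_. 0) k = 0" by (simp add: pair_def)
    moreover have "pair y k = k i"
    proof -
      have "pair y k = (\<Sum>l\<in>V. if l = j then k (\<pi> l) else 0)"
        unfolding pair_alt by (rule sum.cong) (auto simp: y)
      then show ?thesis using j W.finite_V by simp
    qed
    ultimately have "k i \<in> \<int>" using Ints_diff[OF hk hyk] by simp
    then show ?thesis using k True Ints_frac_zero by (auto simp: W.Gm_def)
  qed (use k in \<open>simp add: W.Gm_def\<close>)
qed

definition ann :: "('v \<Rightarrow> rat) set \<Rightarrow> ('v \<Rightarrow> rat) set" where
  "ann G = {h \<in> T.Gm. \<forall>k\<in>G. pair h k \<in> \<int>}"

lemma cis_pair_mult: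
  "x - (y + z) \<in> \<int> \<Longrightarrow> cis (2 * pi * of_rat x) = cis (2 * pi * of_rat y) * cis (2 * pi * of_rat z)"
proof -
  assume *: "x - (y + z) \<in> \<int>"
  have "x = (x - (y + z)) + (y + z)" by simp
  then have "cis (2 * pi * of_rat x) = cis (2 * pi * of_rat (x - (y + z)) + (2 * pi * of_rat y + 2 * pi * of_rat z))"
    by (metis of_rat_add distrib_left)
  also have "\<dots> = cis (2 * pi * of_rat y) * cis (2 * pi * of_rat z)"
    unfolding cis_mult[symmetric] using cis_two_pi_Ints[OF *] by simp
  finally show ?thesis .
qed

text \<open>The character values of the pairing are summed over both groups in two orders: summing
  over \<open>h\<close> first leaves only \<open>k = 0\<close> by nondegeneracy, summing over
  \<open>k\<close> first leaves the \<open>h\<close> in \<open>ann G\<close>.\<close>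

lemma card_ann:
  assumes G: "subgroup G (QZ_group V)" and GW: "G \<subseteq> W.Gm"
  shows "card G * card (ann G) = card T.Gm"
proof -
  interpret QZ: group "QZ_group V" by (rule group_QZ)
  have finG: "finite G" using GW W.finite_Gm finite_subset by blast
  let ?x = "\<lambda>h k. cis (2 * pi * of_rat (pair h k))"
  have zero: "(\<lambda>_. 0) \<in> G" using subgroup.one_closed[OF G] by simp
  have "(\<Sum>k\<in>G. \<Sum>h\<in>T.Gm. ?x h k) = (\<Sum>k\<in>G. if k = (\<lambda>_. 0) then of_nat (card T.Gm) else 0)"
  proof (rule sum.cong[OF refl])
    fix k assume k: "k \<in> G"
    then have kW: "k \<in> W.Gm" using GW by blast
    have "(\<Sum>h\<in>T.Gm. ?x h k) = (if \<forall>h\<in>T.Gm. ?x h k = 1 then of_nat (card T.Gm) else 0)"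
    proof (rule QZ.character_sum[OF T.subgroup_Gm T.finite_Gm])
      fix g h assume "g \<in> T.Gm" "h \<in> T.Gm"
      show "?x (g \<otimes>\<^bsub>QZ_group V\<^esub> h) k = ?x g k * ?x h k"
        by (rule cis_pair_mult, rule pair_add_left[OF kW]) (simp add: frac_minus_self_Ints)
    qed
    moreover have "(\<forall>h\<in>T.Gm. ?x h k = 1) \<longleftrightarrow> k = (\<lambda>_. 0)"
    proof
      assume "\<forall>h\<in>T.Gm. ?x h k = 1"
      then show "k = (\<lambda>_. 0)" using pair_nondegenerate[OF kW] by (auto simp: cis_two_pi_eq_1_iff)
    qed (simp add: pair_alt)
    ultimately show "(\<Sum>h\<in>T.Gm. ?x h k) = (if k = (\<lambda>_. 0) then of_nat (card T.Gm) else 0)" by simp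
  qed
  also have "\<dots> = of_nat (card T.Gm)" using finG zero by simp
  finally have 1: "(\<Sum>k\<in>G. \<Sum>h\<in>T.Gm. ?x h k) = of_nat (card T.Gm)" .
  have "(\<Sum>h\<in>T.Gm. \<Sum>k\<in>G. ?x h k) = (\<Sum>h\<in>T.Gm. if h \<in> ann G then of_nat (card G) else 0)"
  proof (rule sum.cong[OF refl])
    fix h assume h: "h \<in> T.Gm"
    have "(\<Sum>k\<in>G. ?x h k) = (if \<forall>k\<in>G. ?x h k = 1 then of_nat (card G) else 0)"
    proof (rule QZ.character_sum[OF G finG])
      fix k l assume "k \<in> G" "l \<in> G"
      show "?x h (k \<otimes>\<^bsub>QZ_group V\<^esub> l) = ?x h k * ?x h l"
        by (rule cis_pair_mult, rule pair_add_right[OF h]) (simp add: frac_minus_self_Ints)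
    qed
    then show "(\<Sum>k\<in>G. ?x h k) = (if h \<in> ann G then of_nat (card G) else 0)"
      using h by (simp add: ann_def cis_two_pi_eq_1_iff)
  qed
  also have "\<dots> = of_nat (card (ann G) * card G)"
    using T.finite_Gm by (simp add: sum.If_cases Int_absorb1 ann_def Int_def)
  finally have "(of_nat (card T.Gm) :: complex) = of_nat (card (ann G) * card G)"
    using 1 sum.swap[of "\<lambda>h k. ?x h k" G T.Gm] by simp
  then show ?thesis by (metis mult.commute of_nat_eq_iff)
qed

lemma subgroup_ann:
  assumes GW: "G \<subseteq> W.Gm" shows "subgroup (ann G) (QZ_group V)"
proof (rule group.subgroupI[OF group_QZ])
  show "ann G \<subseteq> carrier (QZ_group V)" using T.Gm_carrier by (auto simp: ann_def)
  have "(\<lambda>_. 0) \<in> ann G"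
    using subgroup.one_closed[OF T.subgroup_Gm] by (simp add: ann_def pair_def)
  then show "ann G \<noteq> {}" by blast
  fix h assume h: "h \<in> ann G"
  then have hT: "h \<in> T.Gm" by (simp add: ann_def)
  have hi: "inv\<^bsub>QZ_group V\<^esub> h = (\<lambda>j. frac (- h j))" using hT T.Gm_carrier by (intro inv_QZ) blast
  show "inv\<^bsub>QZ_group V\<^esub> h \<in> ann G"
    unfolding ann_def
  proof (intro CollectI conjI ballI)
    show "inv\<^bsub>QZ_group V\<^esub> h \<in> T.Gm" by (rule subgroup.m_inv_closed[OF T.subgroup_Gm hT])
    fix k assume k: "k \<in> G"
    then have kW: "k \<in> W.Gm" using GW by blast
    have "pair (\<lambda>_. 0) k - (pair (inv\<^bsub>QZ_group V\<^esub> h) k + pair h k) \<in> \<int>"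
      unfolding hi using frac_minus_self_Ints[of "- h _"]
      by (intro pair_add_left[OF kW]) (simp add: frac_def)
    moreover have hk: "pair h k \<in> \<int>" using h k by (auto simp: ann_def)
    moreover have "pair (\<lambda>_. 0) k = 0" by (simp add: pair_def)
    ultimately have "- (0 - (pair (inv\<^bsub>QZ_group V\<^esub> h) k + pair h k)) \<in> \<int>"
      by (metis Ints_minus)
    from Ints_diff[OF this hk] show "pair (inv\<^bsub>QZ_group V\<^esub> h) k \<in> \<int>" by simp
  qed
  fix l assume l: "l \<in> ann G"
  then have lT: "l \<in> T.Gm" by (simp add: ann_def)
  show "h \<otimes>\<^bsub>QZ_group V\<^esub> l \<in> ann G"
    unfolding ann_def
  proof (intro CollectI conjI ballI)
    show "h \<otimes>\<^bsub>QZ_group V\<^esub> l \<in> T.Gm" by (rule subgroup.m_closed[OF T.subgroup_Gm hT lT])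
    fix k assume k: "k \<in> G"
    then have kW: "k \<in> W.Gm" using GW by blast
    have "pair (h \<otimes>\<^bsub>QZ_group V\<^esub> l) k - (pair h k + pair l k) \<in> \<int>"
      by (rule pair_add_left[OF kW]) (simp add: frac_minus_self_Ints)
    moreover have "pair h k + pair l k \<in> \<int>" using h l k by (auto simp: ann_def)
    ultimately show "pair (h \<otimes>\<^bsub>QZ_group V\<^esub> l) k \<in> \<int>" by (metis Ints_add diff_add_cancel)
  qed
qed

text \<open>\<open>G\<close> lies in its double annihilator, and counting twice shows that the sizes
  agree. The count compares the two maximal groups, whose equal size comes from the trivial
  annihilator of \<open>W.Gm\<close>.\<close>

lemma double_annihilator:
  assumes G: "subgroup G (QZ_group V)" and GW: "G \<subseteq> W.Gm"
    and g: "g \<in> W.Gm" and 0: "\<And>h. h \<in> ann G \<Longrightarrow> pair h g \<in> \<int>"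
  shows "g \<in> G"
proof -
  interpret S: krawitz V aT nxT pvT cT a nx pv c \<rho> \<pi> by (rule krawitz_swap)
  define D where "D = {k \<in> W.Gm. \<forall>h\<in>ann G. pair h k \<in> \<int>}"
  have "D = S.ann (ann G)" by (simp add: D_def S.ann_def pair_swap)
  moreover have sub: "ann G \<subseteq> T.Gm" by (auto simp: ann_def)
  ultimately have "card (ann G) * card D = card W.Gm"
    using S.card_ann[OF subgroup_ann[OF GW] sub] by simp
  moreover have "card G * card (ann G) = card T.Gm" by (rule card_ann[OF G GW])
  moreover have "card W.Gm = card T.Gm"
  proof -
    have "h \<in> ann W.Gm \<longleftrightarrow> h = (\<lambda>_. 0)" for h
    proof
      assume h: "h \<in> ann W.Gm"
      show "h = (\<lambda>_. 0)"
        by (rule S.pair_nondegenerate) (use h in \<open>auto simp: ann_def pair_swap\<close>)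
    next
      assume "h = (\<lambda>_. 0)"
      then show "h \<in> ann W.Gm"
        using subgroup.one_closed[OF T.subgroup_Gm] by (simp add: ann_def pair_def)
    qed
    then have "ann W.Gm = {\<lambda>_. 0}" by blast
    then show ?thesis using card_ann[OF W.subgroup_Gm order_refl] by simp
  qed
  ultimately have "card (ann G) * card D = card (ann G) * card G" by (simp add: mult.commute)
  moreover have "card (ann G) \<noteq> 0"
    using subgroup.one_closed[OF subgroup_ann[OF GW]] finite_subset[OF sub T.finite_Gm] by auto
  ultimately have "card G = card D" by simp
  moreover have "G \<subseteq> D" using GW by (auto simp: D_def ann_def)
  moreover have "finite D" using W.finite_Gm by (simp add: D_def)
  ultimately have "G = D" using card_subset_eq[of D G] by simp
  moreover have "g \<in> D" using g 0 by (simp add: D_def)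
  ultimately show ?thesis by blast
qed

end

section \<open>Invertible polynomials are sums of chains and loops\<close>

definition mrow :: "('v \<Rightarrow> nat) \<Rightarrow> ('v \<Rightarrow> 'v option) \<Rightarrow> 'v \<Rightarrow> 'v exponent" where
  "mrow a nx i = mon i (a i) + (case nx i of None \<Rightarrow> 0 | Some j \<Rightarrow> mon j 1)"

lemma lookup_mrow: "lkp (mrow a nx i) j = (if j = i then a i else 0) + (if nx i = Some j then 1 else 0)"
  by (auto simp: mrow_def lookup_add lookup_single when_def split: option.splits)

lemma (in inv_struct) row_eq_mrow: "row = mrow a nx"
  by (simp add: row_def mrow_def fun_eq_iff)

lemma mpoly_eval_deriv:
  "mpoly_eval z (mpoly_deriv l W) = (\<Sum>m\<in>kys W. lkp W m * (of_nat (lkp m l) * mval z (m - mon l 1)))"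
  unfolding mpoly_eval_eq_mlin mpoly_deriv_eq_mterm mlin_mterm by (simp add: mlin_def)

lemma mval_eq_zero: "i \<in> kys m \<Longrightarrow> z i = 0 \<Longrightarrow> mval z m = 0"
  by (rule prod_zero) (auto simp: in_keys_iff)

lemma complex_root_exists:
  assumes "0 < n" obtains s where "s ^ n = (y::complex)"
proof -
  have "(rcis (root n (cmod y)) (Arg y / n)) ^ n = rcis (cmod y) (Arg y)"
    using assms by (simp add: DeMoivre2)
  then show ?thesis using that by (simp add: rcis_cmod_Arg)
qed

text \<open>A nonzero point on the \<open>j\<close>-axis near 0 is not critical, so there is a term
  \<open>z_j^n\<close> or \<open>z_j^n z_l\<close>, and the weights allow a choice with
  \<open>n \<ge> 2\<close>. As there are only as many terms as variables, these are all. Two terms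
  with the same second variable would produce nonzero critical points near 0.\<close>

lemma invertible_structure:
  fixes W f :: "'v mpoly"
  assumes inv: "invertible_poly V W" and cy: "calabi_yau V W" and x: "x \<in> V"
    and Wf: "W = mpoly_square x + f" and f: "mpoly_vars f \<subseteq> V - {x}"
  obtains a nx pv c where "inv_struct V a nx pv c" "W = (\<Sum>i\<in>V. mon (mrow a nx i) (c i))"
    "a x = 2" "nx x = None" "pv x = None"
proof -
  have finV: "finite V" and WV: "\<And>m. m \<in> kys W \<Longrightarrow> kys m \<subseteq> V"
    and iso: "isolated_singularity_at_origin V W" and ex1: "\<exists>!q. is_weights V W q"
    and card: "card (kys W) = card V"
    using inv by (auto simp: invertible_poly_def nondegenerate_def carrier_mpoly_ring)
  define q where "q = weights V W"
  have isq: "is_weights V W q" unfolding q_def weights_def by (rule theI'[OF ex1])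
  have qpos: "0 < q j" if "j \<in> V" for j using isq that by (simp add: is_weights_def)
  have qm: "(\<Sum>j\<in>V. q j * of_nat (lkp m j)) = 1" if "m \<in> kys W" for m
    using isq that by (simp add: is_weights_def)
  have qsum: "(\<Sum>j\<in>V. q j) = 1" using cy by (simp add: calabi_yau_def q_def)
  have fx: "m \<in> kys f \<Longrightarrow> lkp m x = 0" for m
    using f unfolding mpoly_vars_subset_iff by (metis Diff_iff insertI1 in_keys_iff subsetD)
  have "lkp f (mon x 2) = 0" using fx[of "mon x 2"] by (auto simp: in_keys_iff)
  then have keyx: "mon x 2 \<in> kys W"
    by (simp add: in_keys_iff Wf lookup_add mpoly_square_def)
  have other: "lkp m x = 0" if "m \<in> kys W" "m \<noteq> mon x 2" for m
  proof (rule fx)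
    show "m \<in> kys f" using that by (auto simp: in_keys_iff Wf lookup_add mpoly_square_def lookup_single when_def)
  qed
  have q_single: "(\<Sum>j\<in>V. q j * of_nat (lkp (mon l n) j)) = q l * of_nat n" if "l \<in> V" for l n
  proof -
    have "(\<Sum>j\<in>V. q j * of_nat (lkp (mon l n) j)) = (\<Sum>j\<in>V. if j = l then q l * of_nat n else 0)"
      by (rule sum.cong) (auto simp: lookup_single when_def)
    then show ?thesis using finV that by simp
  qed
  have qx: "q x = 1/2" using qm[OF keyx] q_single[OF x, of 2] by simp
  \<comment> \<open>The square takes weight 1/2 of the total 1, so the remaining variables share the
    other half.\<close>
  have two: "q j + q l \<le> 1/2" if "j \<in> V" "l \<in> V" "j \<noteq> l" "j \<noteq> x" "l \<noteq> x" for j l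
  proof -
    have "(\<Sum>i\<in>{x, j, l}. q i) \<le> (\<Sum>i\<in>V. q i)"
      by (rule sum_mono2[OF finV]) (use that x qpos in \<open>auto simp: less_imp_le\<close>)
    then show ?thesis using that qx qsum by simp
  qed
  have one: "q j \<le> 1/2" if "j \<in> V" "j \<noteq> x" for j
  proof -
    have "(\<Sum>i\<in>{x, j}. q i) \<le> (\<Sum>i\<in>V. q i)"
      by (rule sum_mono2[OF finV]) (use that x qpos in \<open>auto simp: less_imp_le\<close>)
    then show ?thesis using that qx qsum by simp
  qed
  have nolin: "mon l 1 \<notin> kys W" for l
  proof
    assume l: "mon l 1 \<in> kys W"
    then have lV: "l \<in> V" using WV[OF l] by simp
    have "mon l (1::nat) \<noteq> mon x 2"
    proof
      assume "mon l (1::nat) = mon x 2"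
      then have "lkp (mon l (1::nat)) x = lkp (mon x 2) x" by simp
      then show False by (simp add: lookup_single when_def split: if_splits)
    qed
    then have "lkp (mon l (1::nat)) x = 0" by (rule other[OF l])
    then have "l \<noteq> x" by (auto simp: lookup_single when_def)
    moreover have "q l = 1" using qm[OF l] q_single[OF lV, of 1] by simp
    ultimately show False using one[OF lV] by simp
  qed
  obtain \<epsilon> where \<epsilon>: "0 < \<epsilon>"
    and iso': "\<And>z. (\<forall>j\<in>V. cmod (z j) < \<epsilon>) \<Longrightarrow> critical_point V W z \<Longrightarrow> (\<forall>j\<in>V. z j = 0)"
    using iso by (auto simp: isolated_singularity_at_origin_def)
  have form: "\<exists>nk. 2 \<le> fst nk \<and> (\<forall>l. snd nk = Some l \<longrightarrow> l \<in> V \<and> l \<noteq> j) \<and>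
      mon j (fst nk) + (case snd nk of None \<Rightarrow> 0 | Some l \<Rightarrow> mon l 1) \<in> kys W" if j: "j \<in> V" for j
  proof (rule ccontr)
    assume no: "\<not> ?thesis"
    have noN: "mon j n \<notin> kys W" if n: "2 \<le> n" for n
    proof
      assume k: "mon j n \<in> kys W"
      show False
        by (rule no[THEN notE], rule exI[of _ "(n, None)"]) (use n k in simp)
    qed
    have noS: "mon j n + mon l 1 \<notin> kys W" if n: "2 \<le> n" "l \<in> V" "l \<noteq> j" for n l
    proof
      assume k: "mon j n + mon l 1 \<in> kys W"
      show False
        by (rule no[THEN notE], rule exI[of _ "(n, Some l)"]) (use n k in simp)
    qed
    define z :: "'v \<Rightarrow> complex" where "z i = (if i = j then of_real (\<epsilon> / 2) else 0)" for i
    have "critical_point V W z"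
      unfolding critical_point_def mpoly_eval_deriv
    proof (intro ballI sum.neutral)
      fix l m assume l: "l \<in> V" and m: "m \<in> kys W"
      have "of_nat (lkp m l) * mval z (m - mon l 1) = 0"
      proof (rule ccontr)
        assume nz: "of_nat (lkp m l) * mval z (m - mon l 1) \<noteq> 0"
        then have ml: "lkp m l \<noteq> 0" by auto
        have sub: "i = j" if "i \<in> kys (m - mon l 1)" for i
        proof (rule ccontr)
          assume "i \<noteq> j"
          then have "mval z (m - mon l 1) = 0" by (intro mval_eq_zero[OF that]) (simp add: z_def)
          then show False using nz by simp
        qed
        define n where "n = lkp (m - mon l 1) j"
        have "m - mon l 1 = mon j n"
          by (rule poly_mapping_eqI) (use sub in \<open>auto simp: n_def lookup_single when_def in_keys_iff\<close>)
        moreover have "m = (m - mon l 1) + mon l 1"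
          by (rule poly_mapping_eqI) (use ml in \<open>auto simp: lookup_add lookup_minus lookup_single when_def\<close>)
        ultimately have mm: "m = mon j n + mon l 1" by simp
        show False
        proof (cases "l = j")
          case True
          then have "m = mon j (n + 1)" using mm by (simp only: single_add)
          then show False using noN[of "n + 1"] nolin[of j] m by (cases "n = 0") auto
        next
          case False
          consider "n = 0" | "n = 1" | "2 \<le> n" by linarith
          then show False
          proof cases
            case 1 then show False using mm m nolin[of l] by simp
          next
            case 3 then show False using noS[OF _ l False] mm m by blast
          next
            case 2
            have mj: "lkp m j = 1" "lkp m l = 1" using mm 2 False by (auto simp: lookup_add lookup_single when_def)
            have "m \<noteq> mon x 2" using mj False by (auto simp: lookup_single when_def split: if_splits)
            then have "lkp m x = 0" by (rule other[OF m])
            then have "j \<noteq> x" "l \<noteq> x" using mj by auto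
            then have "q j + q l \<le> 1/2" using two[OF j l] False by simp
            moreover have "q j + q l = 1"
              using qm[OF m] q_single[OF j, of 1] q_single[OF l, of 1]
              unfolding mm 2 lookup_add by (simp add: distrib_left sum.distrib)
            ultimately show False by simp
          qed
        qed
      qed
      then show "lkp W m * (of_nat (lkp m l) * mval z (m - mon l 1)) = 0" by simp
    qed
    moreover have "\<forall>i\<in>V. cmod (z i) < \<epsilon>" using \<epsilon> by (simp add: z_def)
    ultimately have "z j = 0" using iso' j by blast
    then show False using \<epsilon> by (simp add: z_def)
  qed
  obtain F where F: "\<And>j. j \<in> V \<Longrightarrow> 2 \<le> fst (F j) \<and> (\<forall>l. snd (F j) = Some l \<longrightarrow> l \<in> V \<and> l \<noteq> j) \<and>
      mon j (fst (F j)) + (case snd (F j) of None \<Rightarrow> 0 | Some l \<Rightarrow> mon l 1) \<in> kys W"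
    using form by metis
  define a where "a j = fst (F j)" for j
  define nx where "nx j = snd (F j)" for j
  have a2: "2 \<le> a j" if "j \<in> V" for j using F[OF that] by (simp add: a_def)
  have nxV: "l \<in> V \<and> l \<noteq> j" if "j \<in> V" "nx j = Some l" for j l using F[OF that(1)] that(2) by (simp add: nx_def)
  have rowk: "mrow a nx j \<in> kys W" if "j \<in> V" for j using F[OF that] by (simp add: mrow_def a_def nx_def)
  have inj: "inj_on (mrow a nx) V"
  proof (rule inj_onI)
    fix i j assume i: "i \<in> V" and j: "j \<in> V" and eq: "mrow a nx i = mrow a nx j"
    show "i = j"
    proof (rule ccontr)
      assume "i \<noteq> j"
      then have "lkp (mrow a nx j) i \<le> 1" by (simp add: lookup_mrow)
      moreover have "2 \<le> lkp (mrow a nx i) i" using a2[OF i] by (simp add: lookup_mrow)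
      ultimately show False using eq by simp
    qed
  qed
  have keysW: "kys W = mrow a nx ` V"
  proof -
    have "mrow a nx ` V \<subseteq> kys W" using rowk by blast
    moreover have "card (mrow a nx ` V) = card (kys W)" using card_image[OF inj] card by simp
    ultimately show ?thesis using card_subset_eq[of "kys W" "mrow a nx ` V"] by simp
  qed
  define c where "c i = lkp W (mrow a nx i)" for i
  have c0: "c i \<noteq> 0" if "i \<in> V" for i using rowk[OF that] by (simp add: c_def in_keys_iff)
  have rowx: "mrow a nx x = mon x 2"
    using other[OF rowk[OF x]] a2[OF x] by (auto simp: lookup_mrow)
  have nxx: "nx x = None"
  proof (rule ccontr)
    assume "nx x \<noteq> None"
    then obtain l where l: "nx x = Some l" by blast
    then have "l \<noteq> x" using nxV[OF x] by blast
    have "lkp (mrow a nx x) l \<noteq> 0" using l by (simp add: lookup_mrow)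
    then show False using \<open>l \<noteq> x\<close> by (simp add: rowx lookup_single when_def)
  qed
  have ax: "a x = 2"
  proof -
    have "lkp (mrow a nx x) x = 2" by (simp add: rowx)
    then show ?thesis using nxx by (simp add: lookup_mrow)
  qed
  have nox: "nx i \<noteq> Some x" if i: "i \<in> V" for i
  proof
    assume nx: "nx i = Some x"
    then have "lkp (mrow a nx i) x \<noteq> 0" by (simp add: lookup_mrow)
    then have "mrow a nx i = mrow a nx x" using other[OF rowk[OF i]] rowx by metis
    then have "i = x" using inj_onD[OF inj _ i x] by blast
    then show False using nx nxx by simp
  qed
  \<comment> \<open>On the plane of \<open>z_i\<close> and \<open>z_j\<close> every derivative
    vanishes except the one by \<open>z_k\<close>, which is
    \<open>c_i z_i^(a i) + c_j z_j^(a j)\<close> and has nonzero zeros arbitrarily near 0.\<close>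
  have nxinj: "i = j" if i: "i \<in> V" and j: "j \<in> V" and nxi: "nx i = Some k" and nxj: "nx j = Some k" for i j k
  proof (rule ccontr)
    assume ij: "i \<noteq> j"
    have kV: "k \<in> V" "k \<noteq> i" "k \<noteq> j" using nxV[OF i nxi] nxV[OF j nxj] by auto
    define K where "K = cmod (c j / c i)"
    \<comment> \<open>\<open>t \<le> 1\<close> gives \<open>t ^ a j \<le> t\<close>, and the last
      bound keeps \<open>K * t\<close>, hence \<open>cmod s ^ a i\<close>, below
      \<open>\<epsilon> ^ a i\<close>; adding 1 to \<open>K\<close> avoids a division by 0.\<close>
    define t where "t = min (min (\<epsilon> / 2) 1) (\<epsilon> ^ a i / (2 * (K + 1)))"
    have K0: "0 \<le> K" by (simp add: K_def)
    have t: "0 < t" "t < \<epsilon>" "t \<le> 1" "t \<le> \<epsilon> ^ a i / (2 * (K + 1))"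
    proof -
      have "0 < \<epsilon> ^ a i / (2 * (K + 1))" using \<epsilon> K0 by simp
      then show "0 < t" using \<epsilon> by (simp only: t_def min_less_iff_conj) simp
      have "t \<le> \<epsilon> / 2" unfolding t_def by (simp only: min.coboundedI1 min.cobounded1)
      then show "t < \<epsilon>" using \<epsilon> by linarith
      show "t \<le> 1" unfolding t_def by (simp only: min.coboundedI1 min.cobounded2)
      show "t \<le> \<epsilon> ^ a i / (2 * (K + 1))" unfolding t_def by (rule min.cobounded2)
    qed
    have aj: "0 < a j" "0 < a i" using a2[OF j] a2[OF i] by auto
    obtain s where s: "s ^ a i = - (c j * of_real t ^ a j / c i)"
      using complex_root_exists[OF aj(2)] by blast
    have "cmod s ^ a i = K * t ^ a j"
    proof -
      have "cmod s ^ a i = cmod (s ^ a i)" by (simp add: norm_power)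
      also have "\<dots> = K * t ^ a j" unfolding s K_def using t(1) by (simp add: norm_mult norm_divide norm_power)
      finally show ?thesis .
    qed
    also have "\<dots> \<le> K * t"
      using t K0 power_decreasing[of 1 "a j" t] aj by (intro mult_left_mono) auto
    also have "\<dots> \<le> K * (\<epsilon> ^ a i / (2 * (K + 1)))" using t(4) K0 by (intro mult_left_mono)
    also have "\<dots> < \<epsilon> ^ a i"
    proof -
      have "K / (2 * (K + 1)) < 1" using K0 by (simp add: divide_less_eq)
      then have "K / (2 * (K + 1)) * \<epsilon> ^ a i < 1 * \<epsilon> ^ a i" using \<epsilon> by (intro mult_strict_right_mono) auto
      then show ?thesis by simp
    qed
    finally have "cmod s < \<epsilon>" using \<epsilon> by (meson less_imp_le power_less_imp_less_base)
    define z :: "'v \<Rightarrow> complex" where "z p = (if p = i then s else if p = j then of_real t else 0)" for p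
    have small: "\<forall>p\<in>V. cmod (z p) < \<epsilon>" using \<open>cmod s < \<epsilon>\<close> t \<epsilon> by (simp add: z_def)
    have "critical_point V W z"
      unfolding critical_point_def
    proof
      fix l assume l: "l \<in> V"
      let ?T = "\<lambda>p. c p * (of_nat (lkp (mrow a nx p) l) * mval z (mrow a nx p - mon l 1))"
      have ev: "mpoly_eval z (mpoly_deriv l W) = (\<Sum>p\<in>V. ?T p)"
        unfolding mpoly_eval_deriv keysW c_def using sum.reindex[OF inj] by simp
      have van: "?T p = 0" if p: "p \<in> V" and bad: "p \<notin> {i, j} \<or> l \<noteq> k" for p
      proof -
        have "\<exists>r. r \<in> kys (mrow a nx p - mon l 1) \<and> z r = 0"
        proof (cases "p \<in> {i, j}")
          case False
          have "p \<in> kys (mrow a nx p - mon l 1)"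
            using a2[OF p] by (auto simp: in_keys_iff lookup_minus lookup_mrow lookup_single when_def)
          then show ?thesis using False by (auto simp: z_def)
        next
          case True
          then have "k \<in> kys (mrow a nx p - mon l 1)"
            using nxi nxj bad by (auto simp: in_keys_iff lookup_minus lookup_mrow lookup_single when_def)
          then show ?thesis using kV by (auto simp: z_def)
        qed
        then obtain r where r: "r \<in> kys (mrow a nx p - mon l 1)" "z r = 0" by blast
        have "mval z (mrow a nx p - mon l 1) = 0" using r by (rule mval_eq_zero)
        then show ?thesis by simp
      qed
      show "mpoly_eval z (mpoly_deriv l W) = 0"
      proof (cases "l = k")
        case False
        then show ?thesis unfolding ev using van by (intro sum.neutral) blast
      next
        case True
        have m: "mrow a nx p - mon k 1 = mon p (a p)" if "p \<in> {i, j}" for p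
          by (rule poly_mapping_eqI)
             (use that nxi nxj kV in \<open>auto simp: lookup_minus lookup_mrow lookup_single when_def\<close>)
        have mv: "mval z (mon p (a p)) = z p ^ a p" if "p \<in> {i, j}" for p
          using that aj by auto
        have lk: "lkp (mrow a nx p) k = 1" if "p \<in> {i, j}" for p
          using that nxi nxj kV by (auto simp: lookup_mrow)
        have "(\<Sum>p\<in>V. ?T p) = (\<Sum>p\<in>{i, j}. ?T p)"
          by (rule sum.mono_neutral_right[OF finV]) (use i j van in auto)
        also have "\<dots> = ?T i + ?T j" using ij by simp
        also have "?T i = c i * s ^ a i"
          unfolding True m[of i, simplified] using lk[of i] mv[of i] by (simp add: z_def m[of i, simplified])
        also have "?T j = c j * of_real t ^ a j"
          unfolding True using lk[of j] mv[of j] ij by (simp add: z_def m[of j, simplified])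
        also have "c i * s ^ a i + c j * of_real t ^ a j = 0"
          unfolding s using c0[OF i] by simp
        finally show ?thesis unfolding ev .
      qed
    qed
    then have "z j = 0" using iso'[OF small] j by blast
    then show False using t(1) ij by (simp add: z_def)
  qed
  define pv where "pv j = (if \<exists>i\<in>V. nx i = Some j then Some (SOME i. i \<in> V \<and> nx i = Some j) else None)" for j
  have pvI: "pv j = Some i" if "i \<in> V" "nx i = Some j" for i j
  proof -
    have "(SOME i. i \<in> V \<and> nx i = Some j) = i"
      by (rule some_equality) (use that nxinj in auto)
    then show ?thesis using that by (auto simp: pv_def)
  qed
  have pvD: "i \<in> V \<and> nx i = Some j" if p: "pv j = Some i" for i j
  proof -
    obtain k where k: "k \<in> V" "nx k = Some j" using p by (auto simp: pv_def split: if_splits)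
    then show ?thesis using pvI[OF k] p by simp
  qed
  show ?thesis
  proof (rule that)
    show "inv_struct V a nx pv c"
    proof unfold_locales
      show "j \<in> V \<and> j \<noteq> i \<and> pv j = Some i" if "i \<in> V" "nx i = Some j" for i j
        using nxV[OF that] pvI[OF that] by simp
      show "i \<in> V \<and> nx i = Some j" if "j \<in> V" "pv j = Some i" for i j
        using pvD[OF that(2)] by simp
    qed (use finV a2 c0 in auto)
    have "W = (\<Sum>m\<in>mrow a nx ` V. mon m (lkp W m))"
      using poly_mapping_sum_terms[of W] by (simp add: keysW)
    then show "W = (\<Sum>i\<in>V. mon (mrow a nx i) (c i))"
      by (simp add: sum.reindex[OF inj] c_def)
    show "pv x = None" using nox by (auto simp: pv_def)
  qed (use ax nxx in auto)
qed

lemma inv_struct_union: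
  assumes "inv_struct V1 a1 nx1 pv1 c1" "inv_struct V2 a2 nx2 pv2 c2" and disj: "V1 \<inter> V2 = {}"
  shows "inv_struct (V1 \<union> V2) (\<lambda>i. if i \<in> V1 then a1 i else a2 i) (\<lambda>i. if i \<in> V1 then nx1 i else nx2 i)
    (\<lambda>i. if i \<in> V1 then pv1 i else pv2 i) (\<lambda>i. if i \<in> V1 then c1 i else c2 i)"
proof -
  interpret A: inv_struct V1 a1 nx1 pv1 c1 by fact
  interpret B: inv_struct V2 a2 nx2 pv2 c2 by fact
  show ?thesis
  proof unfold_locales
    show "finite (V1 \<union> V2)" using A.finite_V B.finite_V by simp
    fix i assume i: "i \<in> V1 \<union> V2"
    show "2 \<le> (if i \<in> V1 then a1 i else a2 i)" using i A.a_ge2 B.a_ge2 by auto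
    show "(if i \<in> V1 then c1 i else c2 i) \<noteq> 0" using i A.c_nz B.c_nz by auto
    fix j
    show "(if i \<in> V1 then nx1 i else nx2 i) = Some j \<Longrightarrow>
        j \<in> V1 \<union> V2 \<and> j \<noteq> i \<and> (if j \<in> V1 then pv1 j else pv2 j) = Some i"
      using i A.nx_pv[of i j] B.nx_pv[of i j] disj by (auto split: if_splits)
    show "(if i \<in> V1 then pv1 i else pv2 i) = Some j \<Longrightarrow>
        j \<in> V1 \<union> V2 \<and> (if j \<in> V1 then nx1 j else nx2 j) = Some i"
      using i A.pv_nx[of i j] B.pv_nx[of i j] disj by (auto split: if_splits)
  qed
qed

section \<open>The mirror map\<close>

lemma Ints_diff_iff: "x - y \<in> \<int> \<Longrightarrow> x \<in> \<int> \<longleftrightarrow> (y::rat) \<in> \<int>"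
  using Ints_diff[of x "x - y"] Ints_add[of "x - y" y] by auto

lemma (in comm_group) generate_insert_involution:
  assumes H: "subgroup H G" and s: "s \<in> carrier G" "s \<otimes> s = \<one>"
  shows "generate G (insert s H) = H \<union> (\<lambda>h. h \<otimes> s) ` H"
proof
  have Hc: "h \<in> carrier G" if "h \<in> H" for h using subgroup.subset[OF H] that by blast
  have inv_s: "inv s = s" using s by (simp add: inv_equality)
  have "subgroup (H \<union> (\<lambda>h. h \<otimes> s) ` H) G"
  proof (rule subgroupI)
    show "H \<union> (\<lambda>h. h \<otimes> s) ` H \<subseteq> carrier G" using Hc s by auto
    show "H \<union> (\<lambda>h. h \<otimes> s) ` H \<noteq> {}" using subgroup.one_closed[OF H] by blast
    show "inv a \<in> H \<union> (\<lambda>h. h \<otimes> s) ` H" if "a \<in> H \<union> (\<lambda>h. h \<otimes> s) ` H" for a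
    proof -
      have "inv (h \<otimes> s) = inv h \<otimes> s" if "h \<in> H" for h
        using Hc[OF that] s by (simp add: inv_mult inv_s)
      then show ?thesis using that subgroup.m_inv_closed[OF H] by auto
    qed
    show "a \<otimes> b \<in> H \<union> (\<lambda>h. h \<otimes> s) ` H"
      if "a \<in> H \<union> (\<lambda>h. h \<otimes> s) ` H" "b \<in> H \<union> (\<lambda>h. h \<otimes> s) ` H" for a b
    proof -
      have 1: "h \<otimes> (k \<otimes> s) = (h \<otimes> k) \<otimes> s" "(h \<otimes> s) \<otimes> k = (h \<otimes> k) \<otimes> s" "(h \<otimes> s) \<otimes> (k \<otimes> s) = h \<otimes> k"
        if "h \<in> H" "k \<in> H" for h k
      proof -
        note c = Hc[OF that(1)] Hc[OF that(2)] s(1)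
        show "h \<otimes> (k \<otimes> s) = (h \<otimes> k) \<otimes> s" using c by (simp add: m_assoc)
        show "(h \<otimes> s) \<otimes> k = (h \<otimes> k) \<otimes> s" using c by (simp add: m_ac)
        have "(h \<otimes> s) \<otimes> (k \<otimes> s) = (h \<otimes> k) \<otimes> (s \<otimes> s)" using c by (simp add: m_ac)
        then show "(h \<otimes> s) \<otimes> (k \<otimes> s) = h \<otimes> k" using c s by simp
      qed
      show ?thesis using that 1 subgroup.m_closed[OF H] by auto
    qed
  qed
  moreover have "insert s H \<subseteq> H \<union> (\<lambda>h. h \<otimes> s) ` H"
    using subgroup.one_closed[OF H] s by (auto intro!: image_eqI[of s _ "\<one>"])
  ultimately show "generate G (insert s H) \<subseteq> H \<union> (\<lambda>h. h \<otimes> s) ` H"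
    by (rule generate_subgroup_incl[rotated])
  show "H \<union> (\<lambda>h. h \<otimes> s) ` H \<subseteq> generate G (insert s H)"
    by (auto intro: generate.intros)
qed

lemma comm_group_QZ: "comm_group (QZ_group V)"
  by (rule group.group_comm_groupI[OF group_QZ]) (simp add: add.commute)

context inv_struct
begin

lemma form_degree_eq:
  assumes p: "(g, e) \<in> PP" and nz: "inv_sub.phi a nx pv c (fixed_vars V g) e m \<noteq> 0"
  shows "form_degree V (wpoly V) m g = (\<Sum>i\<in>V. e i)"
proof -
  have g: "g \<in> Gm" using p by (simp add: PP_def)
  interpret S: inv_sub V a nx pv c "fixed_vars V g" by (rule inv_sub_fixed[OF g])
  have e: "e \<in> S.E" using p by (simp add: PP_def)
  obtain q where q: "q = weights V (wpoly V)" "\<And>i. i \<in> V \<Longrightarrow> symm_weights q i = 1"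
    using weights_wpoly by metis
  have "form_degree V (wpoly V) m g = (\<Sum>i\<in>fixed_vars V g. e i)"
    unfolding form_degree_def q(1)[symmetric]
    by (rule S.phi_degree[OF e nz]) (simp add: q(2) S.I_V)
  also have "\<dots> = (\<Sum>i\<in>V. e i)"
    by (rule sum.mono_neutral_left[OF finite_V S.I_sub]) (use S.E_supp[OF e] in auto)
  finally show ?thesis .
qed

lemma form_degree_mone:
  assumes p: "(g, e) \<in> PP"
  shows "form_degree V (wpoly V) (inv_sub.mone a pv (fixed_vars V g) e) g = (\<Sum>i\<in>V. e i)"
proof -
  have g: "g \<in> Gm" using p by (simp add: PP_def)
  interpret S: inv_sub V a nx pv c "fixed_vars V g" by (rule inv_sub_fixed[OF g])
  have e: "e \<in> S.E" using p by (simp add: PP_def)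
  show ?thesis by (rule form_degree_eq[OF p]) (simp add: S.phi_mone[OF e e])
qed

abbreviation "sector_char \<equiv> (\<lambda>g e h. cis (2 * pi * of_rat (\<Sum>i\<in>fixed_vars V g. R e i * h i)))"

text \<open>Asking that \<open>bd\<close> depends on the monomial only through its form degree
  covers the A-model and the B-model bidegree at once.\<close>

lemma milnor_coords_wpoly:
  assumes H: "H \<subseteq> Gm"
    and bd: "\<And>m m' g. form_degree V (wpoly V) m g = form_degree V (wpoly V) m' g \<Longrightarrow> bd m g = bd m' g"
  shows "milnor_coords V (wpoly V) H (\<lambda>g. inv_sub.E a nx pv (fixed_vars V g))
    (\<lambda>g. inv_sub.phi a nx pv c (fixed_vars V g)) (\<lambda>g. inv_sub.mone a pv (fixed_vars V g)) sector_char bd"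
proof (rule milnor_coords.intro)
  show "finite H" using finite_subset[OF H finite_Gm] .
  fix g assume "g \<in> H"
  then have g: "g \<in> Gm" using H by blast
  interpret S: inv_sub V a nx pv c "fixed_vars V g" by (rule inv_sub_fixed[OF g])
  show "finite S.E" by (rule S.finite_E)
  show "ideal S.Jac (mpoly_ring (fixed_vars V g))" by (rule S.Jac_ideal)
  show "S.Jac = {f \<in> carrier (mpoly_ring (fixed_vars V g)). \<forall>e\<in>S.E. mlin (S.phi e) f = 0}"
    by (rule S.Jac_eq)
  fix e assume e: "e \<in> S.E"
  show "kys (S.mone e) \<subseteq> fixed_vars V g" by (rule S.keys_mone)
  show "S.phi e (S.mone e') = (if e = e' then 1 else 0)" if "e' \<in> S.E" for e'
    by (rule S.phi_mone[OF e that])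
  show "mlin (S.phi e) (form_action (fixed_vars V g) h f) = sector_char g e h * mlin (S.phi e) f"
    if "h \<in> H" for h f
    by (rule S.phi_form_action[OF e]) (use that H S.I_V in \<open>auto simp: Gm_def\<close>)
  show "sector_char g e h \<noteq> 0" for h by simp
  have p: "(g, e) \<in> PP" using g e by (simp add: PP_def)
  show "bd m g = bd (S.mone e) g" if "S.phi e m \<noteq> 0" for m
    by (rule bd) (simp add: form_degree_eq[OF p that] form_degree_mone[OF p])
qed

lemma coords_P_iff:
  assumes "H \<subseteq> Gm"
  shows "(g, e) \<in> milnor_coords.P H (\<lambda>g. inv_sub.E a nx pv (fixed_vars V g)) sector_char \<longleftrightarrow>
    (g, e) \<in> PP \<and> g \<in> H \<and> (\<forall>h\<in>H. (\<Sum>i\<in>fixed_vars V g. R e i * h i) \<in> \<int>)"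
  using assms milnor_coords.P_def[OF milnor_coords_wpoly[OF assms, of "\<lambda>_ _. (0, 0)"]]
  by (auto simp: PP_def cis_two_pi_eq_1_iff)

lemma age_grading_op: "age V (grading_op V (wpoly V)) = (\<Sum>i\<in>V. weights V (wpoly V) i)"
proof -
  obtain q where q: "q = weights V (wpoly V)" "\<And>i. i \<in> V \<Longrightarrow> 0 < q i \<and> q i \<le> 1/2"
    using weights_wpoly by metis
  have "frac (q i) = q i" if "i \<in> V" for i using q(2)[OF that] by (intro frac_unit) auto
  then show ?thesis by (simp add: age_def grading_op_def q(1)[symmetric])
qed

text \<open>Without neighbours, integrality concerns \<open>2 * e x\<close> or
  \<open>2 * g x\<close> alone, and the entries 0 and 1 of \<open>e\<close> are excluded at a fixed
  variable because they require a neighbour.\<close>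

lemma quadratic_variable:
  assumes p: "(g, e) \<in> PP" and x: "x \<in> V" "a x = 2" "nx x = None" "pv x = None"
  shows "(g x = 0 \<and> e x = 1/2) \<or> (g x = 1/2 \<and> e x = 0)"
proof -
  note pr = PP_props[OF p]
  have half: "y = 1/2" if y: "2 * y \<in> \<int>" "0 < y" "y < 1" for y :: rat
    using Ints_less_imp_add1_le[of 0 "2 * y"] Ints_less_imp_add1_le[of "2 * y" 2] y by simp
  show ?thesis
  proof (cases "g x = 0")
    case True
    have "2 * e x \<in> \<int>" using pr(6)[OF x(1)] x by (simp add: R_def)
    moreover have "e x \<noteq> 0" using pr(9)[OF True x(1)] x by auto
    moreover have "e x \<noteq> 1" using pr(10)[OF True x(1)] x by auto
    ultimately show ?thesis using half[of "e x"] pr(4)[of x] True by auto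
  next
    case False
    have "2 * g x \<in> \<int>" using pr(8)[OF x(1)] x by (simp add: symm_weights_def)
    then show ?thesis using half[of "g x"] pr(5)[of x] pr(3)[of x] False by auto
  qed
qed

end

lemma sum_sigma_mult:
  assumes "finite V" "x0 \<in> V" "y0 \<in> V" "x0 \<noteq> y0"
  shows "(\<Sum>j\<in>V. sigma x0 y0 j * f j) = (f x0 + f y0) / 2"
proof -
  have "(\<Sum>j\<in>V. sigma x0 y0 j * f j) = (\<Sum>j\<in>V. (if j = x0 then f x0 / 2 else 0) + (if j = y0 then f y0 / 2 else 0))"
    by (rule sum.cong) (use assms in \<open>auto simp: sigma_def\<close>)
  then show ?thesis using assms by (simp add: sum.distrib add_divide_distrib)
qed

text \<open>The renaming fixes the isolated squares \<open>x0\<close> and \<open>y0\<close>, so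
  \<sigma> plays the same role on both sides. The last two assumptions separate \<open>G\<close> and
  \<open>ann G\<close> from their cosets by \<sigma>, so that flipped pairs can be
  recognised.\<close>

locale borcea_voisin = krawitz +
  fixes x0 y0 :: 'a and G :: "('a \<Rightarrow> rat) set"
  assumes x0: "x0 \<in> V" "a x0 = 2" "nx x0 = None" "pv x0 = None" "\<pi> x0 = x0"
    and y0: "y0 \<in> V" "a y0 = 2" "nx y0 = None" "pv y0 = None" "\<pi> y0 = y0"
    and x0_y0: "x0 \<noteq> y0"
    and G: "subgroup G (QZ_group V)" and G_W: "G \<subseteq> W.Gm"
    and sigma_G: "sigma x0 y0 \<notin> G" and sigma_ann: "sigma x0 y0 \<notin> ann G"
begin

abbreviation "sg \<equiv> sigma x0 y0"
abbreviation "SG \<equiv> Sigma_group V x0 y0 G"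
abbreviation "SGT \<equiv> Sigma_group V x0 y0 (ann G)"

lemma x0_T: "aT x0 = 2" "nxT x0 = None" "pvT x0 = None"
  using aT_eq[OF x0(1)] pv_pi[OF x0(1)] nx_pi[OF x0(1)] x0 by auto

lemma y0_T: "aT y0 = 2" "nxT y0 = None" "pvT y0 = None"
  using aT_eq[OF y0(1)] pv_pi[OF y0(1)] nx_pi[OF y0(1)] y0 by auto

lemma pi_eq: "j \<in> V \<Longrightarrow> \<pi> j = x0 \<longleftrightarrow> j = x0" "j \<in> V \<Longrightarrow> \<pi> j = y0 \<longleftrightarrow> j = y0"
  using rho_pi x0 y0 by metis+

lemmas sum_sigma = sum_sigma_mult[OF W.finite_V x0(1) y0(1) x0_y0]

text \<open>The exponent 2 of the squares cancels the 1/2 in \<sigma>.\<close>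

lemma pair_sigma_right: "pair h sg = h x0 + h y0"
proof -
  have "pair h sg = (\<Sum>j\<in>V. sg j * T.symm_weights h j)"
    unfolding pair_alt by (rule sum.cong) (auto simp: sigma_def pi_eq)
  then show ?thesis by (simp add: sum_sigma T.symm_weights_def x0_T y0_T)
qed

lemma pair_sigma_left: "pair sg g = g x0 + g y0"
  unfolding pair_def sum_sigma by (simp add: W.symm_weights_def x0 y0)

lemma sigma_carrier: "sg \<in> carrier (QZ_group V)"
  using x0 y0 by (auto simp: sigma_def)

lemma sigma_W: "sg \<in> W.Gm"
proof -
  have "W.symm_weights sg i \<in> \<int>" if i: "i \<in> V" for i
  proof -
    have "ov sg (nx i) = 0"
      using W.nx_pv[OF i] x0 y0 by (cases "nx i") (auto simp: sigma_def)
    then show ?thesis using x0 y0 by (auto simp: W.symm_weights_def sigma_def)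
  qed
  then show ?thesis using sigma_carrier by (simp add: W.Gm_def)
qed

lemma sigma_T: "sg \<in> T.Gm"
proof -
  have "T.symm_weights sg i \<in> \<int>" if i: "i \<in> V" for i
  proof -
    have "ov sg (nxT i) = 0"
      using T.nx_pv[OF i] x0_T y0_T by (cases "nxT i") (auto simp: sigma_def)
    then show ?thesis using x0_T y0_T by (auto simp: T.symm_weights_def sigma_def)
  qed
  then show ?thesis using sigma_carrier by (simp add: T.Gm_def)
qed

section \<open>Twisting by \<sigma> and flipping at the two squares\<close>

definition tw :: "('a \<Rightarrow> rat) \<Rightarrow> 'a \<Rightarrow> rat" where
  "tw k = (\<lambda>j. frac (k j + sg j))"

lemma tw_eq_mult: "tw k = k \<otimes>\<^bsub>QZ_group V\<^esub> sg"
  by (simp add: tw_def)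

lemma sigma_involution: "sg \<otimes>\<^bsub>QZ_group V\<^esub> sg = \<one>\<^bsub>QZ_group V\<^esub>"
  by (auto simp: sigma_def fun_eq_iff frac_def)

lemma tw_tw: "k \<in> carrier (QZ_group V) \<Longrightarrow> tw (tw k) = k"
proof -
  interpret QZ: comm_group "QZ_group V" by (rule comm_group_QZ)
  assume k: "k \<in> carrier (QZ_group V)"
  show ?thesis unfolding tw_eq_mult
    by (simp only: QZ.m_assoc[OF k sigma_carrier sigma_carrier] sigma_involution QZ.r_one[OF k])
qed

lemma Sigma_group_eq:
  assumes S: "subgroup S (QZ_group V)" shows "Sigma_group V x0 y0 S = S \<union> tw ` S"
  unfolding Sigma_group_def
    comm_group.generate_insert_involution[OF comm_group_QZ S sigma_carrier sigma_involution]
    tw_eq_mult[abs_def] ..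

lemma tw_notin:
  assumes S: "subgroup S (QZ_group V)" and "sg \<notin> S" "k \<in> S" shows "tw k \<notin> S"
proof
  interpret QZ: comm_group "QZ_group V" by (rule comm_group_QZ)
  assume "tw k \<in> S"
  then have "inv\<^bsub>QZ_group V\<^esub> k \<otimes>\<^bsub>QZ_group V\<^esub> (k \<otimes>\<^bsub>QZ_group V\<^esub> sg) \<in> S"
    unfolding tw_eq_mult
    using subgroup.m_closed[OF S subgroup.m_inv_closed[OF S assms(3)]] by blast
  moreover have kc: "k \<in> carrier (QZ_group V)" using subgroup.subset[OF S] assms(3) by blast
  have "inv\<^bsub>QZ_group V\<^esub> k \<otimes>\<^bsub>QZ_group V\<^esub> (k \<otimes>\<^bsub>QZ_group V\<^esub> sg) = sg"
    by (simp only: QZ.m_assoc[symmetric, OF QZ.inv_closed[OF kc] kc sigma_carrier]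
      QZ.l_inv[OF kc] QZ.l_one[OF sigma_carrier])
  ultimately show False using assms(2) by simp
qed

lemma in_Sigma_group_iff:
  assumes S: "subgroup S (QZ_group V)" and k: "k \<in> carrier (QZ_group V)"
  shows "k \<in> Sigma_group V x0 y0 S \<longleftrightarrow> k \<in> S \<or> tw k \<in> S"
proof -
  have "k \<in> tw ` S \<longleftrightarrow> tw k \<in> S"
  proof
    assume "k \<in> tw ` S"
    then obtain l where l: "l \<in> S" "k = tw l" by blast
    then have "tw k = l" using tw_tw subgroup.subset[OF S] by blast
    then show "tw k \<in> S" using l by simp
  next
    assume "tw k \<in> S"
    then show "k \<in> tw ` S" using tw_tw[OF k] by (metis imageI)
  qed
  then show ?thesis by (simp add: Sigma_group_eq[OF S])
qed

text \<open>Exchanges the two possibilities of \<open>quadratic_variable\<close> at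
  \<open>x0\<close> and at \<open>y0\<close>: fixed with \<open>e = 1/2\<close>, and moved with
  \<open>g = 1/2\<close>.\<close>

definition flip :: "('a \<Rightarrow> rat) \<times> ('a \<Rightarrow> rat) \<Rightarrow> ('a \<Rightarrow> rat) \<times> ('a \<Rightarrow> rat)" where
  "flip = (\<lambda>(g, e). (tw g, \<lambda>j. if j = x0 \<or> j = y0 then 1/2 - e j else e j))"

lemma fst_flip: "fst (flip p) = tw (fst p)"
  by (simp add: flip_def split_beta)

lemma PP_carrier: "p \<in> W.PP \<Longrightarrow> fst p \<in> carrier (QZ_group V)"
  using W.Gm_carrier by (cases p) (auto simp: W.PP_def)

lemma flip_flip: "p \<in> W.PP \<Longrightarrow> flip (flip p) = p"
  using tw_tw[OF PP_carrier, of p] by (cases p) (auto simp: flip_def fun_eq_iff)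

lemma tw_other:
  assumes "(g, e) \<in> W.PP" shows "tw g j = (if j = x0 \<or> j = y0 then 1/2 - g j else g j)"
proof (cases "j = x0 \<or> j = y0")
  case True
  then have v: "tw g j = frac (g j + 1/2)" by (auto simp: tw_def sigma_def)
  have "g j = 0 \<or> g j = 1/2"
    using W.quadratic_variable[OF assms x0(1-4)] W.quadratic_variable[OF assms y0(1-4)] True by auto
  then have "frac (g j + 1/2) = 1/2 - g j"
  proof
    assume z: "g j = 0"
    show ?thesis unfolding z using frac_unit[of "1/2"] by simp
  next
    assume h: "g j = 1/2"
    show ?thesis unfolding h by (simp add: frac_def)
  qed
  then show ?thesis using True v by simp
next
  case False
  then show ?thesis
    using frac_unit[of "g j"] W.PP_props(5)[OF assms, of j] by (simp add: tw_def sigma_def)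
qed

lemma flip_PP:
  assumes p: "p \<in> W.PP" shows "flip p \<in> W.PP"
proof -
  obtain g e where ge: "p = (g, e)" by (cases p)
  note p' = p[unfolded ge]
  note pr = W.PP_props[OF p']
  define e' where "e' j = (if j = x0 \<or> j = y0 then 1/2 - e j else e j)" for j
  have fl: "flip p = (tw g, e')" by (simp add: ge flip_def e'_def fun_eq_iff)
  note tg = tw_other[OF p']
  note qx = W.quadratic_variable[OF p' x0(1-4)] and qy = W.quadratic_variable[OF p' y0(1-4)]
  have g': "tw g \<in> W.Gm"
    unfolding tw_eq_mult by (rule subgroup.m_closed[OF W.subgroup_Gm pr(1) sigma_W])
  have Re: "W.R e' i = W.R e i" if "i \<in> V" "i \<noteq> x0" "i \<noteq> y0" for i
  proof -
    have "pv i \<noteq> Some x0" "pv i \<noteq> Some y0" using W.pv_nx[OF that(1)] x0 y0 by auto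
    then show ?thesis using that by (cases "pv i") (auto simp: W.R_def e'_def)
  qed
  have "(tw g, e') \<in> W.PP"
    unfolding W.PP_iff
  proof (intro conjI ballI impI g')
    show "supp_in (fixed_vars V (tw g)) e'"
      unfolding supp_in_def
    proof (intro allI impI)
      fix i assume i: "i \<notin> fixed_vars V (tw g)"
      show "e' i = 0"
      proof (cases "i = x0 \<or> i = y0")
        case True
        then have "tw g i \<noteq> 0" using i x0 y0 by (auto simp: fixed_vars_def)
        then show ?thesis using True qx qy tg[of i] by (auto simp: e'_def)
      next
        case False
        then show ?thesis using i tg[of i] pr(2)[of i] pr(3)[of i] by (auto simp: fixed_vars_def e'_def)
      qed
    qed
    fix i assume i: "i \<in> fixed_vars V (tw g)"
    have iV: "i \<in> V" "tw g i = 0" using i by (auto simp: fixed_vars_def)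
    show "0 \<le> e' i" "e' i \<le> 1"
      using pr(4)[of i] qx qy by (auto simp: e'_def)
    have special: "e' i = 1/2" if "i = x0 \<or> i = y0"
      using that iV(2) qx qy tg[of i] by (auto simp: e'_def)
    show "W.R e' i \<in> \<int>"
    proof (cases "i = x0 \<or> i = y0")
      case True
      then have "W.R e' i = 1" using special x0 y0 by (auto simp: W.R_def)
      then show ?thesis by simp
    next
      case False
      then show ?thesis using Re[OF iV(1)] pr(6)[OF iV(1)] by simp
    qed
    have gi: "g i = 0" if "\<not> (i = x0 \<or> i = y0)" using that iV(2) tg[of i] by simp
    show "\<exists>q. pv i = Some q \<and> e' q = 1" if z: "e' i = 0"
    proof -
      have ns: "\<not> (i = x0 \<or> i = y0)" using special z by auto
      then obtain q where q: "pv i = Some q" "e q = 1"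
        using pr(9)[OF gi iV(1)] z by (auto simp: e'_def)
      have "\<not> (q = x0 \<or> q = y0)" using q(2) qx qy by auto
      then show ?thesis using q by (auto simp: e'_def)
    qed
    show "\<exists>j. nx i = Some j \<and> e' j = 0" if z: "e' i = 1"
    proof -
      have ns: "\<not> (i = x0 \<or> i = y0)" using special z by auto
      then obtain j where j: "nx i = Some j" "e j = 0"
        using pr(10)[OF gi iV(1)] z by (auto simp: e'_def)
      have "\<not> (j = x0 \<or> j = y0)" using W.nx_pv[OF iV(1) j(1)] x0 y0 by auto
      then show ?thesis using j by (auto simp: e'_def)
    qed
  qed
  then show ?thesis by (simp add: fl)
qed

text \<open>For \<open>e\<close> equal to 0 or 1/2 the values \<open>1/2 - e\<close> and
  \<open>e + 1/2\<close> agree modulo integers, so a flip before dualising becomes a twist by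
  \<sigma> afterwards.\<close>

lemma kdual_flip:
  assumes p: "p \<in> W.PP" shows "fst (kdual V \<pi> (flip p)) = tw (fst (kdual V \<pi> p))"
proof -
  obtain g e where ge: "p = (g, e)" by (cases p)
  note p' = p[unfolded ge]
  note qx = W.quadratic_variable[OF p' x0(1-4)] and qy = W.quadratic_variable[OF p' y0(1-4)]
  have s: "sg (\<pi> j) = sg j" if "j \<in> V" for j using that pi_eq by (simp add: sigma_def)
  have "frac (if \<pi> j = x0 \<or> \<pi> j = y0 then 1/2 - e (\<pi> j) else e (\<pi> j)) = frac (frac (e (\<pi> j)) + sg (\<pi> j))" for j
  proof (cases "\<pi> j = x0 \<or> \<pi> j = y0")
    case True
    then have "e (\<pi> j) = 0 \<or> e (\<pi> j) = 1/2" using qx qy by auto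
    then have "frac (1/2 - e (\<pi> j)) = frac (frac (e (\<pi> j)) + 1/2)"
    proof
      assume z: "e (\<pi> j) = 0"
      show ?thesis unfolding z by simp
    next
      assume h: "e (\<pi> j) = 1/2"
      show ?thesis unfolding h by (simp add: frac_def)
    qed
    then show ?thesis using True by (auto simp: sigma_def)
  next
    case False
    have "frac (e (\<pi> j)) = frac (frac (e (\<pi> j)))"
      by (rule frac_eqI) (simp add: frac_def)
    then show ?thesis using False by (simp add: sigma_def)
  qed
  then show ?thesis
    using sigma_carrier by (auto simp: ge flip_def kdual_def tw_def fun_eq_iff s)
qed

text \<open>In both possibilities at \<open>x0\<close> and \<open>y0\<close> the summands of either
  identity equal 1/2, so each sum is unchanged entry by entry.\<close>

lemma flip_degree:
  assumes p: "(g, e) \<in> W.PP" and f: "flip (g, e) = (g', e')"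
  shows "(\<Sum>i\<in>V. e' i) + (\<Sum>i\<in>V. g' i) = (\<Sum>i\<in>V. e i) + (\<Sum>i\<in>V. g i)"
    and "of_nat (card (fixed_vars V g')) - (\<Sum>i\<in>V. e' i) + (\<Sum>i\<in>V. g' i) =
      (of_nat (card (fixed_vars V g)) - (\<Sum>i\<in>V. e i) + (\<Sum>i\<in>V. g i) :: rat)"
proof -
  note qx = W.quadratic_variable[OF p x0(1-4)] and qy = W.quadratic_variable[OF p y0(1-4)]
  have g': "g' j = (if j = x0 \<or> j = y0 then 1/2 - g j else g j)" for j
    using f tw_other[OF p, of j] by (auto simp: flip_def)
  have e': "e' j = (if j = x0 \<or> j = y0 then 1/2 - e j else e j)" for j
    using f by (auto simp: flip_def)
  have "e' i + g' i = e i + g i" for i using qx qy by (auto simp: e' g')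
  then show "(\<Sum>i\<in>V. e' i) + (\<Sum>i\<in>V. g' i) = (\<Sum>i\<in>V. e i) + (\<Sum>i\<in>V. g i)"
    unfolding sum.distrib[symmetric] by simp
  have card: "of_nat (card (fixed_vars V k)) = (\<Sum>i\<in>V. if k i = 0 then (1::rat) else 0)" for k :: "'a \<Rightarrow> rat"
    using W.finite_V by (simp add: sum.If_cases Int_def fixed_vars_def)
  have "(if g' i = 0 then 1 else 0) - e' i + g' i = (if g i = 0 then 1 else 0) - e i + g i" for i
    using qx qy by (auto simp: e' g')
  then show "of_nat (card (fixed_vars V g')) - (\<Sum>i\<in>V. e' i) + (\<Sum>i\<in>V. g' i) =
      (of_nat (card (fixed_vars V g)) - (\<Sum>i\<in>V. e i) + (\<Sum>i\<in>V. g i) :: rat)"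
    unfolding card sum.distrib[symmetric] sum_subtractf[symmetric] by simp
qed

lemma SG_sub: "SG \<subseteq> W.Gm"
proof -
  have "tw ` G \<subseteq> W.Gm"
    unfolding tw_eq_mult[abs_def] using subgroup.m_closed[OF W.subgroup_Gm _ sigma_W] G_W by blast
  then show ?thesis using G_W by (simp add: Sigma_group_eq[OF G])
qed

lemma subgroup_annG: "subgroup (ann G) (QZ_group V)"
  by (rule subgroup_ann[OF G_W])

lemma SGT_sub: "SGT \<subseteq> T.Gm"
proof -
  have "ann G \<subseteq> T.Gm" by (auto simp: ann_def)
  moreover from this have "tw ` ann G \<subseteq> T.Gm"
    unfolding tw_eq_mult[abs_def] using subgroup.m_closed[OF T.subgroup_Gm _ sigma_T] by blast
  ultimately show ?thesis by (simp add: Sigma_group_eq[OF subgroup_annG])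
qed

text \<open>The condition of invariance under \<sigma>: \<open>x0\<close> and \<open>y0\<close> are
  both fixed or both moved.\<close>

definition bal :: "('a \<Rightarrow> rat) \<times> ('a \<Rightarrow> rat) \<Rightarrow> bool" where
  "bal p \<longleftrightarrow> fst p x0 + fst p y0 \<in> \<int>"

lemma bal_flip: "p \<in> W.PP \<Longrightarrow> bal (flip p) \<longleftrightarrow> bal p"
proof -
  assume p: "p \<in> W.PP"
  obtain g e where ge: "p = (g, e)" by (cases p)
  have "tw g x0 + tw g y0 = 1 - (g x0 + g y0)"
    using tw_other[OF p[unfolded ge]] by simp
  moreover have "1 - (g x0 + g y0) \<in> \<int> \<longleftrightarrow> g x0 + g y0 \<in> \<int>"
    using Ints_diff[of 1 "g x0 + g y0"] Ints_diff[of 1 "1 - (g x0 + g y0)"] by auto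
  ultimately show ?thesis by (simp add: bal_def fst_flip ge)
qed

text \<open>As \<open>e = 1/2 - g\<close> at both variables, \<sigma> pairs with the dual sector to
  \<open>1 - (g x0 + g y0)\<close>.\<close>

lemma kdual_bal: "p \<in> W.PP \<Longrightarrow> pair (fst (kdual V \<pi> p)) sg \<in> \<int> \<longleftrightarrow> bal p"
proof -
  assume p: "p \<in> W.PP"
  obtain g e where ge: "p = (g, e)" by (cases p)
  note p' = p[unfolded ge]
  note qx = W.quadratic_variable[OF p' x0(1-4)] and qy = W.quadratic_variable[OF p' y0(1-4)]
  have "frac (e x0) = e x0" "frac (e y0) = e y0" using qx qy by (auto intro: frac_unit)
  then have "frac (e x0) = 1/2 - g x0" "frac (e y0) = 1/2 - g y0" using qx qy by auto
  then have "pair (fst (kdual V \<pi> p)) sg = 1 - (g x0 + g y0)"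
    by (simp add: pair_sigma_right ge kdual_def x0 y0)
  moreover have "1 - (g x0 + g y0) \<in> \<int> \<longleftrightarrow> g x0 + g y0 \<in> \<int>"
    using Ints_diff[of 1 "g x0 + g y0"] Ints_diff[of 1 "1 - (g x0 + g y0)"] by auto
  ultimately show ?thesis by (simp add: bal_def ge)
qed

text \<open>Invariance under \<open>SG\<close> splits into invariance under \<open>G\<close>,
  expressed by the dual sector, and invariance under \<sigma>. \<open>PB\<close> does the same on
  the transposed side, read off from the dual pair.\<close>

definition PA :: "(('a \<Rightarrow> rat) \<times> ('a \<Rightarrow> rat)) set" where
  "PA = {p \<in> W.PP. fst p \<in> SG \<and> fst (kdual V \<pi> p) \<in> ann G \<and> bal p}"

definition PB :: "(('a \<Rightarrow> rat) \<times> ('a \<Rightarrow> rat)) set" where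
  "PB = {p \<in> T.PP. fst p \<in> SGT \<and> fst (kdual V \<rho> p) \<in> G \<and> bal (kdual V \<rho> p)}"

definition beta :: "('a \<Rightarrow> rat) \<times> ('a \<Rightarrow> rat) \<Rightarrow> ('a \<Rightarrow> rat) \<times> ('a \<Rightarrow> rat)" where
  "beta p = kdual V \<pi> (if fst p \<in> G then p else flip p)"

lemma kdual_PP': "p \<in> W.PP \<Longrightarrow> kdual V \<pi> p \<in> T.PP"
  using kdual_PP by (cases p) auto

lemma kdual_inverse': "p \<in> W.PP \<Longrightarrow> kdual V \<rho> (kdual V \<pi> p) = p"
  using kdual_inverse by (cases p) auto

lemma kdual_swap: "p \<in> T.PP \<Longrightarrow> kdual V \<rho> p \<in> W.PP" "p \<in> T.PP \<Longrightarrow> kdual V \<pi> (kdual V \<rho> p) = p"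
  using krawitz.kdual_PP[OF krawitz_swap] krawitz.kdual_inverse[OF krawitz_swap] by (cases p; auto)+

text \<open>Exactly the pairs with sector in the coset \<open>\<sigma> G\<close> have to be flipped.\<close>

lemma bij_beta: "bij_betw beta PA PB"
proof (rule bij_betw_byWitness[where f' = "\<lambda>p. if fst p \<in> ann G then kdual V \<rho> p else flip (kdual V \<rho> p)"])
  have carT: "fst p \<in> carrier (QZ_group V)" if "p \<in> T.PP" for p
    using that T.Gm_carrier by (cases p) (auto simp: T.PP_def)
  have A: "beta p \<in> PB \<and> (if fst (beta p) \<in> ann G then kdual V \<rho> (beta p) else flip (kdual V \<rho> (beta p))) = p"
    if "p \<in> PA" for p
  proof -
    have p: "p \<in> W.PP" "fst p \<in> SG" "fst (kdual V \<pi> p) \<in> ann G" "bal p" using that by (auto simp: PA_def)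
    show ?thesis
    proof (cases "fst p \<in> G")
      case True
      have "beta p \<in> PB"
        using True p kdual_PP'[OF p(1)] kdual_inverse'[OF p(1)]
          in_Sigma_group_iff[OF subgroup_annG carT[OF kdual_PP'[OF p(1)]]]
        by (simp add: beta_def PB_def)
      then show ?thesis using True p kdual_inverse'[OF p(1)] by (simp add: beta_def)
    next
      case False
      have tG: "tw (fst p) \<in> G" using False p(2) in_Sigma_group_iff[OF G PP_carrier[OF p(1)]] by simp
      have fp: "flip p \<in> W.PP" by (rule flip_PP[OF p(1)])
      have h: "fst (kdual V \<pi> (flip p)) = tw (fst (kdual V \<pi> p))" by (rule kdual_flip[OF p(1)])
      \<comment> \<open>The inverse map detects a flip by a sector outside \<open>ann G\<close>;
        here it matters that \<sigma> is not in \<open>ann G\<close>.\<close>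
      have nh: "fst (kdual V \<pi> (flip p)) \<notin> ann G"
        unfolding h by (rule tw_notin[OF subgroup_annG sigma_ann p(3)])
      have "fst (kdual V \<pi> (flip p)) \<in> SGT"
        unfolding h Sigma_group_eq[OF subgroup_annG] using p(3) by blast
      then have "beta p \<in> PB"
        using False p fp tG kdual_PP'[OF fp] kdual_inverse'[OF fp] bal_flip[OF p(1)]
        by (simp add: beta_def PB_def fst_flip)
      then show ?thesis using False nh kdual_inverse'[OF fp] flip_flip[OF p(1)] by (simp add: beta_def)
    qed
  qed
  have B: "(if fst p \<in> ann G then kdual V \<rho> p else flip (kdual V \<rho> p)) \<in> PA \<and>
      beta (if fst p \<in> ann G then kdual V \<rho> p else flip (kdual V \<rho> p)) = p" if "p \<in> PB" for p
  proof -
    have p: "p \<in> T.PP" "fst p \<in> SGT" "fst (kdual V \<rho> p) \<in> G" "bal (kdual V \<rho> p)"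
      using that by (auto simp: PB_def)
    let ?q = "kdual V \<rho> p"
    have q: "?q \<in> W.PP" "kdual V \<pi> ?q = p" using kdual_swap[OF p(1)] by auto
    show ?thesis
    proof (cases "fst p \<in> ann G")
      case True
      then show ?thesis using p q
        by (simp add: PA_def beta_def in_Sigma_group_iff[OF G PP_carrier[OF q(1)]])
    next
      case False
      have th: "tw (fst p) \<in> ann G"
        using False p(2) in_Sigma_group_iff[OF subgroup_annG carT[OF p(1)]] by simp
      have fq: "flip ?q \<in> W.PP" by (rule flip_PP[OF q(1)])
      have nG: "fst (flip ?q) \<notin> G"
        unfolding fst_flip by (rule tw_notin[OF G sigma_G p(3)])
      have "fst (flip ?q) \<in> SG" unfolding fst_flip Sigma_group_eq[OF G] using p(3) by blast
      moreover have "fst (kdual V \<pi> (flip ?q)) \<in> ann G" using kdual_flip[OF q(1)] q(2) th by simp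
      ultimately have "flip ?q \<in> PA" using fq p(4) bal_flip[OF q(1)] by (simp add: PA_def)
      then show ?thesis using False nG flip_flip[OF q(1)] q(2) by (simp add: beta_def)
    qed
  qed
  show "\<forall>p\<in>PA. (if fst (beta p) \<in> ann G then kdual V \<rho> (beta p) else flip (kdual V \<rho> (beta p))) = p"
    using A by blast
  show "\<forall>p\<in>PB. beta (if fst p \<in> ann G then kdual V \<rho> p else flip (kdual V \<rho> p)) = p"
    using B by blast
  show "beta ` PA \<subseteq> PB" using A by blast
  show "(\<lambda>p. if fst p \<in> ann G then kdual V \<rho> p else flip (kdual V \<rho> p)) ` PB \<subseteq> PA"
    using B by blast
qed

lemma PA_eq: "milnor_coords.P SG (\<lambda>g. inv_sub.E a nx pv (fixed_vars V g)) W.sector_char = PA"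
proof -
  have "p \<in> milnor_coords.P SG (\<lambda>g. inv_sub.E a nx pv (fixed_vars V g)) W.sector_char \<longleftrightarrow> p \<in> PA" for p
  proof -
    obtain g e where ge: "p = (g, e)" by (cases p)
    obtain h d where hd: "kdual V \<pi> (g, e) = (h, d)" by (cases "kdual V \<pi> (g, e)")
    show ?thesis
    proof (cases "(g, e) \<in> W.PP")
      case True
      have hT: "h \<in> T.Gm" using kdual_PP[OF True] hd by (simp add: T.PP_def)
      have iff: "(\<Sum>i\<in>fixed_vars V g. W.R e i * k i) \<in> \<int> \<longleftrightarrow> pair h k \<in> \<int>" if "k \<in> W.Gm" for k
        by (rule Ints_diff_iff) (rule character_pair[OF True that hd])
      have tw: "pair h (tw k) \<in> \<int> \<longleftrightarrow> pair h k + pair h sg \<in> \<int>" for k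
        by (rule Ints_diff_iff, rule pair_add_right[OF hT]) (simp add: tw_def frac_minus_self_Ints)
      have zG: "(\<lambda>_. 0) \<in> G" using subgroup.one_closed[OF G] by simp
      have z: "pair h (\<lambda>_. 0) = 0" by (simp add: pair_alt)
      have "(\<forall>k\<in>SG. pair h k \<in> \<int>) \<longleftrightarrow> h \<in> ann G \<and> pair h sg \<in> \<int>"
      proof (intro iffI conjI)
        assume all: "\<forall>k\<in>SG. pair h k \<in> \<int>"
        then show "h \<in> ann G" using hT by (auto simp: ann_def Sigma_group_eq[OF G])
        have "tw (\<lambda>_. 0) \<in> SG" unfolding Sigma_group_eq[OF G] using zG by blast
        then show "pair h sg \<in> \<int>" using all tw[of "\<lambda>_. 0"] z by simp
      qed (auto simp: ann_def Sigma_group_eq[OF G] tw)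
      then show ?thesis
        using True iff SG_sub kdual_bal[OF True] unfolding ge
        by (auto simp: W.coords_P_iff[OF SG_sub] PA_def hd subset_iff)
    next
      case False
      then show ?thesis by (simp add: ge W.coords_P_iff[OF SG_sub] PA_def)
    qed
  qed
  then show ?thesis by blast
qed

text \<open>On this side invariance under \<open>ann G\<close> must be turned into membership in
  \<open>G\<close>, which is the double annihilator property.\<close>

lemma PB_eq: "milnor_coords.P SGT (\<lambda>g. inv_sub.E aT nxT pvT (fixed_vars V g)) T.sector_char = PB"
proof -
  interpret S: krawitz V aT nxT pvT cT a nx pv c \<rho> \<pi> by (rule krawitz_swap)
  have "p \<in> milnor_coords.P SGT (\<lambda>g. inv_sub.E aT nxT pvT (fixed_vars V g)) T.sector_char \<longleftrightarrow> p \<in> PB" for p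
  proof -
    obtain h d where hd: "p = (h, d)" by (cases p)
    obtain g e where ge: "kdual V \<rho> (h, d) = (g, e)" by (cases "kdual V \<rho> (h, d)")
    show ?thesis
    proof (cases "(h, d) \<in> T.PP")
      case True
      have gW: "g \<in> W.Gm" using S.kdual_PP[OF True] ge by (simp add: W.PP_def)
      have iff: "(\<Sum>i\<in>fixed_vars V h. T.R d i * k i) \<in> \<int> \<longleftrightarrow> pair k g \<in> \<int>" if "k \<in> T.Gm" for k
        unfolding pair_swap[symmetric]
        by (rule Ints_diff_iff) (rule S.character_pair[OF True that ge])
      have tw: "pair (tw k) g \<in> \<int> \<longleftrightarrow> pair k g + pair sg g \<in> \<int>" for k
        by (rule Ints_diff_iff, rule pair_add_left[OF gW]) (simp add: tw_def frac_minus_self_Ints)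
      have zG: "(\<lambda>_. 0) \<in> ann G" using subgroup.one_closed[OF subgroup_annG] by simp
      have z: "pair (\<lambda>_. 0) g = 0" by (simp add: pair_def)
      have "(\<forall>k\<in>SGT. pair k g \<in> \<int>) \<longleftrightarrow> (\<forall>k\<in>ann G. pair k g \<in> \<int>) \<and> pair sg g \<in> \<int>"
      proof (intro iffI conjI)
        assume all: "\<forall>k\<in>SGT. pair k g \<in> \<int>"
        then show "\<forall>k\<in>ann G. pair k g \<in> \<int>" by (auto simp: Sigma_group_eq[OF subgroup_annG])
        have "tw (\<lambda>_. 0) \<in> SGT" unfolding Sigma_group_eq[OF subgroup_annG] using zG by blast
        then show "pair sg g \<in> \<int>" using all tw[of "\<lambda>_. 0"] z by simp
      qed (auto simp: Sigma_group_eq[OF subgroup_annG] tw)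
      moreover have "(\<forall>k\<in>ann G. pair k g \<in> \<int>) \<longleftrightarrow> g \<in> G"
        using double_annihilator[OF G G_W gW] by (auto simp: ann_def)
      ultimately have "(\<forall>k\<in>SGT. pair k g \<in> \<int>) \<longleftrightarrow> g \<in> G \<and> g x0 + g y0 \<in> \<int>"
        by (simp add: pair_sigma_left)
      then show ?thesis
        using True iff SGT_sub unfolding hd
        by (auto simp: T.coords_P_iff[OF SGT_sub] PB_def ge bal_def subset_iff)
    next
      case False
      then show ?thesis by (simp add: hd T.coords_P_iff[OF SGT_sub] PB_def)
    qed
  qed
  then show ?thesis by blast
qed

text \<open>The pairing of the two weight vectors is the sum of either one, depending on which
  argument absorbs the matrix. It makes the shifts in the two bidegrees equal.\<close>

lemma sum_weights_eq: "(\<Sum>i\<in>V. weights V (W.wpoly V) i) = (\<Sum>i\<in>V. weights V (T.wpoly V) i)"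
proof -
  obtain q where q: "q = weights V (W.wpoly V)" "\<And>i. i \<in> V \<Longrightarrow> W.symm_weights q i = 1"
    using W.weights_wpoly by metis
  obtain r where r: "r = weights V (T.wpoly V)" "\<And>i. i \<in> V \<Longrightarrow> T.symm_weights r i = 1"
    using T.weights_wpoly by metis
  have "pair r q = (\<Sum>i\<in>V. r i)" unfolding pair_def using q(2) pi_V by simp
  moreover have "pair r q = (\<Sum>i\<in>V. q (\<pi> i))" unfolding pair_alt using r(2) by simp
  ultimately show ?thesis by (simp add: sum_pi q(1) r(1))
qed

lemma beta_bidegree:
  assumes p: "(g, e) \<in> PA" and b: "beta (g, e) = (h, d)"
  shows "A_bidegree V (W.wpoly V) (inv_sub.mone a pv (fixed_vars V g) e) g =
    B_bidegree V (T.wpoly V) (inv_sub.mone aT pvT (fixed_vars V h) d) h"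
proof -
  have pW: "(g, e) \<in> W.PP" using p by (simp add: PA_def)
  define g' where "g' = fst (if g \<in> G then (g, e) else flip (g, e))"
  define e' where "e' = snd (if g \<in> G then (g, e) else flip (g, e))"
  have pW': "(g', e') \<in> W.PP" using pW flip_PP[OF pW] by (auto simp: g'_def e'_def)
  have kd: "kdual V \<pi> (g', e') = (h, d)" using b by (simp add: beta_def g'_def e'_def)
  have hd: "(h, d) \<in> T.PP" using kdual_PP[OF pW'] kd by simp
  then have "h \<in> carrier (QZ_group V)" using T.Gm_carrier by (auto simp: T.PP_def)
  then have inv: "inv\<^bsub>QZ_group V\<^esub> h = (\<lambda>j. frac (- h j))" by (rule inv_QZ)
  have 1: "(\<Sum>i\<in>V. e' i) + (\<Sum>i\<in>V. g' i) = (\<Sum>i\<in>V. e i) + (\<Sum>i\<in>V. g i)"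
    and 2: "of_nat (card (fixed_vars V g')) - (\<Sum>i\<in>V. e' i) + (\<Sum>i\<in>V. g' i) =
      (of_nat (card (fixed_vars V g)) - (\<Sum>i\<in>V. e i) + (\<Sum>i\<in>V. g i) :: rat)"
    using flip_degree[OF pW, of g' e'] by (auto simp: g'_def e'_def)
  show ?thesis
    unfolding A_bidegree_def B_bidegree_def W.form_degree_mone[OF pW] T.form_degree_mone[OF hd]
      W.age_grading_op T.age_grading_op sum_weights_eq inv
    unfolding age_def using kdual_degree[OF pW' kd] 1 2 by simp
qed

theorem mirror_isomorphism:
  "\<exists>\<Phi>. linear_map (class_ring :: complex ring) (state_space V (W.wpoly V) SG) (state_space V (T.wpoly V) SGT) \<Phi> \<and>
     bij_betw \<Phi> (carrier (state_space V (W.wpoly V) SG)) (carrier (state_space V (T.wpoly V) SGT)) \<and>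
     (\<forall>d. \<Phi> ` homogeneous_part V (W.wpoly V) SG (A_bidegree V (W.wpoly V)) d =
       homogeneous_part V (T.wpoly V) SGT (B_bidegree V (T.wpoly V)) d)"
proof (rule state_space_isomorphism)
  show "milnor_coords V (W.wpoly V) SG (\<lambda>g. inv_sub.E a nx pv (fixed_vars V g))
    (\<lambda>g. inv_sub.phi a nx pv c (fixed_vars V g)) (\<lambda>g. inv_sub.mone a pv (fixed_vars V g)) W.sector_char (A_bidegree V (W.wpoly V))"
    by (rule W.milnor_coords_wpoly[OF SG_sub]) (simp add: A_bidegree_def)
  show "milnor_coords V (T.wpoly V) SGT (\<lambda>g. inv_sub.E aT nxT pvT (fixed_vars V g))
    (\<lambda>g. inv_sub.phi aT nxT pvT cT (fixed_vars V g)) (\<lambda>g. inv_sub.mone aT pvT (fixed_vars V g)) T.sector_char (B_bidegree V (T.wpoly V))"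
    by (rule T.milnor_coords_wpoly[OF SGT_sub]) (simp add: B_bidegree_def)
  show "bij_betw beta (milnor_coords.P SG (\<lambda>g. inv_sub.E a nx pv (fixed_vars V g)) W.sector_char)
     (milnor_coords.P SGT (\<lambda>g. inv_sub.E aT nxT pvT (fixed_vars V g)) T.sector_char)"
    unfolding PA_eq PB_eq by (rule bij_beta)
qed (simp add: PA_eq beta_bidegree)

end

section \<open>The theorem\<close>

text \<open>Here \<open>\<pi> i\<close> is the first variable of the row \<open>A i\<close>. Each
  column of the matrix is again of chain or loop form, since it has the same large entry and at most
  one further 1, coming from the predecessor.\<close>

lemma krawitz_transpose:
  fixes V :: "'v set" and A :: "'v \<Rightarrow> 'v exponent"
  assumes S: "inv_struct V a nx pv c" and A: "bij_betw A V (mrow a nx ` V)"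
  obtains aT nxT pvT \<pi> \<rho> where "krawitz V a nx pv c aT nxT pvT (\<lambda>_. 1) \<pi> \<rho>"
    "\<forall>i\<in>V. A i = mrow a nx (\<pi> i)" "transpose_poly V A = inv_struct.wpoly aT nxT (\<lambda>_. 1) V"
proof -
  interpret W: inv_struct V a nx pv c by (rule S)
  have Arow: "bij_betw A V (W.row ` V)" using A by (simp add: W.row_eq_mrow)
  define \<pi> where "\<pi> i = inv_into V W.row (A i)" for i
  have pV: "\<pi> i \<in> V" and Api: "W.row (\<pi> i) = A i" if "i \<in> V" for i
  proof -
    have "A i \<in> W.row ` V" using Arow that by (auto simp: bij_betw_def)
    then show "\<pi> i \<in> V" "W.row (\<pi> i) = A i" by (auto simp: \<pi>_def inv_into_into f_inv_into_f)
  qed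
  have bij: "bij_betw \<pi> V V"
  proof -
    have "bij_betw (inv_into V W.row) (W.row ` V) V"
      by (rule bij_betw_inv_into) (simp add: bij_betw_def W.row_inj)
    from bij_betw_trans[OF Arow this] show ?thesis by (simp add: \<pi>_def[abs_def] comp_def)
  qed
  define \<rho> where "\<rho> = inv_into V \<pi>"
  have rV: "\<rho> i \<in> V" and rp: "\<rho> (\<pi> i) = i" and pr: "\<pi> (\<rho> i) = i" if "i \<in> V" for i
    using bij that by (auto simp: \<rho>_def bij_betw_def inv_into_into f_inv_into_f)
  define aT where "aT i = a (\<pi> i)" for i
  define nxT where "nxT i = map_option \<rho> (pv (\<pi> i))" for i
  define pvT where "pvT i = map_option \<rho> (nx (\<pi> i))" for i
  have T: "inv_struct V aT nxT pvT (\<lambda>_. 1)"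
  proof unfold_locales
    show "finite V" by (rule W.finite_V)
    fix i assume i: "i \<in> V"
    show "2 \<le> aT i" using W.a_ge2[OF pV[OF i]] by (simp add: aT_def)
    show "j \<in> V \<and> j \<noteq> i \<and> pvT j = Some i" if j: "nxT i = Some j" for j
    proof -
      obtain p where p: "pv (\<pi> i) = Some p" "j = \<rho> p" using j by (auto simp: nxT_def)
      have "p \<in> V" "nx p = Some (\<pi> i)" using W.pv_nx[OF pV[OF i] p(1)] by auto
      moreover from this have "\<pi> i \<noteq> p" using W.nx_pv[of p "\<pi> i"] by auto
      ultimately show ?thesis using p rV pr rp[OF i] by (auto simp: pvT_def)
    qed
    show "j \<in> V \<and> nxT j = Some i" if j: "pvT i = Some j" for j
    proof -
      obtain p where p: "nx (\<pi> i) = Some p" "j = \<rho> p" using j by (auto simp: pvT_def)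
      have "p \<in> V" "pv p = Some (\<pi> i)" using W.nx_pv[OF pV[OF i] p(1)] by auto
      then show ?thesis using p rV pr rp[OF i] by (auto simp: nxT_def)
    qed
  qed simp
  interpret T: inv_struct V aT nxT pvT "\<lambda>_. 1" by (rule T)
  have K: "krawitz V a nx pv c aT nxT pvT (\<lambda>_. 1) \<pi> \<rho>"
  proof (intro krawitz.intro krawitz_axioms.intro S T)
    fix i assume i: "i \<in> V"
    show "pv (\<pi> i) = map_option \<pi> (nxT i)"
      using W.pv_nx[OF pV[OF i]] pr by (cases "pv (\<pi> i)") (auto simp: nxT_def)
    show "nx (\<pi> i) = map_option \<pi> (pvT i)"
      using W.nx_pv[OF pV[OF i]] pr by (cases "nx (\<pi> i)") (auto simp: pvT_def)
  qed (use pV rV rp pr in \<open>auto simp: aT_def\<close>)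
  interpret K: krawitz V a nx pv c aT nxT pvT "\<lambda>_. 1" \<pi> \<rho> by (rule K)
  have col: "(\<Sum>j\<in>V. mon j (lkp (A j) (\<pi> i))) = T.row i" if i: "i \<in> V" for i
  proof (rule poly_mapping_eqI)
    fix k
    have "lkp (\<Sum>j\<in>V. mon j (lkp (A j) (\<pi> i))) k = (if k \<in> V then lkp (A k) (\<pi> i) else 0)"
      using W.finite_V by (simp add: lookup_sum lookup_single when_def)
    also have "\<dots> = lkp (T.row i) k"
    proof (cases "k \<in> V")
      case True
      have "\<pi> i = \<pi> k \<longleftrightarrow> k = i" using rp i True by metis
      moreover have "nx (\<pi> k) = Some (\<pi> i) \<longleftrightarrow> nxT i = Some k"
        unfolding K.nx_pi[OF True] T.nx_iff_pv[OF i True]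
        using T.pv_nx[OF True] rp i by (cases "pvT k") (auto, metis)
      ultimately show ?thesis
        using True Api[OF True, symmetric] by (simp add: W.lookup_row T.lookup_row aT_def)
    next
      case False
      then show ?thesis using i T.nx_pv[OF i, of k] by (auto simp: T.lookup_row)
    qed
    finally show "lkp (\<Sum>j\<in>V. mon j (lkp (A j) (\<pi> i))) k = lkp (T.row i) k" .
  qed
  have "transpose_poly V A = (\<Sum>i\<in>V. mon (\<Sum>j\<in>V. mon j (lkp (A j) (\<pi> i))) 1)"
    unfolding transpose_poly_def by (rule sum.reindex_bij_betw[OF bij, symmetric])
  also have "\<dots> = T.wpoly V" unfolding T.wpoly_def by (rule sum.cong) (simp_all add: col)
  finally show ?thesis using that[OF K] Api by (simp add: W.row_eq_mrow)
qed

lemma restrict_Gm: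
  assumes A: "inv_struct V1 a1 nx1 pv1 c1" and V: "inv_struct V a nx pv c"
    and eq: "\<And>i. i \<in> V1 \<Longrightarrow> a i = a1 i \<and> nx i = nx1 i"
    and g: "g \<in> inv_struct.Gm V1 a1 nx1" and f: "\<And>i. i \<in> V1 \<Longrightarrow> f i = g i" and i: "i \<in> V1"
  shows "inv_struct.symm_weights a nx f i \<in> \<int>"
proof -
  interpret A: inv_struct V1 a1 nx1 pv1 c1 by (rule A)
  interpret V: inv_struct V a nx pv c by (rule V)
  have "V.symm_weights f i = A.symm_weights g i"
    using A.nx_pv[OF i] f i eq[OF i] by (cases "nx1 i") (auto simp: V.symm_weights_def A.symm_weights_def)
  then show ?thesis using g i by (simp add: A.Gm_def)
qed

theorem theorem1:
  fixes V1 V2 V :: "'v set" and x0 y0 :: 'v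
    and f1 f2 W1 W2 W WT :: "'v mpoly"
    and A :: "'v \<Rightarrow> 'v exponent"
    and G GT SG SGT :: "('v \<Rightarrow> rat) set"
  assumes "V1 \<inter> V2 = {}" and "V = V1 \<union> V2"
    and "x0 \<in> V1" and "y0 \<in> V2"
    and "mpoly_vars f1 \<subseteq> V1 - {x0}" and "mpoly_vars f2 \<subseteq> V2 - {y0}"
    and "W1 = mpoly_square x0 + f1" and "W2 = mpoly_square y0 + f2"
    and "invertible_poly V1 W1" and "invertible_poly V2 W2"
    and "calabi_yau V1 W1" and "calabi_yau V2 W2"
    and "W = W1 + W2"
    and "exponent_matrix V1 W1 A" and "exponent_matrix V2 W2 A"
    and "A x0 = Poly_Mapping.single x0 2" and "A y0 = Poly_Mapping.single y0 2"
    and "WT = transpose_poly V A"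
    and "subgroup G (QZ_group V)"
    and "group_prod (J_group V1 W1) (J_group V2 W2) \<subseteq> G"
    and "G \<subseteq> group_prod (SL_group V1 W1) (SL_group V2 W2)"
    and "GT = transpose_group V A G"
    and "SG = Sigma_group V x0 y0 G" and "SGT = Sigma_group V x0 y0 GT"
  shows "\<exists>\<Phi>. linear_map (class_ring :: complex ring) (state_space V W SG) (state_space V WT SGT) \<Phi> \<and>
           bij_betw \<Phi> (carrier (state_space V W SG)) (carrier (state_space V WT SGT)) \<and>
           (\<forall>d. \<Phi> ` homogeneous_part V W SG (A_bidegree V W) d =
                homogeneous_part V WT SGT (B_bidegree V WT) d)"
proof -
  note disj = assms(1) and V = assms(2)
  obtain a1 nx1 pv1 c1 where S1: "inv_struct V1 a1 nx1 pv1 c1"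
    and W1: "W1 = (\<Sum>i\<in>V1. mon (mrow a1 nx1 i) (c1 i))" "a1 x0 = 2" "nx1 x0 = None" "pv1 x0 = None"
    by (rule invertible_structure[OF assms(9,11,3,7,5)])
  obtain a2 nx2 pv2 c2 where S2: "inv_struct V2 a2 nx2 pv2 c2"
    and W2: "W2 = (\<Sum>i\<in>V2. mon (mrow a2 nx2 i) (c2 i))" "a2 y0 = 2" "nx2 y0 = None" "pv2 y0 = None"
    by (rule invertible_structure[OF assms(10,12,4,8,6)])
  interpret A1: inv_struct V1 a1 nx1 pv1 c1 by (rule S1)
  interpret A2: inv_struct V2 a2 nx2 pv2 c2 by (rule S2)
  have W1p: "W1 = A1.wpoly V1" and W2p: "W2 = A2.wpoly V2"
    by (simp_all add: W1(1) W2(1) A1.wpoly_def A2.wpoly_def A1.row_eq_mrow A2.row_eq_mrow)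
  define a where "a i = (if i \<in> V1 then a1 i else a2 i)" for i
  define nx where "nx i = (if i \<in> V1 then nx1 i else nx2 i)" for i
  define pv where "pv i = (if i \<in> V1 then pv1 i else pv2 i)" for i
  define c where "c i = (if i \<in> V1 then c1 i else c2 i)" for i
  have S: "inv_struct V a nx pv c"
    using inv_struct_union[OF S1 S2 disj] by (simp add: V a_def[abs_def] nx_def[abs_def] pv_def[abs_def] c_def[abs_def])
  interpret W: inv_struct V a nx pv c by (rule S)
  have in2: "i \<notin> V1" if "i \<in> V2" for i using that disj by blast
  have eq1: "a i = a1 i \<and> nx i = nx1 i" if "i \<in> V1" for i using that by (simp add: a_def nx_def)
  have eq2: "a i = a2 i \<and> nx i = nx2 i" if "i \<in> V2" for i using in2[OF that] by (simp add: a_def nx_def)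
  have row1: "mrow a nx i = mrow a1 nx1 i" if "i \<in> V1" for i using eq1[OF that] by (simp add: mrow_def)
  have row2: "mrow a nx i = mrow a2 nx2 i" if "i \<in> V2" for i using eq2[OF that] by (simp add: mrow_def)
  have Wp: "W = W.wpoly V"
  proof -
    have "W.wpoly V = (\<Sum>i\<in>V1. mon (mrow a nx i) (c i)) + (\<Sum>i\<in>V2. mon (mrow a nx i) (c i))"
      unfolding W.wpoly_def W.row_eq_mrow V
      by (rule sum.union_disjoint[OF A1.finite_V A2.finite_V disj])
    also have "\<dots> = W1 + W2"
      unfolding W1(1) W2(1) by (intro arg_cong2[where f = "(+)"] sum.cong refl) (auto simp: row1 row2 c_def in2)
    finally show ?thesis using assms(13) by simp
  qed
  have A: "bij_betw A V (mrow a nx ` V)"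
  proof -
    have k1: "kys W1 = mrow a nx ` V1" unfolding W1p using A1.keys_wpoly[of V1] by (simp add: A1.row_eq_mrow row1)
    have k2: "kys W2 = mrow a nx ` V2" unfolding W2p using A2.keys_wpoly[of V2] by (simp add: A2.row_eq_mrow row2)
    have "inj_on (mrow a nx) V" using W.row_inj by (simp add: W.row_eq_mrow)
    then have "mrow a nx ` V1 \<inter> mrow a nx ` V2 = {}"
      using inj_on_image_Int[of "mrow a nx" V V1 V2] V disj by simp
    moreover have "bij_betw A V1 (mrow a nx ` V1)" "bij_betw A V2 (mrow a nx ` V2)"
      using assms(14,15) by (simp_all add: exponent_matrix_def k1 k2)
    ultimately show ?thesis unfolding V image_Un by (intro bij_betw_combine)
  qed
  obtain aT nxT pvT \<pi> \<rho> where K: "krawitz V a nx pv c aT nxT pvT (\<lambda>_. 1) \<pi> \<rho>"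
    and "\<forall>i\<in>V. A i = mrow a nx (\<pi> i)"
    and WTp: "transpose_poly V A = inv_struct.wpoly aT nxT (\<lambda>_. 1) V"
    by (rule krawitz_transpose[OF S A])
  then have Api: "A i = mrow a nx (\<pi> i)" if "i \<in> V" for i using that by blast
  interpret K: krawitz V a nx pv c aT nxT pvT "\<lambda>_. 1" \<pi> \<rho> by (rule K)
  have xV: "x0 \<in> V" "y0 \<in> V" "x0 \<noteq> y0" "y0 \<notin> V1" using assms(3,4) V disj by auto
  have x0: "a x0 = 2" "nx x0 = None" "pv x0 = None"
    using W1 assms(3) by (simp_all add: a_def nx_def pv_def)
  have y0: "a y0 = 2" "nx y0 = None" "pv y0 = None"
    using W2 xV by (simp_all add: a_def nx_def pv_def)
  have rowx: "mrow a nx x0 = mon x0 2" and rowy: "mrow a nx y0 = mon y0 2"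
    using x0 y0 by (simp_all add: mrow_def)
  \<comment> \<open>\<open>A\<close> lists the rows of the two squares at \<open>x0\<close> and
    \<open>y0\<close> themselves, so the renaming fixes these variables.\<close>
  have fixpi: "\<pi> z = z" if "z \<in> V" "A z = mrow a nx z" for z
    using inj_onD[OF W.row_inj, of "\<pi> z" z] that Api[OF that(1)] K.pi_V[OF that(1)]
    by (simp add: W.row_eq_mrow)
  have px: "\<pi> x0 = x0" and py: "\<pi> y0 = y0"
    using fixpi xV assms(16,17) rowx rowy by auto
  have GE: "\<exists>g h. k = (\<lambda>j. g j + h j) \<and> g \<in> A1.Gm \<and> age V1 g \<in> \<int> \<and> h \<in> A2.Gm" if "k \<in> G" for k
    using assms(21) that unfolding group_prod_def SL_group_def W1p W2p A1.G_max_eq A2.G_max_eq by blast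
  have GW: "G \<subseteq> W.Gm"
  proof
    fix k assume "k \<in> G"
    then obtain g h where k: "k = (\<lambda>j. g j + h j)" "g \<in> A1.Gm" "h \<in> A2.Gm" using GE by blast
    have k1: "k j = g j" if "j \<in> V1" for j using that k disj by (auto simp: A2.Gm_def)
    have k2: "k j = h j" if "j \<in> V2" for j using that k in2 by (auto simp: A1.Gm_def)
    have "W.symm_weights k i \<in> \<int>" if "i \<in> V" for i
      using that restrict_Gm[OF S1 S eq1 k(2) k1] restrict_Gm[OF S2 S eq2 k(3) k2] by (auto simp: V)
    moreover have "0 \<le> k j \<and> k j < 1" if "j \<in> V" for j
      using that k1[of j] k2[of j] k(2,3) by (auto simp: V A1.Gm_def A2.Gm_def)
    moreover have "k j = 0" if "j \<notin> V" for j
      using that k by (auto simp: V A1.Gm_def A2.Gm_def)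
    ultimately show "k \<in> W.Gm" by (simp add: W.Gm_def)
  qed
  have half: "(1/2 :: rat) \<notin> \<int>" using Ints_frac_zero[of "1/2"] by auto
  \<comment> \<open>The part of \<sigma> on the variables of \<open>W1\<close> has age 1/2, which is
    excluded by the bound through \<open>SL_group V1 W1\<close>.\<close>
  have sG: "sigma x0 y0 \<notin> G"
  proof
    assume "sigma x0 y0 \<in> G"
    then obtain g h where k: "sigma x0 y0 = (\<lambda>j. g j + h j)" "age V1 g \<in> \<int>" "h \<in> A2.Gm" using GE by blast
    have "sigma x0 y0 j = g j" if "j \<in> V1" for j
      using that disj k(3) fun_cong[OF k(1), of j] by (auto simp: A2.Gm_def)
    then have "age V1 g = (\<Sum>j\<in>V1. sigma x0 y0 j)" by (simp add: age_def)
    also have "\<dots> = (\<Sum>j\<in>V1. if j = x0 then 1/2 else 0)"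
      by (rule sum.cong) (use xV in \<open>auto simp: sigma_def\<close>)
    also have "\<dots> = 1/2" using A1.finite_V assms(3) by simp
    finally have "age V1 g = 1/2" .
    then show False using k(2) half by (simp only:)
  qed
  have sA: "sigma x0 y0 \<notin> K.ann G"
  proof
    assume ann: "sigma x0 y0 \<in> K.ann G"
    \<comment> \<open>The grading operator of \<open>W1\<close>, with zero component on the second
      set of variables, lies in \<open>G\<close> and pairs with \<sigma> to 1/2.\<close>
    define k where "k = grading_op V1 W1"
    have "(\<lambda>j. k j + (\<lambda>_. 0) j) \<in> group_prod (J_group V1 W1) (J_group V2 W2)"
    proof -
      have "k \<in> J_group V1 W1" unfolding J_group_def k_def by (rule generate.incl) simp
      moreover have "(\<lambda>_. 0) \<in> J_group V2 W2"
        using generate.one[of "QZ_group V2" "{grading_op V2 W2}"] by (simp add: J_group_def)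
      ultimately show ?thesis unfolding group_prod_def
        by (intro CollectI exI[of _ k] exI[of _ "\<lambda>_. 0"]) simp
    qed
    then have kG: "k \<in> G" using assms(20) by auto
    obtain q where q: "q = weights V1 (A1.wpoly V1)" "\<And>i. i \<in> V1 \<Longrightarrow> A1.symm_weights q i = 1"
      "\<And>i. i \<notin> V1 \<Longrightarrow> q i = 0"
      using A1.weights_wpoly by metis
    have kq: "k j = frac (q j)" for j by (simp add: k_def grading_op_def q(1) W1p)
    have "q x0 = 1/2" using q(2)[OF assms(3)] W1 by (simp add: A1.symm_weights_def)
    then have "k x0 = 1/2" using kq[of x0] frac_unit[of "1/2"] by simp
    moreover have "k y0 = 0" using kq[of y0] q(3)[OF xV(4)] by simp
    moreover have "K.pair (sigma x0 y0) k = (W.symm_weights k (\<pi> x0) + W.symm_weights k (\<pi> y0)) / 2"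
      unfolding K.pair_def by (rule sum_sigma_mult[OF W.finite_V xV(1-3)])
    ultimately have pk: "K.pair (sigma x0 y0) k = 1/2"
      using x0 y0 by (simp add: px py W.symm_weights_def)
    have "K.pair (sigma x0 y0) k \<in> \<int>" using ann kG by (simp add: K.ann_def)
    then show False using half by (simp only: pk)
  qed
  have GT: "GT = K.ann G"
  proof -
    have "(\<Sum>i\<in>V. \<Sum>j\<in>V. g i * of_nat (lkp (A i) j) * h j) = K.pair g h" for g h
      unfolding K.pair_def
    proof (rule sum.cong[OF refl])
      fix i assume i: "i \<in> V"
      have "(\<Sum>j\<in>V. g i * of_nat (lkp (A i) j) * h j) = g i * (\<Sum>j\<in>V. of_nat (lkp (W.row (\<pi> i)) j) * h j)"
        by (simp add: sum_distrib_left Api[OF i] W.row_eq_mrow mult.assoc)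
      then show "(\<Sum>j\<in>V. g i * of_nat (lkp (A i) j) * h j) = g i * W.symm_weights h (\<pi> i)"
        by (simp add: W.sum_row[OF K.pi_V[OF i]])
    qed
    then show ?thesis
      unfolding assms(22) transpose_group_def WTp K.T.G_max_eq K.ann_def by simp
  qed
  interpret B: borcea_voisin V a nx pv c aT nxT pvT "\<lambda>_. 1" \<pi> \<rho> x0 y0 G
    by (intro borcea_voisin.intro K borcea_voisin_axioms.intro) (fact xV x0 y0 px py assms GW sG sA)+
  show ?thesis
    unfolding assms(18) WTp Wp assms(23,24) GT by (rule B.mirror_isomorphism)
qed

end
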